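(* Let $W$ be an irreducible real reflection group and let $k\ge1$ be an integer. Let $\mathcal{R}\subset\mathrm{Hom}_{\mathbb{C}[W]}(V^*,\mathbb{C}[V]_{kh+1})$ be the set of all $\Theta$ such that $\Theta$ is an h.s.o.p. and the parking locus $V^\Theta(k)$ is reduced. Then the following two assertions are equivalent. (Intermediate Conjecture for $(W,k)$) There exists an h.s.o.p. $\Theta\in\mathrm{Hom}_{\mathbb{C}[W]}(V^*,\mathbb{C}[V]_{kh+1})$ such that $V^\Theta(k)$ is reduced and there is a $W\times\mathbb{Z}_{kh}$-equivariant bijection between $V^\Theta(k)$ and $\mathrm{Park}^{NC}_W(k)$. (Generic Strong Conjecture for $(W,k)$) For every $\Theta\in\mathcal{R}$ there is a $W\times\mathbb{Z}_{kh}$-equivariant bijection between $V^\Theta(k)$ and $\mathrm{Park}^{NC}_W(k)$; and there is a nonempty Zariski open subset $\mathcal{U}$ of the affine space $\mathrm{Hom}_{\mathbb{C}[W]}(V^*,\mathbb{C}[V]_{kh+1})$ with $\mathcal{U}\subseteq\mathcal{R}$.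
   Context: Reflection groups. A real reflection group $W$ is a finite group generated by orthogonal reflections of a real Euclidean space; here it is irreducible, and $V$ denotes the complexification of its reflection representation. $T\subset W$ is the set of all reflections; $c\in W$ is a fixed Coxeter element (a conjugate of a product of all the simple reflections in some order); $h$ is the order of $c$. $\mathbb{Z}_{kh}=\langle g\rangle$ is a cyclic group of order $kh$ with distinguished generator $g$, and $\zeta=e^{2\pi i/(kh)}$. Parking locus. $\mathbb{C}[V]=\bigoplus_d\mathbb{C}[V]_d$ is the graded ring of polynomial functions on $V$, with $(w.f)(v)=f(w^{-1}v)$. An element $\Theta\in\mathrm{Hom}_{\mathbb{C}[W]}(V^*,\mathbb{C}[V]_{kh+1})$ is identified with the $W$-equivariant homogeneous polynomial map $\Theta:V\to V$ of degree $kh+1$ determined by $x(\Theta(v))=\Theta(x)(v)$ for $x\in V^*$, $v\in V$. It is an h.s.o.p. (homogeneous system of parameters of degree $kh+1$ carrying $V^*$) if $\Theta^{-1}(0)=\{0\}$. The parking locus $V^\Theta(k)$ is the subscheme of $V$ cut out by the ideal generated by all $\Theta(x)-x$, $x\in V^*$. When it is reduced, it is identified with the finite set $\{v\in V:\Theta(v)=v\}$, on which $W\times\mathbb{Z}_{kh}$ acts by $(w,g^d).v=\zeta^d\,w.v$. Noncrossing parking functions. The set $\mathcal{L}$ of flats consists of all intersections of reflecting hyperplanes of $W$ in $V$ (including $V$). For $X\subseteq V$, $W_X=\{w\in W: w.x=x\ \forall x\in X\}$; for $w\in W$, $V^w$ is the fixed space. $\ell_T(w)$ is the minimal number of elements of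 $T$ whose product is $w$; $u\le_T w$ iff $\ell_T(w)=\ell_T(u)+\ell_T(u^{-1}w)$. Elements of $NC(W)=[e,c]_T$ are called noncrossing; $w\mapsto V^w$ is injective on $NC(W)$, and flats in its image are noncrossing flats. A noncrossing $k$-flat is a multichain $X_1\supseteq\cdots\supseteq X_k$ of noncrossing flats; it corresponds to the multichain $u_1\le_T\cdots\le_T u_k$ in $NC(W)$ with $V^{u_i}=X_i$. The map $\partial(u_1,\dots,u_k)=(u_1,u_1^{-1}u_2,\dots,u_{k-1}^{-1}u_k,u_k^{-1}c)$ is a bijection from such multichains to the set of sequences $(w_0,\dots,w_k)\in W^{k+1}$ with $w_0\cdots w_k=c$ and $\sum\ell_T(w_i)=\ell_T(c)$. The group $\mathbb{Z}_{kh}$ acts on the latter set by $g.(w_0,\dots,w_k)=(v,cw_kc^{-1},w_1,\dots,w_{k-1})$ with $v=(cw_kc^{-1})w_0(cw_kc^{-1})^{-1}$; transferring through $\partial$ and taking fixed spaces gives an action on noncrossing $k$-flats. $\mathrm{Park}^{NC}_W(k)$ is the set of equivalence classes $[w,X_1\supseteq\cdots\supseteq X_k]$ of pairs ($w\in W$, a noncrossing $k$-flat), where $(w,X_1\supseteq\cdots\supseteq X_k)\sim(w',X_1'\supseteq\cdots\supseteq X_k')$ iff $X_i=X_i'$ for all $i$ and $wW_{X_1}=w'W_{X_1}$. The group $W\times\mathbb{Z}_{kh}$ acts on it by $(v,g).[w,X_1\supseteq\cdots\supseteq X_k]=[vwu_kc^{-1},\,g.(X_1\supseteq\cdots\supseteq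 X_k)]$ and $(v,e).[w,X_1\supseteq\cdots\supseteq X_k]=[vw,X_1\supseteq\cdots\supseteq X_k]$, where $u_k$ is the noncrossing element with $V^{u_k}=X_k$. *)

theory Defs
  imports "HOL-Analysis.Analysis" "HOL-Algebra.Elementary_Groups" "HOL-Algebra.Multiplicative_Group"
    "HOL-Algebra.QuotRing"
begin

section \<open>Real reflection groups\<close>

text \<open>The Euclidean space is \<open>real ^ 'n\<close>, with \<open>'n\<close> of arbitrary finite positive size.
  Elements of \<open>W\<close> are orthogonal matrices.\<close>

definition reflection :: "real ^ 'n \<Rightarrow> real ^ 'n ^ 'n" where
  "reflection a = matrix (\<lambda>x. x - (2 * (x \<bullet> a) / (a \<bullet> a)) *\<^sub>R a)"

definition orthogonal_group_mat :: "(real ^ 'n ^ 'n) monoid" where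
  "orthogonal_group_mat =
     \<lparr>carrier = {A. orthogonal_matrix A}, mult = (**), one = mat 1\<rparr>"

definition subgroup_of :: "(real ^ 'n ^ 'n) set \<Rightarrow> (real ^ 'n ^ 'n) monoid" where
  "subgroup_of W = orthogonal_group_mat\<lparr>carrier := W\<rparr>"

definition real_reflection_group :: "(real ^ 'n ^ 'n) set \<Rightarrow> bool" where
  "real_reflection_group W \<longleftrightarrow>
     finite W \<and> (\<exists>S \<subseteq> reflection ` (- {0}). W = generate orthogonal_group_mat S)"

definition reflections :: "(real ^ 'n ^ 'n) set \<Rightarrow> (real ^ 'n ^ 'n) set" where
  "reflections W = W \<inter> reflection ` (- {0})"

text \<open>The condition \<open>reflections W \<noteq> {}\<close> only excludes the trivial group acting on a line.\<close>

definition irreducible_reflection_group :: "(real ^ 'n ^ 'n) set \<Rightarrow> bool" where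
  "irreducible_reflection_group W \<longleftrightarrow>
     real_reflection_group W \<and> reflections W \<noteq> {} \<and>
     (\<forall>U. subspace U \<and> (\<forall>w\<in>W. \<forall>x\<in>U. w *v x \<in> U) \<longrightarrow> U = {0} \<or> U = UNIV)"

definition unit_roots :: "(real ^ 'n ^ 'n) set \<Rightarrow> (real ^ 'n) set" where
  "unit_roots W = {a. norm a = 1 \<and> reflection a \<in> W}"

definition simple_system :: "(real ^ 'n ^ 'n) set \<Rightarrow> (real ^ 'n) set \<Rightarrow> bool" where
  "simple_system W \<Delta> \<longleftrightarrow>
     \<Delta> \<subseteq> unit_roots W \<and> independent \<Delta> \<and>
     (\<forall>a \<in> unit_roots W. \<exists>f. a = (\<Sum>b\<in>\<Delta>. f b *\<^sub>R b) \<and>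
        ((\<forall>b\<in>\<Delta>. 0 \<le> f b) \<or> (\<forall>b\<in>\<Delta>. f b \<le> 0)))"

definition mat_prod :: "(real ^ 'n ^ 'n) list \<Rightarrow> real ^ 'n ^ 'n" where
  "mat_prod ws = foldr (**) ws (mat 1)"

definition coxeter_element :: "(real ^ 'n ^ 'n) set \<Rightarrow> real ^ 'n ^ 'n \<Rightarrow> bool" where
  "coxeter_element W c \<longleftrightarrow>
     (\<exists>\<Delta> bs w. simple_system W \<Delta> \<and> set bs = \<Delta> \<and> distinct bs \<and> w \<in> W \<and>
        c = w ** mat_prod (map reflection bs) ** matrix_inv w)"

text \<open>The order \<open>h\<close> of \<open>c\<close>.\<close>

definition coxeter_number :: "(real ^ 'n ^ 'n) set \<Rightarrow> real ^ 'n ^ 'n \<Rightarrow> nat" where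
  "coxeter_number W c = group.ord (subgroup_of W) c"

text \<open>The action on the complexification \<open>V = complex ^ 'n\<close>.\<close>

definition cact :: "real ^ 'n ^ 'n \<Rightarrow> complex ^ 'n \<Rightarrow> complex ^ 'n" where
  "cact w v = map_matrix complex_of_real w *v v"


section \<open>The parking locus\<close>

definition dual_space :: "(complex ^ 'n \<Rightarrow> complex) set" where
  "dual_space = {x. Vector_Spaces.linear (*s) (*) x}"

text \<open>Polynomial functions on \<open>V\<close>; since the field is infinite these are the same as
  polynomials.\<close>

definition poly_funs_deg :: "nat \<Rightarrow> (complex ^ 'n \<Rightarrow> complex) set" where
  "poly_funs_deg d =
     {f. \<exists>a :: ('n \<Rightarrow> nat) \<Rightarrow> complex.
          f = (\<lambda>v. \<Sum>m | (\<Sum>i\<in>UNIV. m i) = d. a m * (\<Prod>i\<in>UNIV. (v $ i) ^ m i))}"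

definition poly_funs :: "(complex ^ 'n \<Rightarrow> complex) set" where
  "poly_funs = {f. \<exists>N p. (\<forall>d\<le>N. p d \<in> poly_funs_deg d) \<and> f = (\<lambda>v. \<Sum>d\<le>N. p d v)}"

definition poly_ring :: "(complex ^ 'n \<Rightarrow> complex) ring" where
  "poly_ring =
     \<lparr>carrier = poly_funs, mult = (\<lambda>f g v. f v * g v), one = (\<lambda>v. 1),
      ring.zero = (\<lambda>v. 0), add = (\<lambda>f g v. f v + g v)\<rparr>"

text \<open>\<open>equivariant_maps W d\<close> is \<open>Hom_{C[W]}(V*, C[V]_d)\<close>: a map \<open>\<Theta> : V \<rightarrow> V\<close> stands for the
  homomorphism sending \<open>x\<close> to \<open>x \<circ> \<Theta>\<close>.\<close>

definition equivariant_maps ::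
    "(real ^ 'n ^ 'n) set \<Rightarrow> nat \<Rightarrow> (complex ^ 'n \<Rightarrow> complex ^ 'n) set" where
  "equivariant_maps W d =
     {\<Theta>. (\<forall>x \<in> dual_space. x \<circ> \<Theta> \<in> poly_funs_deg d) \<and>
          (\<forall>w\<in>W. \<forall>v. \<Theta> (cact w v) = cact w (\<Theta> v))}"

definition hsop :: "(complex ^ 'n \<Rightarrow> complex ^ 'n) \<Rightarrow> bool" where
  "hsop \<Theta> \<longleftrightarrow> \<Theta> -` {0} = {0}"

definition parking_ideal ::
    "(complex ^ 'n \<Rightarrow> complex ^ 'n) \<Rightarrow> (complex ^ 'n \<Rightarrow> complex) set" where
  "parking_ideal \<Theta> = Idl\<^bsub>poly_ring\<^esub> {\<lambda>v. x (\<Theta> v) - x v | x. x \<in> dual_space}"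

definition reduced_ring :: "('a, 'b) ring_scheme \<Rightarrow> bool" where
  "reduced_ring R \<longleftrightarrow>
     (\<forall>a \<in> carrier R. \<forall>n::nat. a [^]\<^bsub>R\<^esub> n = \<zero>\<^bsub>R\<^esub> \<longrightarrow> a = \<zero>\<^bsub>R\<^esub>)"

text \<open>The parking locus is an affine scheme, hence reduced iff its coordinate ring is.\<close>

definition parking_locus_reduced :: "(complex ^ 'n \<Rightarrow> complex ^ 'n) \<Rightarrow> bool" where
  "parking_locus_reduced \<Theta> \<longleftrightarrow> reduced_ring (poly_ring Quot parking_ideal \<Theta>)"

definition parking_locus :: "(complex ^ 'n \<Rightarrow> complex ^ 'n) \<Rightarrow> (complex ^ 'n) set" where
  "parking_locus \<Theta> = {v. \<Theta> v = v}"

text \<open>\<open>W \<times> Z_{kh}\<close>; the integer \<open>d \<in> {0..<kh}\<close> stands for \<open>g^d\<close>.\<close>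

definition acting_group ::
    "(real ^ 'n ^ 'n) set \<Rightarrow> real ^ 'n ^ 'n \<Rightarrow> nat \<Rightarrow> ((real ^ 'n ^ 'n) \<times> int) monoid" where
  "acting_group W c k = subgroup_of W \<times>\<times> integer_mod_group (k * coxeter_number W c)"

definition locus_act ::
    "(real ^ 'n ^ 'n) set \<Rightarrow> real ^ 'n ^ 'n \<Rightarrow> nat \<Rightarrow>
     (real ^ 'n ^ 'n) \<times> int \<Rightarrow> complex ^ 'n \<Rightarrow> complex ^ 'n" where
  "locus_act W c k = (\<lambda>(w, d) v.
     exp (2 * of_real pi * \<i> / of_nat (k * coxeter_number W c)) ^ nat d *s cact w v)"


section \<open>Noncrossing parking functions\<close>

definition fixed_space :: "real ^ 'n ^ 'n \<Rightarrow> (complex ^ 'n) set" where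
  "fixed_space w = {v. cact w v = v}"

definition flats :: "(real ^ 'n ^ 'n) set \<Rightarrow> (complex ^ 'n) set set" where
  "flats W = {\<Inter>\<H> | \<H>. \<H> \<subseteq> fixed_space ` reflections W}"

definition pointwise_stabilizer ::
    "(real ^ 'n ^ 'n) set \<Rightarrow> (complex ^ 'n) set \<Rightarrow> (real ^ 'n ^ 'n) set" where
  "pointwise_stabilizer W X = {w \<in> W. \<forall>x\<in>X. cact w x = x}"

definition abs_length :: "(real ^ 'n ^ 'n) set \<Rightarrow> real ^ 'n ^ 'n \<Rightarrow> nat" where
  "abs_length W w =
     (LEAST r. \<exists>ts. set ts \<subseteq> reflections W \<and> length ts = r \<and> mat_prod ts = w)"

definition abs_le :: "(real ^ 'n ^ 'n) set \<Rightarrow> real ^ 'n ^ 'n \<Rightarrow> real ^ 'n ^ 'n \<Rightarrow> bool" where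
  "abs_le W u w \<longleftrightarrow> abs_length W w = abs_length W u + abs_length W (matrix_inv u ** w)"

definition NC :: "(real ^ 'n ^ 'n) set \<Rightarrow> real ^ 'n ^ 'n \<Rightarrow> (real ^ 'n ^ 'n) set" where
  "NC W c = {u \<in> W. abs_le W (mat 1) u \<and> abs_le W u c}"

definition noncrossing_flats ::
    "(real ^ 'n ^ 'n) set \<Rightarrow> real ^ 'n ^ 'n \<Rightarrow> (complex ^ 'n) set set" where
  "noncrossing_flats W c = flats W \<inter> fixed_space ` NC W c"

text \<open>Multichains of length \<open>k\<close> are lists \<open>[X\<^sub>1, \<dots>, X\<^sub>k]\<close>, respectively \<open>[u\<^sub>1, \<dots>, u\<^sub>k]\<close>.\<close>

definition noncrossing_kflats ::
    "(real ^ 'n ^ 'n) set \<Rightarrow> real ^ 'n ^ 'n \<Rightarrow> nat \<Rightarrow> (complex ^ 'n) set list set" where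
  "noncrossing_kflats W c k =
     {Xs. length Xs = k \<and> set Xs \<subseteq> noncrossing_flats W c \<and> sorted_wrt (\<supseteq>) Xs}"

definition nc_multichains ::
    "(real ^ 'n ^ 'n) set \<Rightarrow> real ^ 'n ^ 'n \<Rightarrow> nat \<Rightarrow> (real ^ 'n ^ 'n) list set" where
  "nc_multichains W c k = {us. length us = k \<and> set us \<subseteq> NC W c \<and> sorted_wrt (abs_le W) us}"

text \<open>The noncrossing element \<open>u\<close> with \<open>V^u = X\<close>, for a noncrossing flat \<open>X\<close>.\<close>

definition nc_elt :: "(real ^ 'n ^ 'n) set \<Rightarrow> real ^ 'n ^ 'n \<Rightarrow> (complex ^ 'n) set \<Rightarrow> real ^ 'n ^ 'n"
  where "nc_elt W c = the_inv_into (NC W c) fixed_space"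

text \<open>The map \<open>\<partial>\<close>, sending \<open>[u\<^sub>1, \<dots>, u\<^sub>k]\<close> to \<open>[u\<^sub>1, u\<^sub>1\<^sup>-\<^sup>1 u\<^sub>2, \<dots>, u\<^sub>k\<^sup>-\<^sup>1 c]\<close>.\<close>

definition bdry :: "real ^ 'n ^ 'n \<Rightarrow> (real ^ 'n ^ 'n) list \<Rightarrow> (real ^ 'n ^ 'n) list" where
  "bdry c us = map2 (\<lambda>u u'. matrix_inv u ** u') (mat 1 # us) (us @ [c])"

text \<open>The generator \<open>g\<close> acting on factorizations \<open>[w\<^sub>0, \<dots>, w\<^sub>k]\<close> of \<open>c\<close>, for \<open>k \<ge> 1\<close>.\<close>

definition rotate_factorization ::
    "real ^ 'n ^ 'n \<Rightarrow> (real ^ 'n ^ 'n) list \<Rightarrow> (real ^ 'n ^ 'n) list" where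
  "rotate_factorization c ws =
     (let y = c ** last ws ** matrix_inv c
      in (y ** hd ws ** matrix_inv y) # y # butlast (tl ws))"

definition rotate_kflat ::
    "(real ^ 'n ^ 'n) set \<Rightarrow> real ^ 'n ^ 'n \<Rightarrow> nat \<Rightarrow>
     (complex ^ 'n) set list \<Rightarrow> (complex ^ 'n) set list" where
  "rotate_kflat W c k Xs =
     map fixed_space
       (the_inv_into (nc_multichains W c k) (bdry c)
         (rotate_factorization c (bdry c (map (nc_elt W c) Xs))))"

definition park_rel ::
    "(real ^ 'n ^ 'n) set \<Rightarrow> real ^ 'n ^ 'n \<Rightarrow> nat \<Rightarrow>
     ((real ^ 'n ^ 'n) \<times> (complex ^ 'n) set list) rel" where
  "park_rel W c k =
     {((w, Xs), (w', Xs')).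
        w \<in> W \<and> w' \<in> W \<and> Xs \<in> noncrossing_kflats W c k \<and> Xs = Xs' \<and>
        (**) w ` pointwise_stabilizer W (hd Xs) = (**) w' ` pointwise_stabilizer W (hd Xs)}"

definition Park_NC ::
    "(real ^ 'n ^ 'n) set \<Rightarrow> real ^ 'n ^ 'n \<Rightarrow> nat \<Rightarrow>
     ((real ^ 'n ^ 'n) \<times> (complex ^ 'n) set list) set set" where
  "Park_NC W c k = (W \<times> noncrossing_kflats W c k) // park_rel W c k"

text \<open>Both actions are given on representatives and applied to a class by saturating the image
  of that class.\<close>

definition park_W_act ::
    "(real ^ 'n ^ 'n) set \<Rightarrow> real ^ 'n ^ 'n \<Rightarrow> nat \<Rightarrow> real ^ 'n ^ 'n \<Rightarrow>
     ((real ^ 'n ^ 'n) \<times> (complex ^ 'n) set list) set \<Rightarrow>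
     ((real ^ 'n ^ 'n) \<times> (complex ^ 'n) set list) set" where
  "park_W_act W c k v C = park_rel W c k `` ((\<lambda>(w, Xs). (v ** w, Xs)) ` C)"

definition park_gen_act ::
    "(real ^ 'n ^ 'n) set \<Rightarrow> real ^ 'n ^ 'n \<Rightarrow> nat \<Rightarrow>
     ((real ^ 'n ^ 'n) \<times> (complex ^ 'n) set list) set \<Rightarrow>
     ((real ^ 'n ^ 'n) \<times> (complex ^ 'n) set list) set" where
  "park_gen_act W c k C =
     park_rel W c k ``
       ((\<lambda>(w, Xs). (w ** nc_elt W c (last Xs) ** matrix_inv c, rotate_kflat W c k Xs)) ` C)"

definition park_act ::
    "(real ^ 'n ^ 'n) set \<Rightarrow> real ^ 'n ^ 'n \<Rightarrow> nat \<Rightarrow> (real ^ 'n ^ 'n) \<times> int \<Rightarrow>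
     ((real ^ 'n ^ 'n) \<times> (complex ^ 'n) set list) set \<Rightarrow>
     ((real ^ 'n ^ 'n) \<times> (complex ^ 'n) set list) set" where
  "park_act W c k = (\<lambda>(v, d) C. park_W_act W c k v ((park_gen_act W c k ^^ nat d) C))"



section \<open>The two conjectures\<close>

definition equivariant_bijection ::
    "('g, 'm) monoid_scheme \<Rightarrow> ('g \<Rightarrow> 'a \<Rightarrow> 'a) \<Rightarrow> 'a set \<Rightarrow> ('g \<Rightarrow> 'b \<Rightarrow> 'b) \<Rightarrow> 'b set \<Rightarrow>
     ('a \<Rightarrow> 'b) \<Rightarrow> bool" where
  "equivariant_bijection G \<alpha> A \<beta> B \<phi> \<longleftrightarrow>
     bij_betw \<phi> A B \<and> (\<forall>g \<in> carrier G. \<forall>a\<in>A. \<phi> (\<alpha> g a) = \<beta> g (\<phi> a))"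

definition locus_equivalent_to_park ::
    "(real ^ 'n ^ 'n) set \<Rightarrow> real ^ 'n ^ 'n \<Rightarrow> nat \<Rightarrow> (complex ^ 'n \<Rightarrow> complex ^ 'n) \<Rightarrow> bool" where
  "locus_equivalent_to_park W c k \<Theta> \<longleftrightarrow>
     (\<exists>\<phi>. equivariant_bijection (acting_group W c k)
            (locus_act W c k) (parking_locus \<Theta>) (park_act W c k) (Park_NC W c k) \<phi>)"

text \<open>Polynomial functions on a linear space \<open>H\<close> of maps into \<open>complex ^ 'n\<close>, coordinate-free: the
  algebra generated by the linear functionals on \<open>H\<close>. Only values on \<open>H\<close> matter.\<close>

definition linear_functionals_on ::
    "('v \<Rightarrow> complex ^ 'n) set \<Rightarrow> (('v \<Rightarrow> complex ^ 'n) \<Rightarrow> complex) set" where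
  "linear_functionals_on H =
     {l. \<forall>\<Theta>\<in>H. \<forall>\<Theta>'\<in>H. \<forall>a b. l (\<lambda>v. a *s \<Theta> v + b *s \<Theta>' v) = a * l \<Theta> + b * l \<Theta>'}"

inductive_set polynomials_on ::
    "('v \<Rightarrow> complex ^ 'n) set \<Rightarrow> (('v \<Rightarrow> complex ^ 'n) \<Rightarrow> complex) set"
  for H where
    const: "(\<lambda>_. a) \<in> polynomials_on H"
  | linear: "l \<in> linear_functionals_on H \<Longrightarrow> l \<in> polynomials_on H"
  | add: "p \<in> polynomials_on H \<Longrightarrow> q \<in> polynomials_on H \<Longrightarrow> (\<lambda>\<Theta>. p \<Theta> + q \<Theta>) \<in> polynomials_on H"
  | mult: "p \<in> polynomials_on H \<Longrightarrow> q \<in> polynomials_on H \<Longrightarrow> (\<lambda>\<Theta>. p \<Theta> * q \<Theta>) \<in> polynomials_on H"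

definition zariski_open_in ::
    "('v \<Rightarrow> complex ^ 'n) set \<Rightarrow> ('v \<Rightarrow> complex ^ 'n) set \<Rightarrow> bool" where
  "zariski_open_in H U \<longleftrightarrow>
     (\<exists>P \<subseteq> polynomials_on H. U = H - {\<Theta> \<in> H. \<forall>p\<in>P. p \<Theta> = 0})"

text \<open>\<open>Hom_{C[W]}(V*, C[V]_{kh+1})\<close> and its subset \<open>\<R>\<close>.\<close>

definition parking_maps ::
    "(real ^ 'n ^ 'n) set \<Rightarrow> real ^ 'n ^ 'n \<Rightarrow> nat \<Rightarrow> (complex ^ 'n \<Rightarrow> complex ^ 'n) set" where
  "parking_maps W c k = equivariant_maps W (k * coxeter_number W c + 1)"

definition reduced_hsops ::
    "(real ^ 'n ^ 'n) set \<Rightarrow> real ^ 'n ^ 'n \<Rightarrow> nat \<Rightarrow> (complex ^ 'n \<Rightarrow> complex ^ 'n) set" where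
  "reduced_hsops W c k = {\<Theta> \<in> parking_maps W c k. hsop \<Theta> \<and> parking_locus_reduced \<Theta>}"

definition intermediate_conjecture ::
    "(real ^ 'n ^ 'n) set \<Rightarrow> real ^ 'n ^ 'n \<Rightarrow> nat \<Rightarrow> bool" where
  "intermediate_conjecture W c k \<longleftrightarrow>
     (\<exists>\<Theta> \<in> parking_maps W c k. hsop \<Theta> \<and> parking_locus_reduced \<Theta> \<and>
        locus_equivalent_to_park W c k \<Theta>)"

definition generic_strong_conjecture ::
    "(real ^ 'n ^ 'n) set \<Rightarrow> real ^ 'n ^ 'n \<Rightarrow> nat \<Rightarrow> bool" where
  "generic_strong_conjecture W c k \<longleftrightarrow>
     (\<forall>\<Theta> \<in> reduced_hsops W c k. locus_equivalent_to_park W c k \<Theta>) \<and>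
     (\<exists>U. zariski_open_in (parking_maps W c k) U \<and> U \<noteq> {} \<and> U \<subseteq> reduced_hsops W c k)"

end

theory Submission
  imports Defs "HOL-Library.Function_Algebras" "HOL-Computational_Algebra.Fundamental_Theorem_Algebra"
begin

text \<open>Let \<open>F\<^sub>i = \<Theta>\<^sub>i - x\<^sub>i\<close>. For an h.s.o.p. \<open>\<Theta>\<close> the fixed point set is finite, and the ideal of the
  \<open>F\<^sub>i\<close> is radical iff all fixed points are nondegenerate, that is \<open>E = det (D\<Theta> - 1)\<close> vanishes at none
  of them. Being a nondegenerate h.s.o.p. is certified by two spanning conditions: the products of
  the \<open>\<Theta>\<^sub>i\<close> with forms span the forms of some degree \<open>N\<close>, and the multiples of the \<open>F\<^sub>i\<close> and of \<open>E\<close>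
  of bounded degree span the polynomials of degree at most some \<open>M\<close>. By the Nullstellensatz
  every nondegenerate h.s.o.p. satisfies such conditions, and spanning conditions are Zariski open.
  Hence \<open>\<R>\<close> is Zariski open. Two members of \<open>\<R>\<close> are joined by a complex line that meets the
  complement of \<open>\<R>\<close> in finitely many points only; along the rest of the line, which is connected,
  the fixed points move continuously without collision or escape to infinity, and since the group
  acts by isometries commuting with this motion, the fixed point sets stay equivariantly
  isomorphic.\<close>

section \<open>Spaces of functions\<close>

text \<open>That 1 lies in the ideal generated by the F_i and E says that these have no common zero,
  but membership of one vector in a span can be lost under perturbation of \<Theta>. Spanning a
  fixed finite-dimensional space is a full-rank condition and therefore stable. Passing from the
  former to the latter requires control of degrees. Since \<Theta> has degree d \<ge> 2, the leading
  form of F_i is that of \<Theta>, and the components of an h.s.o.p. generate all forms of large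
  degree; so every polynomial reduces modulo the F_i to degree at most some N, with cofactors of
  bounded degree. Rank is tested by evaluating functions at points, and evaluation is linear in
  \<Theta>, so no coordinates on the space of equivariant maps have to be chosen. The
  Nullstellensatz rests on the uncountability of the complex numbers: a field generated by countably
  many elements over them cannot hold all the inverses of x_i - \<alpha> independently. The line has
  to be complex: a real segment may be cut by the bad parameters, whereas finitely many points do
  not disconnect the plane.\<close>

definition fun_scale :: "'k::field \<Rightarrow> ('x \<Rightarrow> 'k) \<Rightarrow> 'x \<Rightarrow> 'k" where
  "fun_scale c f = (\<lambda>x. c * f x)"

lemma fun_scale_apply [simp]: "fun_scale c f x = c * f x"
  by (simp add: fun_scale_def)

interpretation fun_space: vector_space fun_scale
  by unfold_locales (auto simp: fun_eq_iff algebra_simps)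

lemma sum_fun_apply: "(\<Sum>i\<in>A. F i) x = (\<Sum>i\<in>A. F i x)"
  for F :: "'i \<Rightarrow> 'x \<Rightarrow> 'k::comm_monoid_add"
  by (induction A rule: infinite_finite_induct) auto

text \<open>Independence of an indexed family rather than of a set: the index set stays fixed while
  the functions vary with a parameter, and a repeated function counts as a dependence.\<close>

definition indep_family :: "'i set \<Rightarrow> ('i \<Rightarrow> 'x \<Rightarrow> 'k::field) \<Rightarrow> bool" where
  "indep_family K f \<longleftrightarrow>
     (\<forall>c. (\<forall>x. (\<Sum>k\<in>K. c k * f k x) = 0) \<longrightarrow> (\<forall>k\<in>K. c k = 0))"

lemma indep_familyD:
  assumes "indep_family K f" "\<And>x. (\<Sum>k\<in>K. c k * f k x) = 0" "k \<in> K"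
  shows "c k = 0"
  using assms(1)[unfolded indep_family_def, rule_format, of c k] assms(2,3) by blast

lemma indep_familyI:
  assumes "\<And>c k. (\<And>x. (\<Sum>k\<in>K. c k * f k x) = 0) \<Longrightarrow> k \<in> K \<Longrightarrow> c k = 0"
  shows "indep_family K f"
  unfolding indep_family_def using assms by blast

lemma indep_family_imp_independent:
  fixes f :: "'i \<Rightarrow> 'x \<Rightarrow> 'k::field"
  assumes K: "finite K" and f: "indep_family K f"
  shows "inj_on f K" and "fun_space.independent (f ` K)"
proof -
  show inj: "inj_on f K"
  proof (rule inj_onI, rule ccontr)
    fix k l assume kl: "k \<in> K" "l \<in> K" "f k = f l" "k \<noteq> l"
    let ?c = "\<lambda>i. if i = k then 1 else if i = l then - 1 else (0 :: 'k)"
    have "(\<Sum>i\<in>K. ?c i * f i x) = 0" for x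
    proof -
      have "(\<Sum>i\<in>K. ?c i * f i x) = (\<Sum>i\<in>{k, l}. ?c i * f i x)"
        by (rule sum.mono_neutral_right) (use K kl in auto)
      also have "\<dots> = 0"
        using kl by simp
      finally show ?thesis .
    qed
    then have "\<forall>i\<in>K. ?c i = 0"
      using indep_familyD[OF f, of ?c] by blast
    then show False using kl(1) by (auto dest: bspec[of _ _ k])
  qed
  show "fun_space.independent (f ` K)"
  proof
    assume "fun_space.dependent (f ` K)"
    then obtain u where u: "\<exists>v\<in>f ` K. u v \<noteq> 0" "(\<Sum>v\<in>f ` K. fun_scale (u v) v) = 0"
      using fun_space.dependent_finite[of "f ` K"] K by blast
    have "(\<Sum>k\<in>K. u (f k) * f k x) = 0" for x
    proof -
      have "(\<Sum>k\<in>K. u (f k) * f k x) = (\<Sum>v\<in>f ` K. fun_scale (u v) v) x"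
        unfolding sum_fun_apply by (simp add: sum.reindex[OF inj])
      then show ?thesis using u(2) by simp
    qed
    then have "\<forall>k\<in>K. u (f k) = 0"
      using indep_familyD[OF f, of "\<lambda>k. u (f k)"] by blast
    with u(1) show False by auto
  qed
qed

lemma independent_imp_indep_family:
  assumes K: "finite K" and inj: "inj_on f K" and ind: "fun_space.independent (f ` K)"
  shows "indep_family K f"
  unfolding indep_family_def
proof (intro allI impI ballI)
  fix c k assume c: "\<forall>x. (\<Sum>k\<in>K. c k * f k x) = 0" and k: "k \<in> K"
  let ?u = "\<lambda>v. c (the_inv_into K f v)"
  have z: "(\<Sum>v\<in>f ` K. fun_scale (?u v) v) = 0"
  proof
    fix x
    have "(\<Sum>v\<in>f ` K. fun_scale (?u v) v) x = (\<Sum>k\<in>K. ?u (f k) * f k x)"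
      unfolding sum_fun_apply by (simp add: sum.reindex[OF inj])
    also have "\<dots> = (\<Sum>k\<in>K. c k * f k x)"
      by (rule sum.cong) (simp_all add: the_inv_into_f_f[OF inj])
    finally show "(\<Sum>v\<in>f ` K. fun_scale (?u v) v) x = 0 x"
      using c by simp
  qed
  have "?u (f k) = 0"
    by (rule fun_space.independentD[OF ind _ order_refl z]) (use K k in auto)
  then show "c k = 0"
    using k by (simp add: the_inv_into_f_f[OF inj])
qed

lemma indep_family_card_le:
  assumes "finite K" "indep_family K f" "finite B" "f ` K \<subseteq> fun_space.span B"
  shows "card K \<le> card B"
proof -
  have "card (f ` K) \<le> card B"
    by (rule fun_space.independent_span_bound[OF assms(3)
          indep_family_imp_independent(2)[OF assms(1,2)] assms(4), THEN conjunct2])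
  then show ?thesis
    by (simp only: card_image[OF indep_family_imp_independent(1)[OF assms(1,2)]])
qed

text \<open>A vector of the span of \<open>B\<close> outside the span of the family would extend it
  to an independent set with more than \<open>card B\<close> elements.\<close>

lemma indep_family_spans:
  assumes K: "finite K" "indep_family K f" and B: "finite B" "f ` K \<subseteq> fun_space.span B"
    and le: "card B \<le> card K"
  shows "fun_space.span B \<subseteq> fun_space.span (f ` K)"
proof
  fix s assume s: "s \<in> fun_space.span B"
  show "s \<in> fun_space.span (f ` K)"
  proof (rule ccontr)
    assume n: "s \<notin> fun_space.span (f ` K)"
    then have "fun_space.independent (insert s (f ` K))"
      using indep_family_imp_independent(2)[OF K] by (rule fun_space.independent_insertI)
    moreover have "insert s (f ` K) \<subseteq> fun_space.span B"
      using s B(2) by (simp only: insert_subset)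
    ultimately have "card (insert s (f ` K)) \<le> card B"
      by (rule fun_space.independent_span_bound[OF B(1), THEN conjunct2])
    moreover have "s \<notin> f ` K"
      using n fun_space.span_base by (rule contrapos_nn)
    ultimately have "Suc (card (f ` K)) \<le> card B"
      using K(1) by (metis card_insert_disjoint finite_imageI)
    then show False
      using le by (simp add: card_image[OF indep_family_imp_independent(1)[OF K]])
  qed
qed

section \<open>Rank conditions depending polynomially on a parameter\<close>

lemma polynomials_on_diff:
  assumes "p \<in> polynomials_on H" "q \<in> polynomials_on H"
  shows "(\<lambda>\<Theta>. p \<Theta> - q \<Theta>) \<in> polynomials_on H"
  using polynomials_on.add[OF assms(1) polynomials_on.mult[OF polynomials_on.const[of "-1"] assms(2)]]
  by simp

lemma polynomials_on_sum:
  assumes "\<And>i. i \<in> A \<Longrightarrow> p i \<in> polynomials_on H"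
  shows "(\<lambda>\<Theta>. \<Sum>i\<in>A. p i \<Theta>) \<in> polynomials_on H"
  using assms by (induction A rule: infinite_finite_induct) (auto intro: polynomials_on.intros)

lemma polynomials_on_prod:
  assumes "\<And>i. i \<in> A \<Longrightarrow> p i \<in> polynomials_on H"
  shows "(\<lambda>\<Theta>. \<Prod>i\<in>A. p i \<Theta>) \<in> polynomials_on H"
  using assms by (induction A rule: infinite_finite_induct) (auto intro: polynomials_on.intros)

text \<open>Gaussian elimination: evaluating at a point where one of the functions does not vanish
  eliminates that function, and the pivots multiply up to the required polynomial.\<close>

lemma indep_family_open:
  assumes "finite K" and "\<And>k x. k \<in> K \<Longrightarrow> (\<lambda>\<Theta>. f \<Theta> k x) \<in> polynomials_on H"
    and "indep_family K (f \<Theta>\<^sub>1)"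
  shows "\<exists>p \<in> polynomials_on H. p \<Theta>\<^sub>1 \<noteq> 0 \<and> (\<forall>\<Theta>. p \<Theta> \<noteq> 0 \<longrightarrow> indep_family K (f \<Theta>))"
  using assms
proof (induction K arbitrary: f rule: finite_induct)
  case empty
  show ?case
    by (rule bexI[of _ "\<lambda>_. 1"]) (auto simp: indep_family_def intro: polynomials_on.const)
next
  case (insert m K)
  have "\<exists>x. f \<Theta>\<^sub>1 m x \<noteq> 0"
  proof (rule ccontr)
    assume "\<not> (\<exists>x. f \<Theta>\<^sub>1 m x \<noteq> 0)"
    then have z: "(\<Sum>k\<in>insert m K. (if k = m then 1 else 0) * f \<Theta>\<^sub>1 k x) = 0" for x
      by (intro sum.neutral) auto
    have "(if m = m then 1 else 0 :: complex) = 0"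
      by (rule indep_familyD[OF insert.prems(2) z]) simp
    then show False by simp
  qed
  then obtain x where x: "f \<Theta>\<^sub>1 m x \<noteq> 0" by blast
  \<comment> \<open>Row operation with pivot \<open>f \<Theta> m x\<close>: every
    \<open>g \<Theta> k\<close> vanishes at \<open>x\<close>. It avoids division, so the values stay
    polynomial in \<Theta>.\<close>
  define g where "g \<Theta> k y = f \<Theta> m x * f \<Theta> k y - f \<Theta> k x * f \<Theta> m y" for \<Theta> k y
  have "indep_family K (g \<Theta>\<^sub>1)"
  proof (rule indep_familyI)
    fix c k assume c: "\<And>y. (\<Sum>k\<in>K. c k * g \<Theta>\<^sub>1 k y) = 0" and k: "k \<in> K"
    \<comment> \<open>Substituting the definition of \<open>g\<close> turns a relation among the
      \<open>g k\<close> into one among the \<open>f k\<close>; these are its coefficients, that of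
      \<open>m\<close> collecting the subtracted terms.\<close>
    define d where "d i = (if i = m then - (\<Sum>k\<in>K. c k * f \<Theta>\<^sub>1 k x) else c i * f \<Theta>\<^sub>1 m x)" for i
    have "(\<Sum>i\<in>insert m K. d i * f \<Theta>\<^sub>1 i y) = 0" for y
    proof -
      have "(\<Sum>i\<in>insert m K. d i * f \<Theta>\<^sub>1 i y)
          = - (\<Sum>k\<in>K. c k * f \<Theta>\<^sub>1 k x) * f \<Theta>\<^sub>1 m y + (\<Sum>i\<in>K. c i * f \<Theta>\<^sub>1 m x * f \<Theta>\<^sub>1 i y)"
      proof -
        have "(\<Sum>i\<in>K. d i * f \<Theta>\<^sub>1 i y) = (\<Sum>i\<in>K. c i * f \<Theta>\<^sub>1 m x * f \<Theta>\<^sub>1 i y)"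
          using insert.hyps(2) by (intro sum.cong) (auto simp: d_def)
        then show ?thesis
          using insert.hyps by (simp add: d_def)
      qed
      also have "\<dots> = (\<Sum>k\<in>K. c k * g \<Theta>\<^sub>1 k y)"
        by (simp add: g_def right_diff_distrib sum_subtractf sum_distrib_left sum_distrib_right mult_ac)
      finally show ?thesis using c by simp
    qed
    then have "d k = 0"
      by (rule indep_familyD[OF insert.prems(2)]) (use k in simp)
    then show "c k = 0"
      using x k insert.hyps by (auto simp: d_def split: if_splits)
  qed
  moreover have "(\<lambda>\<Theta>. g \<Theta> k y) \<in> polynomials_on H" if "k \<in> K" for k y
    unfolding g_def using insert.prems(1) that
    by (intro polynomials_on_diff polynomials_on.mult) auto
  ultimately obtain p where p: "p \<in> polynomials_on H" "p \<Theta>\<^sub>1 \<noteq> 0"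
      "\<And>\<Theta>. p \<Theta> \<noteq> 0 \<Longrightarrow> indep_family K (g \<Theta>)"
    using insert.IH[of g] by blast
  show ?case
  proof (intro bexI conjI allI impI)
    show "(\<lambda>\<Theta>. p \<Theta> * f \<Theta> m x) \<in> polynomials_on H"
      using p(1) insert.prems(1) by (intro polynomials_on.mult) auto
    show "p \<Theta>\<^sub>1 * f \<Theta>\<^sub>1 m x \<noteq> 0"
      using p x by simp
    fix \<Theta> assume nz: "p \<Theta> * f \<Theta> m x \<noteq> 0"
    show "indep_family (insert m K) (f \<Theta>)"
      unfolding indep_family_def
    proof (intro allI impI)
      fix c assume c: "\<forall>y. (\<Sum>k\<in>insert m K. c k * f \<Theta> k y) = 0"
      have e: "c m * f \<Theta> m y = - (\<Sum>k\<in>K. c k * f \<Theta> k y)" for y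
        using c insert.hyps by (simp add: eq_neg_iff_add_eq_0)
      have "(\<Sum>k\<in>K. c k * g \<Theta> k y) = 0" for y
      proof -
        have "(\<Sum>k\<in>K. c k * g \<Theta> k y)
            = f \<Theta> m x * (\<Sum>k\<in>K. c k * f \<Theta> k y) - (\<Sum>k\<in>K. c k * f \<Theta> k x) * f \<Theta> m y"
          unfolding g_def right_diff_distrib sum_subtractf sum_distrib_left sum_distrib_right
          by (simp only: mult_ac)
        also have "\<dots> = - f \<Theta> m x * (c m * f \<Theta> m y) + c m * f \<Theta> m x * f \<Theta> m y"
          by (simp add: e)
        finally show ?thesis by simp
      qed
      then have z: "\<forall>k\<in>K. c k = 0"
        using indep_familyD[OF p(3)[of \<Theta>], of c] nz by simp
      then have "c m = 0"
        using e[of x] nz by simp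
      with z show "\<forall>k\<in>insert m K. c k = 0" by simp
    qed
  qed
qed

text \<open>At \<open>\<Theta>\<^sub>1\<close> some subfamily \<open>K\<close> of the generators is
  independent and has at least as many members as a basis \<open>B0\<close> of the span of
  \<open>B\<close>. Independence of \<open>K\<close> is an open condition, and since the generators
  never leave the span of \<open>B\<close>, as many independent ones as its dimension must span
  it.\<close>

lemma spanning_open:
  assumes I: "finite I" and B: "finite B"
    and sub: "\<And>\<Theta> b. \<Theta> \<in> H \<Longrightarrow> b \<in> I \<Longrightarrow> f \<Theta> b \<in> fun_space.span B"
    and pol: "\<And>b x. b \<in> I \<Longrightarrow> (\<lambda>\<Theta>. f \<Theta> b x) \<in> polynomials_on H"
    and \<Theta>1: "\<Theta>\<^sub>1 \<in> H" and sp: "B \<subseteq> fun_space.span (f \<Theta>\<^sub>1 ` I)"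
  shows "\<exists>p \<in> polynomials_on H. p \<Theta>\<^sub>1 \<noteq> 0 \<and>
           (\<forall>\<Theta>\<in>H. p \<Theta> \<noteq> 0 \<longrightarrow> B \<subseteq> fun_space.span (f \<Theta> ` I))"
proof -
  obtain B0 where B0: "B0 \<subseteq> B" "fun_space.independent B0" "B \<subseteq> fun_space.span B0"
    using fun_space.maximal_independent_subset .
  obtain C where C: "C \<subseteq> f \<Theta>\<^sub>1 ` I" "fun_space.independent C" "f \<Theta>\<^sub>1 ` I \<subseteq> fun_space.span C"
    using fun_space.maximal_independent_subset .
  obtain K where K: "K \<subseteq> I" "inj_on (f \<Theta>\<^sub>1) K" "C = f \<Theta>\<^sub>1 ` K"
    using C(1) by (auto simp: subset_image_inj)
  have fin: "finite K" "finite B0" "finite C"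
    using K B0 I B finite_subset by (auto simp: K(3) intro: finite_imageI finite_subset)
  have spB: "fun_space.span B \<subseteq> fun_space.span B0"
    using B0(3) fun_space.span_minimal fun_space.subspace_span by blast
  have "B0 \<subseteq> fun_space.span C"
    using B0(1) sp C(3) fun_space.span_minimal[OF C(3) fun_space.subspace_span] by blast
  then have "card B0 \<le> card C"
    using fun_space.independent_span_bound[OF fin(3) B0(2)] by blast
  then have card: "card B0 \<le> card K"
    using K by (simp add: card_image)
  have "indep_family K (f \<Theta>\<^sub>1)"
    using independent_imp_indep_family[OF fin(1) K(2)] C(2) K(3) by blast
  then obtain p where p: "p \<in> polynomials_on H" "p \<Theta>\<^sub>1 \<noteq> 0"
      "\<And>\<Theta>. p \<Theta> \<noteq> 0 \<Longrightarrow> indep_family K (f \<Theta>)"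
    using indep_family_open[of K f H \<Theta>\<^sub>1] fin K(1) pol by blast
  have "B \<subseteq> fun_space.span (f \<Theta> ` I)" if "\<Theta> \<in> H" "p \<Theta> \<noteq> 0" for \<Theta>
  proof -
    have "f \<Theta> ` K \<subseteq> fun_space.span B0"
      using sub[OF that(1)] K(1) spB by blast
    then have "fun_space.span B0 \<subseteq> fun_space.span (f \<Theta> ` K)"
      using indep_family_spans[OF fin(1) p(3)[OF that(2)] fin(2) _ card] by blast
    also have "\<dots> \<subseteq> fun_space.span (f \<Theta> ` I)"
      using K(1) by (intro fun_space.span_mono image_mono)
    finally show ?thesis using B0(3) by blast
  qed
  with p show ?thesis by blast
qed

lemma fun_span_cmult: "f \<in> fun_space.span B \<Longrightarrow> (\<lambda>x. c * f x) \<in> fun_space.span B"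
  using fun_space.span_scale[of f B c] by (simp only: fun_scale_def[of c f])

lemma fun_span_add:
  "f \<in> fun_space.span B \<Longrightarrow> g \<in> fun_space.span B \<Longrightarrow> (\<lambda>x. f x + g x) \<in> fun_space.span B"
  using fun_space.span_add[of f B g] by (simp only: plus_fun_def[of f g])

lemma fun_span_zero: "(\<lambda>x. 0) \<in> fun_space.span B"
  using fun_space.span_zero by (simp only: zero_fun_def)

lemma fun_span_sum:
  "(\<And>i. i \<in> A \<Longrightarrow> f i \<in> fun_space.span B) \<Longrightarrow> (\<lambda>x. \<Sum>i\<in>A. f i x) \<in> fun_space.span B"
  by (induction A rule: infinite_finite_induct) (auto intro: fun_span_zero fun_span_add)

lemma fun_span_least:
  assumes "f \<in> fun_space.span B" and "B \<subseteq> S" and "(\<lambda>x. 0) \<in> S"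
    and add: "\<And>f g. f \<in> S \<Longrightarrow> g \<in> S \<Longrightarrow> (\<lambda>x. f x + g x) \<in> S"
    and scale: "\<And>c f. f \<in> S \<Longrightarrow> (\<lambda>x. c * f x) \<in> S"
  shows "f \<in> S"
  using assms(1)
proof (induction rule: fun_space.span_induct_alt)
  case base
  show ?case using assms(3) by (simp only: zero_fun_def)
next
  case (step c f g)
  then show ?case
    using add[OF scale[of f c]] assms(2) by (auto simp only: plus_fun_def fun_scale_def)
qed

section \<open>Polynomial functions\<close>

text \<open>Polynomials of degree at most \<open>D\<close>, generated by constants, multiplication
  by a coordinate and addition, so that properties of polynomials can be proved by induction without
  handling multi-indices.\<close>

inductive poly_of_degree_le :: "nat \<Rightarrow> (complex ^ 'n \<Rightarrow> complex) \<Rightarrow> bool" where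
  const: "poly_of_degree_le D (\<lambda>v. a)"
| coord: "poly_of_degree_le D f \<Longrightarrow> poly_of_degree_le (Suc D) (\<lambda>v. v $ i * f v)"
| add: "poly_of_degree_le D f \<Longrightarrow> poly_of_degree_le D g \<Longrightarrow> poly_of_degree_le D (\<lambda>v. f v + g v)"

definition poly_le :: "nat \<Rightarrow> (complex ^ 'n \<Rightarrow> complex) set" where
  "poly_le D = {f. poly_of_degree_le D f}"

lemma poly_le_const: "(\<lambda>v. a) \<in> poly_le D"
  and poly_le_times_coord: "f \<in> poly_le D \<Longrightarrow> (\<lambda>v. v $ i * f v) \<in> poly_le (Suc D)"
  and poly_le_add: "f \<in> poly_le D \<Longrightarrow> g \<in> poly_le D \<Longrightarrow> (\<lambda>v. f v + g v) \<in> poly_le D"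
  by (auto simp: poly_le_def intro: poly_of_degree_le.intros)

lemma poly_le_induct [consumes 1, case_names const coord add]:
  assumes "f \<in> poly_le D"
    and "\<And>a D. P D (\<lambda>v. a)"
    and "\<And>f D i. f \<in> poly_le D \<Longrightarrow> P D f \<Longrightarrow> P (Suc D) (\<lambda>v. v $ i * f v)"
    and "\<And>f D g. f \<in> poly_le D \<Longrightarrow> P D f \<Longrightarrow> g \<in> poly_le D \<Longrightarrow> P D g \<Longrightarrow> P D (\<lambda>v. f v + g v)"
  shows "P D f"
  using poly_of_degree_le.induct[of D f P] assms by (auto simp: poly_le_def)

lemma poly_le_mono:
  assumes "f \<in> poly_le D" "D \<le> E" shows "f \<in> poly_le E"
  using assms
proof (induction arbitrary: E rule: poly_le_induct)
  case (coord f D i)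
  then obtain E' where "E = Suc E'" "D \<le> E'" by (cases E) auto
  with coord show ?case by (auto intro: poly_le_times_coord)
qed (auto intro: poly_le_const poly_le_times_coord poly_le_add)

lemma poly_le_cmult:
  assumes "f \<in> poly_le D" shows "(\<lambda>v. a * f v) \<in> poly_le D"
  using assms
proof (induction rule: poly_le_induct)
  case (coord f D i)
  then show ?case
    using poly_le_times_coord[of "\<lambda>v. a * f v" D i] by (simp add: mult_ac)
qed (auto simp: distrib_left intro: poly_le_const poly_le_times_coord poly_le_add)

lemma poly_le_mult:
  assumes "f \<in> poly_le D" "g \<in> poly_le E" shows "(\<lambda>v. f v * g v) \<in> poly_le (D + E)"
  using assms
proof (induction rule: poly_le_induct)
  case (const a D)
  then show ?case using poly_le_mono[OF poly_le_cmult[of g E a], of "D + E"] by simp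
next
  case (coord f D i)
  then show ?case
    using poly_le_times_coord[of "\<lambda>v. f v * g v" "D + E" i] by (simp add: mult_ac)
qed (auto simp: distrib_right intro: poly_le_const poly_le_times_coord poly_le_add)

lemma poly_le_sum:
  assumes "\<And>i. i \<in> A \<Longrightarrow> f i \<in> poly_le D" shows "(\<lambda>v. \<Sum>i\<in>A. f i v) \<in> poly_le D"
  using assms by (induction A rule: infinite_finite_induct) (auto intro: poly_le_const poly_le_times_coord poly_le_add)

lemma poly_le_prod:
  assumes "\<And>i. i \<in> A \<Longrightarrow> f i \<in> poly_le (D i)"
  shows "(\<lambda>v. \<Prod>i\<in>A. f i v) \<in> poly_le (\<Sum>i\<in>A. D i)"
  using assms by (induction A rule: infinite_finite_induct) (auto intro: poly_le_const poly_le_mult)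

lemma poly_le_coord: "(\<lambda>v. v $ i) \<in> poly_le 1"
  using poly_le_times_coord[OF poly_le_const[of 1 0], of i] by simp

lemma poly_le_power:
  assumes "f \<in> poly_le D" shows "(\<lambda>v. f v ^ r) \<in> poly_le (r * D)"
  by (induction r) (use assms in \<open>auto intro: poly_le_const poly_le_mult\<close>)

lemma poly_le_diff:
  assumes "f \<in> poly_le D" "g \<in> poly_le D" shows "(\<lambda>v. f v - g v) \<in> poly_le D"
  using poly_le_add[OF assms(1) poly_le_cmult[OF assms(2), of "-1"]] by simp

lemma poly_le_finite_span:
  "\<exists>B. finite B \<and> B \<subseteq> poly_le D \<and>
     (poly_le D :: (complex ^ 'n \<Rightarrow> complex) set) \<subseteq> fun_space.span B"
proof -
  \<comment> \<open>\<open>B D\<close> is the set of monomials of degree at most \<open>D\<close>: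
    the constant 1 and the coordinate multiples of the monomials of
    \<open>B (D - 1)\<close>.\<close>
  define B :: "nat \<Rightarrow> (complex ^ 'n \<Rightarrow> complex) set" where
    "B = rec_nat {\<lambda>v. 1} (\<lambda>D X. insert (\<lambda>v. 1) ((\<lambda>(i, b) v. v $ i * b v) ` (UNIV \<times> X)))"
  have B0: "B 0 = {\<lambda>v. 1}"
    and BS: "B (Suc D) = insert (\<lambda>v. 1) ((\<lambda>(i, b) v. v $ i * b v) ` (UNIV \<times> B D))" for D
    by (simp_all add: B_def)
  have one: "(\<lambda>v. 1) \<in> B D" for D
    by (cases D) (auto simp: B0 BS)
  have fin: "finite (B D)" for D
    by (induction D) (auto simp: B0 BS)
  have sub: "B D \<subseteq> poly_le D" for D
    by (induction D) (auto simp: B0 BS intro: poly_le_const poly_le_times_coord poly_le_add)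
  have sp: "f \<in> fun_space.span (B D)" if "f \<in> poly_le D" for D f
    using that
  proof (induction rule: poly_le_induct)
    case (const a D)
    show ?case
      using fun_span_cmult[OF fun_space.span_base[OF one], of a D] by (simp only: mult_1_right)
  next
    case (coord f D i)
    show ?case
    \<comment> \<open>Multiplication by a coordinate is linear, so the functions that it maps into
      the larger span form a subspace; it contains \<open>B D\<close>.\<close>
    proof (rule fun_span_least[OF coord.IH, of "{f. (\<lambda>v. v $ i * f v) \<in> fun_space.span (B (Suc D))}", simplified])
      show "B D \<subseteq> {f. (\<lambda>v. v $ i * f v) \<in> fun_space.span (B (Suc D))}"
        by (auto simp: BS intro!: fun_space.span_base)
      show "(\<lambda>x. 0) \<in> fun_space.span (B (Suc D))"
        by (rule fun_span_zero)
    next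
      fix f g :: "complex ^ 'n \<Rightarrow> complex"
      assume "(\<lambda>v. v $ i * f v) \<in> fun_space.span (B (Suc D))"
        "(\<lambda>v. v $ i * g v) \<in> fun_space.span (B (Suc D))"
      from fun_span_add[OF this]
      show "(\<lambda>v. v $ i * (f v + g v)) \<in> fun_space.span (B (Suc D))"
        by (simp add: distrib_left)
    next
      fix f :: "complex ^ 'n \<Rightarrow> complex" and c
      assume "(\<lambda>v. v $ i * f v) \<in> fun_space.span (B (Suc D))"
      from fun_span_cmult[OF this, of c]
      show "(\<lambda>v. v $ i * (c * f v)) \<in> fun_space.span (B (Suc D))"
        by (simp add: mult_ac)
    qed
  next
    case (add f D g)
    then show ?case by (intro fun_span_add)
  qed
  show ?thesis
    using fin sub sp by (intro exI[of _ "B D"] conjI subsetI) auto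
qed

section \<open>Homogeneous forms and homogeneous components\<close>

lemma finite_multidegrees: "finite {m :: 'n::finite \<Rightarrow> nat. (\<Sum>i\<in>UNIV. m i) = d}"
proof (rule finite_subset)
  show "{m :: 'n \<Rightarrow> nat. (\<Sum>i\<in>UNIV. m i) = d} \<subseteq> PiE UNIV (\<lambda>_. {..d})"
    using member_le_sum[of _ UNIV] by (force simp: PiE_def)
qed (auto intro: finite_PiE)

lemma monomial_in_poly_funs_deg:
  assumes "(\<Sum>i\<in>UNIV. m i) = d"
  shows "(\<lambda>v. a * (\<Prod>i\<in>UNIV. (v $ i) ^ m i)) \<in> poly_funs_deg d"
proof -
  have e: "a * (\<Prod>i\<in>UNIV. (v $ i) ^ m i)
      = (\<Sum>m' | (\<Sum>i\<in>UNIV. m' i) = d. (if m' = m then a else 0) * (\<Prod>i\<in>UNIV. (v $ i) ^ m' i))"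
    for v :: "complex ^ 'a"
  proof -
    have "(\<Sum>m' | (\<Sum>i\<in>UNIV. m' i) = d. (if m' = m then a else 0) * (\<Prod>i\<in>UNIV. (v $ i) ^ m' i))
        = (\<Sum>m' | (\<Sum>i\<in>UNIV. m' i) = d. if m' = m then a * (\<Prod>i\<in>UNIV. (v $ i) ^ m' i) else 0)"
      by (rule sum.cong) auto
    also have "\<dots> = a * (\<Prod>i\<in>UNIV. (v $ i) ^ m i)"
      using assms by (simp add: finite_multidegrees)
    finally show ?thesis by simp
  qed
  show ?thesis
    unfolding poly_funs_deg_def
    by (intro CollectI exI[of _ "\<lambda>m'. if m' = m then a else 0"] ext) (rule e)
qed

lemma poly_funs_deg_zero: "(\<lambda>v. 0) \<in> poly_funs_deg d"
  unfolding poly_funs_deg_def by (rule CollectI, rule exI[of _ "\<lambda>_. 0"]) simp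

lemma poly_funs_deg_add:
  assumes "f \<in> poly_funs_deg d" "g \<in> poly_funs_deg d"
  shows "(\<lambda>v. f v + g v) \<in> poly_funs_deg d"
proof -
  obtain a b where "f = (\<lambda>v. \<Sum>m | (\<Sum>i\<in>UNIV. m i) = d. a m * (\<Prod>i\<in>UNIV. (v $ i) ^ m i))"
    "g = (\<lambda>v. \<Sum>m | (\<Sum>i\<in>UNIV. m i) = d. b m * (\<Prod>i\<in>UNIV. (v $ i) ^ m i))"
    using assms unfolding poly_funs_deg_def by blast
  then have "(\<lambda>v. f v + g v)
      = (\<lambda>v. \<Sum>m | (\<Sum>i\<in>UNIV. m i) = d. (a m + b m) * (\<Prod>i\<in>UNIV. (v $ i) ^ m i))"
    by (simp add: distrib_right sum.distrib)
  then show ?thesis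
    unfolding poly_funs_deg_def by (intro CollectI exI[of _ "\<lambda>m. a m + b m"]) simp
qed

lemma poly_funs_deg_cmult:
  assumes "f \<in> poly_funs_deg d" shows "(\<lambda>v. c * f v) \<in> poly_funs_deg d"
proof -
  obtain a where "f = (\<lambda>v. \<Sum>m | (\<Sum>i\<in>UNIV. m i) = d. a m * (\<Prod>i\<in>UNIV. (v $ i) ^ m i))"
    using assms unfolding poly_funs_deg_def by blast
  then have "(\<lambda>v. c * f v)
      = (\<lambda>v. \<Sum>m | (\<Sum>i\<in>UNIV. m i) = d. (c * a m) * (\<Prod>i\<in>UNIV. (v $ i) ^ m i))"
    by (simp add: sum_distrib_left mult_ac)
  then show ?thesis
    unfolding poly_funs_deg_def by (intro CollectI exI[of _ "\<lambda>m. c * a m"]) simp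
qed

lemma poly_funs_deg_sum:
  assumes "\<And>i. i \<in> A \<Longrightarrow> f i \<in> poly_funs_deg d" shows "(\<lambda>v. \<Sum>i\<in>A. f i v) \<in> poly_funs_deg d"
  using assms
  by (induction A rule: infinite_finite_induct) (auto intro: poly_funs_deg_zero poly_funs_deg_add)

lemma poly_funs_deg_coord:
  assumes "f \<in> poly_funs_deg d" shows "(\<lambda>v. v $ i * f v) \<in> poly_funs_deg (Suc d)"
proof -
  obtain a where f: "f = (\<lambda>v. \<Sum>m | (\<Sum>i\<in>UNIV. m i) = d. a m * (\<Prod>i\<in>UNIV. (v $ i) ^ m i))"
    using assms unfolding poly_funs_deg_def by blast
  have prod: "(\<Prod>j\<in>UNIV. (v $ j) ^ (m (i := Suc (m i))) j) = v $ i * (\<Prod>j\<in>UNIV. (v $ j) ^ m j)"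
    for m :: "'a \<Rightarrow> nat" and v :: "complex ^ 'a"
  proof -
    have "(\<Prod>j\<in>UNIV - {i}. (v $ j) ^ (m (i := Suc (m i))) j) = (\<Prod>j\<in>UNIV - {i}. (v $ j) ^ m j)"
      by (rule prod.cong) auto
    then show ?thesis
      by (subst (1 2) prod.remove[of UNIV i]) (simp_all add: mult_ac)
  qed
  have sum: "(\<Sum>j\<in>UNIV. (m (i := Suc (m i))) j) = Suc d" if "(\<Sum>j\<in>UNIV. m j) = d" for m :: "'a \<Rightarrow> nat"
  proof -
    have "(\<Sum>j\<in>UNIV - {i}. (m (i := Suc (m i))) j) = (\<Sum>j\<in>UNIV - {i}. m j)"
      by (rule sum.cong) auto
    then show ?thesis
      using that by (subst (asm) sum.remove[of UNIV i], simp, simp, subst sum.remove[of UNIV i]) simp_all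
  qed
  have "(\<lambda>v. v $ i * f v) = (\<lambda>v. \<Sum>m | (\<Sum>i\<in>UNIV. m i) = d.
      a m * (\<Prod>j\<in>UNIV. (v $ j) ^ (m (i := Suc (m i))) j))"
    unfolding prod f sum_distrib_left by (simp only: mult_ac)
  also have "\<dots> \<in> poly_funs_deg (Suc d)"
    using sum by (intro poly_funs_deg_sum monomial_in_poly_funs_deg) simp
  finally show ?thesis .
qed

lemma poly_funs_deg_homogeneous:
  assumes "f \<in> poly_funs_deg d" shows "f (t *s v) = t ^ d * f v"
proof -
  obtain a where f: "f = (\<lambda>v. \<Sum>m | (\<Sum>i\<in>UNIV. m i) = d. a m * (\<Prod>i\<in>UNIV. (v $ i) ^ m i))"
    using assms unfolding poly_funs_deg_def by blast
  show ?thesis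
    unfolding f sum_distrib_left
    by (rule sum.cong) (auto simp: power_mult_distrib prod.distrib mult_ac simp flip: power_sum)
qed

lemma poly_funs_deg_subset_poly_le: "poly_funs_deg d \<subseteq> poly_le d"
proof
  fix f :: "complex ^ 'n \<Rightarrow> complex" assume "f \<in> poly_funs_deg d"
  then obtain a where f: "f = (\<lambda>v. \<Sum>m | (\<Sum>i\<in>UNIV. m i) = d. a m * (\<Prod>i\<in>UNIV. (v $ i) ^ m i))"
    unfolding poly_funs_deg_def by blast
  have "(\<lambda>v. a m * (\<Prod>i\<in>UNIV. (v $ i) ^ m i)) \<in> poly_le d" if "(\<Sum>i\<in>UNIV. m i) = d" for m
  proof -
    have "(\<lambda>v::complex ^ 'n. \<Prod>i\<in>UNIV. (v $ i) ^ m i) \<in> poly_le (\<Sum>i\<in>UNIV. m i * 1)"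
      by (intro poly_le_prod poly_le_power poly_le_coord)
    with that show ?thesis by (intro poly_le_cmult) simp
  qed
  then show "f \<in> poly_le d"
    unfolding f by (intro poly_le_sum) auto
qed

lemma poly_le_decompose:
  assumes "f \<in> poly_le D"
  shows "\<exists>p. (\<forall>d\<le>D. p d \<in> poly_funs_deg d) \<and> f = (\<lambda>v. \<Sum>d\<le>D. p d v)"
  using assms
proof (induction rule: poly_le_induct)
  case (const a D)
  have "(\<lambda>v. a) \<in> poly_funs_deg 0"
    using monomial_in_poly_funs_deg[of "\<lambda>_. 0" 0 a] by simp
  then show ?case
    by (intro exI[of _ "\<lambda>d v. if d = 0 then a else 0"]) (auto simp: poly_funs_deg_zero)
next
  case (coord f D i)
  then obtain p where p: "\<forall>d\<le>D. p d \<in> poly_funs_deg d" "f = (\<lambda>v. \<Sum>d\<le>D. p d v)" by blast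
  \<comment> \<open>Multiplication by a coordinate shifts all components up by one degree and leaves
    none in degree 0.\<close>
  let ?q = "\<lambda>d v. case d of 0 \<Rightarrow> 0 | Suc e \<Rightarrow> v $ i * p e v"
  have q: "?q d \<in> poly_funs_deg d" if "d \<le> Suc D" for d
    using that p(1) by (cases d) (auto simp: poly_funs_deg_zero poly_funs_deg_coord)
  have "(\<lambda>v. v $ i * f v) = (\<lambda>v. \<Sum>d\<le>Suc D. ?q d v)"
    by (simp add: p(2) sum_distrib_left sum.atMost_Suc_shift del: sum.atMost_Suc)
  then show ?case
    using q by (intro exI[of _ ?q] conjI allI impI)
next
  case (add f D g)
  then obtain p q where "\<forall>d\<le>D. p d \<in> poly_funs_deg d" "f = (\<lambda>v. \<Sum>d\<le>D. p d v)"
    "\<forall>d\<le>D. q d \<in> poly_funs_deg d" "g = (\<lambda>v. \<Sum>d\<le>D. q d v)" by blast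
  then show ?case
    by (intro exI[of _ "\<lambda>d v. p d v + q d v"]) (auto simp: poly_funs_deg_add sum.distrib)
qed

text \<open>The bridge between the coefficient description in the definition of the ring and the
  inductive one that carries the degree bounds.\<close>

lemma poly_funs_eq: "poly_funs = (\<Union>D. poly_le D)"
proof (intro equalityI subsetI)
  fix f :: "complex ^ 'n \<Rightarrow> complex" assume "f \<in> poly_funs"
  then obtain N p where p: "\<forall>d\<le>N. p d \<in> poly_funs_deg d" "f = (\<lambda>v. \<Sum>d\<le>N. p d v)"
    unfolding poly_funs_def by blast
  have "p d \<in> poly_le N" if "d \<le> N" for d
    using that p(1) poly_funs_deg_subset_poly_le[of d] poly_le_mono[of "p d" d N] by auto
  then have "f \<in> poly_le N"
    unfolding p(2) by (intro poly_le_sum) simp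
  then show "f \<in> (\<Union>D. poly_le D)" by (rule UN_I[OF UNIV_I])
next
  fix f :: "complex ^ 'n \<Rightarrow> complex" assume "f \<in> (\<Union>D. poly_le D)"
  then obtain D where "f \<in> poly_le D" by (rule UN_E)
  from poly_le_decompose[OF this] show "f \<in> poly_funs"
    unfolding poly_funs_def by (intro CollectI exI[of _ D])
qed

lemma poly_le_poly_funs: "f \<in> poly_le D \<Longrightarrow> f \<in> poly_funs"
  by (auto simp: poly_funs_eq)

lemma poly_funs_const: "(\<lambda>v. a) \<in> poly_funs"
  by (auto simp: poly_funs_eq intro: poly_le_const)

lemma poly_funs_coord: "(\<lambda>v. v $ i) \<in> poly_funs"
  by (rule poly_le_poly_funs[OF poly_le_coord])

lemma poly_funs_add:
  assumes "f \<in> poly_funs" "g \<in> poly_funs" shows "(\<lambda>v. f v + g v) \<in> poly_funs"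
proof -
  obtain D E where "f \<in> poly_le D" "g \<in> poly_le E" using assms by (auto simp: poly_funs_eq)
  then have "f \<in> poly_le (max D E)" "g \<in> poly_le (max D E)" by (auto intro: poly_le_mono)
  then show ?thesis by (intro poly_le_poly_funs poly_le_add)
qed

lemma poly_funs_mult:
  assumes "f \<in> poly_funs" "g \<in> poly_funs" shows "(\<lambda>v. f v * g v) \<in> poly_funs"
  using assms by (auto simp: poly_funs_eq intro: poly_le_mult)

lemma poly_funs_diff:
  assumes "f \<in> poly_funs" "g \<in> poly_funs" shows "(\<lambda>v. f v - g v) \<in> poly_funs"
  using poly_funs_add[OF assms(1) poly_funs_mult[OF poly_funs_const[of "-1"] assms(2)]] by simp

lemma poly_funs_sum:
  assumes "\<And>i. i \<in> A \<Longrightarrow> f i \<in> poly_funs" shows "(\<lambda>v. \<Sum>i\<in>A. f i v) \<in> poly_funs"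
  using assms by (induction A rule: infinite_finite_induct) (auto intro: poly_funs_const poly_funs_add)

lemma poly_funs_prod:
  assumes "\<And>i. i \<in> A \<Longrightarrow> f i \<in> poly_funs" shows "(\<lambda>v. \<Prod>i\<in>A. f i v) \<in> poly_funs"
  using assms by (induction A rule: infinite_finite_induct) (auto intro: poly_funs_const poly_funs_mult)

lemma poly_funs_power:
  assumes "f \<in> poly_funs" shows "(\<lambda>v. f v ^ r) \<in> poly_funs"
  by (induction r) (auto intro: assms poly_funs_const poly_funs_mult)

section \<open>The Nullstellensatz\<close>

text \<open>Ideals in pointwise form, to avoid ring records in the algebra;
  \<open>ideal_poly_ring\<close> translates at the end.\<close>

definition poly_ideal :: "(complex ^ 'n \<Rightarrow> complex) set \<Rightarrow> bool" where
  "poly_ideal J \<longleftrightarrow> J \<subseteq> poly_funs \<and> (\<lambda>v. 0) \<in> J \<and>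
     (\<forall>f\<in>J. \<forall>g\<in>J. (\<lambda>v. f v + g v) \<in> J) \<and> (\<forall>g\<in>poly_funs. \<forall>f\<in>J. (\<lambda>v. g v * f v) \<in> J)"

lemma poly_idealI:
  assumes "J \<subseteq> poly_funs" "(\<lambda>v. 0) \<in> J"
    and "\<And>f g. f \<in> J \<Longrightarrow> g \<in> J \<Longrightarrow> (\<lambda>v. f v + g v) \<in> J"
    and "\<And>f g. g \<in> poly_funs \<Longrightarrow> f \<in> J \<Longrightarrow> (\<lambda>v. g v * f v) \<in> J"
  shows "poly_ideal J"
  using assms by (simp add: poly_ideal_def)

lemma poly_ideal_poly_funs: "poly_ideal J \<Longrightarrow> f \<in> J \<Longrightarrow> f \<in> poly_funs"
  and poly_ideal_zero: "poly_ideal J \<Longrightarrow> (\<lambda>v. 0) \<in> J"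
  and poly_ideal_add: "poly_ideal J \<Longrightarrow> f \<in> J \<Longrightarrow> g \<in> J \<Longrightarrow> (\<lambda>v. f v + g v) \<in> J"
  and poly_ideal_mult: "poly_ideal J \<Longrightarrow> g \<in> poly_funs \<Longrightarrow> f \<in> J \<Longrightarrow> (\<lambda>v. g v * f v) \<in> J"
  by (auto simp: poly_ideal_def)

lemma poly_ideal_mult_right:
  "poly_ideal J \<Longrightarrow> f \<in> J \<Longrightarrow> g \<in> poly_funs \<Longrightarrow> (\<lambda>v. f v * g v) \<in> J"
  using poly_ideal_mult[of J g f] by (simp add: mult.commute)

lemma poly_ideal_cmult: "poly_ideal J \<Longrightarrow> f \<in> J \<Longrightarrow> (\<lambda>v. c * f v) \<in> J"
  by (rule poly_ideal_mult[OF _ poly_funs_const])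

lemma poly_ideal_diff: "poly_ideal J \<Longrightarrow> f \<in> J \<Longrightarrow> g \<in> J \<Longrightarrow> (\<lambda>v. f v - g v) \<in> J"
  using poly_ideal_add[OF _ _ poly_ideal_cmult[of J g "- 1"], of f] by simp

lemma poly_ideal_sum:
  assumes "poly_ideal J" "\<And>i. i \<in> A \<Longrightarrow> f i \<in> J"
  shows "(\<lambda>v. \<Sum>i\<in>A. f i v) \<in> J"
  using assms(2)
  by (induction A rule: infinite_finite_induct)
    (auto intro: poly_ideal_zero[OF assms(1)] poly_ideal_add[OF assms(1)])

lemma poly_ideal_prod:
  assumes "poly_ideal J" "finite A" "i \<in> A" "f i \<in> J" "\<And>i. i \<in> A \<Longrightarrow> f i \<in> poly_funs"
  shows "(\<lambda>v. \<Prod>i\<in>A. f i v) \<in> J"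
proof -
  have "(\<lambda>v. f i v * (\<Prod>i\<in>A - {i}. f i v)) \<in> J"
    using assms by (intro poly_ideal_mult_right poly_funs_prod) auto
  then show ?thesis
    using assms(2,3) by (simp add: prod.remove[of A i])
qed

text \<open>The displayed set is the ideal sum of \<open>J\<close> and the principal ideal of
  \<open>g\<close>.\<close>

lemma poly_ideal_adjoin:
  fixes J :: "(complex ^ 'n \<Rightarrow> complex) set"
  assumes J: "poly_ideal J" and g: "g \<in> poly_funs"
  shows "poly_ideal {\<lambda>v. m v + a v * g v | m a. m \<in> J \<and> a \<in> poly_funs}" (is "poly_ideal ?K")
    and "J \<subseteq> {\<lambda>v. m v + a v * g v | m a. m \<in> J \<and> a \<in> poly_funs}"
    and "g \<in> {\<lambda>v. m v + a v * g v | m a. m \<in> J \<and> a \<in> poly_funs}"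
proof -
  show sub: "J \<subseteq> ?K"
  proof
    fix m assume "m \<in> J"
    then show "m \<in> ?K"
      using poly_funs_const[of 0] by (intro CollectI exI[of _ m] exI[of _ "\<lambda>v. 0"]) simp
  qed
  show "g \<in> ?K"
    using poly_funs_const[of 1] poly_ideal_zero[OF J]
    by (intro CollectI exI[of _ "\<lambda>v. 0"] exI[of _ "\<lambda>v. 1"]) simp
  show "poly_ideal ?K"
  proof (rule poly_idealI)
    show "?K \<subseteq> poly_funs"
      using poly_ideal_poly_funs[OF J] g by (auto intro!: poly_funs_add poly_funs_mult)
    show "(\<lambda>v. 0) \<in> ?K"
      using sub poly_ideal_zero[OF J] by blast
  next
    fix p q assume "p \<in> ?K" "q \<in> ?K"
    then obtain m a m' a' where *: "p = (\<lambda>v. m v + a v * g v)" "q = (\<lambda>v. m' v + a' v * g v)"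
      "m \<in> J" "m' \<in> J" "a \<in> poly_funs" "a' \<in> poly_funs" by blast
    then show "(\<lambda>v. p v + q v) \<in> ?K"
      by (rule_tac CollectI, rule_tac exI[of _ "\<lambda>v. m v + m' v"], rule_tac exI[of _ "\<lambda>v. a v + a' v"])
        (auto simp: algebra_simps intro: poly_ideal_add[OF J] poly_funs_add)
  next
    fix p q :: "complex ^ 'n \<Rightarrow> complex" assume "q \<in> poly_funs" "p \<in> ?K"
    then obtain m a where *: "p = (\<lambda>v. m v + a v * g v)" "q \<in> poly_funs"
      "m \<in> J" "a \<in> poly_funs" by blast
    then show "(\<lambda>v. q v * p v) \<in> ?K"
      by (rule_tac CollectI, rule_tac exI[of _ "\<lambda>v. q v * m v"], rule_tac exI[of _ "\<lambda>v. q v * a v"])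
        (auto simp: algebra_simps intro: poly_ideal_mult_right[OF J] poly_funs_mult)
  qed
qed

lemma poly_ideal_Union_chain:
  assumes "\<C> \<noteq> {}" and J: "\<And>J. J \<in> \<C> \<Longrightarrow> poly_ideal J"
    and chain: "\<And>J K. J \<in> \<C> \<Longrightarrow> K \<in> \<C> \<Longrightarrow> J \<subseteq> K \<or> K \<subseteq> J"
  shows "poly_ideal (\<Union>\<C>)"
proof (rule poly_idealI)
  show "\<Union>\<C> \<subseteq> poly_funs"
    using poly_ideal_poly_funs[OF J] by blast
  show "(\<lambda>v. 0) \<in> \<Union>\<C>"
    using poly_ideal_zero[OF J] assms(1) by blast
next
  fix f g assume "f \<in> \<Union>\<C>" "g \<in> \<Union>\<C>"
  then obtain K L where "f \<in> K" "g \<in> L" "K \<in> \<C>" "L \<in> \<C>" by blast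
  with chain[of K L] obtain M where "M \<in> \<C>" "f \<in> M" "g \<in> M" by blast
  with poly_ideal_add[OF J] show "(\<lambda>v. f v + g v) \<in> \<Union>\<C>" by (intro UnionI[of M])
next
  fix f g :: "complex ^ 'a \<Rightarrow> complex" assume "g \<in> poly_funs" "f \<in> \<Union>\<C>"
  then obtain K where "f \<in> K" "K \<in> \<C>" by blast
  with \<open>g \<in> poly_funs\<close> poly_ideal_mult[OF J] show "(\<lambda>v. g v * f v) \<in> \<Union>\<C>"
    by (intro UnionI[of K])
qed

text \<open>\<open>M\<close> corresponds to a maximal ideal of the polynomial ring localized at
  \<open>f\<close>. Keeping powers of \<open>f\<close> as the denominators takes the place of the
  additional variable in Rabinowitsch's argument.\<close>

locale power_avoiding_ideal =
  fixes M :: "(complex ^ 'n \<Rightarrow> complex) set" and f :: "complex ^ 'n \<Rightarrow> complex"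
  assumes ideal: "poly_ideal M" and f: "f \<in> poly_funs" and avoid: "\<And>r. (\<lambda>v. f v ^ r) \<notin> M"
    and maximal: "\<And>K. poly_ideal K \<Longrightarrow> M \<subseteq> K \<Longrightarrow> (\<And>r. (\<lambda>v. f v ^ r) \<notin> K) \<Longrightarrow> K = M"
begin

lemma one_notin: "(\<lambda>v. 1) \<notin> M"
  using avoid[of 0] by simp

lemma const_notin: "c \<noteq> 0 \<Longrightarrow> (\<lambda>v. c) \<notin> M"
  using poly_ideal_cmult[OF ideal, of "\<lambda>v. c" "1 / c"] one_notin by auto

text \<open>By maximality the ideal sum of \<open>M\<close> and \<open>g\<close> contains a power of
  \<open>f\<close>. So \<open>a\<close> divided by \<open>f ^ r\<close> inverts \<open>g\<close>
  modulo \<open>M\<close> in the localization.\<close>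

lemma inverse_up_to_power:
  assumes "g \<in> poly_funs" "g \<notin> M"
  obtains r a where "a \<in> poly_funs" "(\<lambda>v. f v ^ r - a v * g v) \<in> M"
proof -
  let ?K = "{\<lambda>v. m v + a v * g v | m a. m \<in> M \<and> a \<in> poly_funs}"
  have "\<not> (\<forall>r. (\<lambda>v. f v ^ r) \<notin> ?K)"
  proof
    assume "\<forall>r. (\<lambda>v. f v ^ r) \<notin> ?K"
    then have "?K = M"
      by (intro maximal poly_ideal_adjoin[OF ideal assms(1)]) simp
    then show False
      using poly_ideal_adjoin(3)[OF ideal assms(1)] assms(2) by blast
  qed
  then obtain r m a where "(\<lambda>v. f v ^ r) = (\<lambda>v. m v + a v * g v)" "m \<in> M" "a \<in> poly_funs"
    by blast
  then have "(\<lambda>v. f v ^ r - a v * g v) = m" by (auto simp: fun_eq_iff)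
  with \<open>m \<in> M\<close> have "(\<lambda>v. f v ^ r - a v * g v) \<in> M" by simp
  with \<open>a \<in> poly_funs\<close> show thesis by (rule that)
qed

text \<open>If neither factor lies in \<open>M\<close>, both are invertible up to powers of
  \<open>f\<close>. Multiplying the two congruences makes \<open>f ^ (r + s)\<close> congruent to a
  multiple of \<open>g * h\<close>, which would put that power into \<open>M\<close>.\<close>

lemma prime:
  assumes "g \<in> poly_funs" "h \<in> poly_funs" "(\<lambda>v. g v * h v) \<in> M"
  shows "g \<in> M \<or> h \<in> M"
proof (rule ccontr)
  assume n: "\<not> (g \<in> M \<or> h \<in> M)"
  obtain r a where a: "a \<in> poly_funs" "(\<lambda>v. f v ^ r - a v * g v) \<in> M"
    using inverse_up_to_power[OF assms(1)] n by blast
  obtain s b where b: "b \<in> poly_funs" "(\<lambda>v. f v ^ s - b v * h v) \<in> M"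
    using inverse_up_to_power[OF assms(2)] n by blast
  have "(\<lambda>v. (a v * b v) * (g v * h v)) \<in> M"
    using a(1) b(1) assms(3) by (rule poly_ideal_mult[OF ideal poly_funs_mult])
  moreover have "(\<lambda>v. (a v * g v) * (f v ^ s - b v * h v)) \<in> M"
    using a(1) assms(1) b(2) by (rule poly_ideal_mult[OF ideal poly_funs_mult])
  moreover have "(\<lambda>v. f v ^ s * (f v ^ r - a v * g v)) \<in> M"
    using f a(2) by (rule poly_ideal_mult[OF ideal poly_funs_power])
  ultimately have "(\<lambda>v. f v ^ s * (f v ^ r - a v * g v) + ((a v * g v) * (f v ^ s - b v * h v)
      + (a v * b v) * (g v * h v))) \<in> M"
    by (intro poly_ideal_add[OF ideal])
  moreover have "f v ^ s * (f v ^ r - a v * g v) + ((a v * g v) * (f v ^ s - b v * h v)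
      + (a v * b v) * (g v * h v)) = f v ^ (r + s)" for v
    by (simp add: algebra_simps power_add)
  ultimately show False
    using avoid[of "r + s"] by simp
qed

text \<open>A residue field of countable dimension over an uncountable algebraically closed field is
  trivial: the functions \<open>1 / (x\<^sub>i - \<alpha>)\<close> cannot be linearly independent.\<close>

lemma coord_minus_const_in: "\<exists>\<alpha>. (\<lambda>v. v $ i - \<alpha>) \<in> M"
proof (rule ccontr)
  assume n: "\<not> (\<exists>\<alpha>. (\<lambda>v. v $ i - \<alpha>) \<in> M)"
  have lin: "(\<lambda>v. v $ i - \<alpha>) \<in> poly_funs" for \<alpha>
    by (intro poly_funs_diff poly_funs_coord poly_funs_const)
  \<comment> \<open>Over the complex numbers \<open>q\<close> splits into linear factors. None of
    them, evaluated at the coordinate, lies in the prime \<open>M\<close>.\<close>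
  have root_free: "(\<lambda>v. poly q (v $ i)) \<notin> M" if "q \<noteq> 0" for q
    using that
  proof (induction "degree q" arbitrary: q rule: less_induct)
    case less
    show ?case
    proof (cases "degree q = 0")
      case True
      then obtain c where "q = [:c:]" by (rule degree_eq_zeroE)
      with less.prems const_notin[of c] show ?thesis by simp
    next
      case False
      then obtain z where "poly q z = 0"
        using fundamental_theorem_of_algebra[of q] constant_degree[of q] by auto
      then obtain q' where q': "q = [:- z, 1:] * q'"
        by (auto simp: poly_eq_0_iff_dvd)
      with less.prems have "q' \<noteq> 0" by auto
      then have "degree q' < degree q"
        unfolding q' by (subst degree_mult_eq) auto
      then have "(\<lambda>v. poly q' (v $ i)) \<notin> M"
        using \<open>q' \<noteq> 0\<close> by (rule less.hyps)
      moreover have "(\<lambda>v. v $ i - z) \<notin> M"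
        using n by simp
      moreover have "(\<lambda>v. poly q' (v $ i)) \<in> poly_funs"
        unfolding poly_altdef
        by (intro poly_funs_sum poly_funs_mult poly_funs_power poly_funs_coord poly_funs_const)
      ultimately have "(\<lambda>v. (v $ i - z) * poly q' (v $ i)) \<notin> M"
        using prime[OF lin[of z], of "\<lambda>v. poly q' (v $ i)"] by auto
      then show ?thesis unfolding q' by (simp add: algebra_simps)
    qed
  qed
  \<comment> \<open>The inverse of the coordinate minus \<alpha> is represented by a polynomial
    \<open>p\<close> of degree at most \<open>D\<close> over the denominator
    \<open>f ^ r\<close>.\<close>
  have "\<forall>\<alpha>. \<exists>r D p. p \<in> poly_le D \<and> (\<lambda>v. f v ^ r - p v * (v $ i - \<alpha>)) \<in> M"
  proof
    fix \<alpha>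
    have nin: "(\<lambda>v. v $ i - \<alpha>) \<notin> M" using n by simp
    obtain r a where a: "a \<in> poly_funs" "(\<lambda>v. f v ^ r - a v * (v $ i - \<alpha>)) \<in> M"
      by (rule inverse_up_to_power[OF lin nin])
    from a(1) obtain D where "a \<in> poly_le D" unfolding poly_funs_eq by (rule UN_E)
    with a(2) show "\<exists>r D p. p \<in> poly_le D \<and> (\<lambda>v. f v ^ r - p v * (v $ i - \<alpha>)) \<in> M"
      by (intro exI[of _ r] exI[of _ D] exI[of _ a] conjI)
  qed
  from choice[OF this] obtain r where
    "\<forall>\<alpha>. \<exists>D p. p \<in> poly_le D \<and> (\<lambda>v. f v ^ r \<alpha> - p v * (v $ i - \<alpha>)) \<in> M" ..
  from choice[OF this] obtain D where
    "\<forall>\<alpha>. \<exists>p. p \<in> poly_le (D \<alpha>) \<and> (\<lambda>v. f v ^ r \<alpha> - p v * (v $ i - \<alpha>)) \<in> M" ..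
  from choice[OF this] obtain p where
    "\<forall>\<alpha>. p \<alpha> \<in> poly_le (D \<alpha>) \<and> (\<lambda>v. f v ^ r \<alpha> - p \<alpha> v * (v $ i - \<alpha>)) \<in> M" ..
  then have p: "p \<alpha> \<in> poly_le (D \<alpha>)" "(\<lambda>v. f v ^ r \<alpha> - p \<alpha> v * (v $ i - \<alpha>)) \<in> M" for \<alpha>
    by simp_all
  \<comment> \<open>There are only countably many pairs of exponent and degree but uncountably many
    \<alpha>. A common denominator and a common degree bound for infinitely many \<alpha> put their
    numerators into one finite-dimensional space.\<close>
  have "\<exists>k. infinite {\<alpha>. (r \<alpha>, D \<alpha>) = k}"
  proof (rule ccontr)
    assume "\<not> (\<exists>k. infinite {\<alpha>. (r \<alpha>, D \<alpha>) = k})"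
    then have "finite {\<alpha>. (r \<alpha>, D \<alpha>) = k}" for k
      unfolding not_ex not_not by (rule spec)
    then have "countable (\<Union>k. {\<alpha>. (r \<alpha>, D \<alpha>) = k})"
      by (intro countable_UN countableI_type countable_finite)
    moreover have "(\<Union>k. {\<alpha>. (r \<alpha>, D \<alpha>) = k}) = (UNIV :: complex set)" by blast
    ultimately show False
      using uncountable_UNIV_complex by simp
  qed
  then obtain s E where inf: "infinite {\<alpha>. r \<alpha> = s \<and> D \<alpha> = E}" by auto
  obtain B :: "(complex ^ 'n \<Rightarrow> complex) set" where B: "finite B" "poly_le E \<subseteq> fun_space.span B"
    using poly_le_finite_span[of E] by (elim exE conjE) (rule that)
  obtain L where L: "finite L" "card L = Suc (card B)" "L \<subseteq> {\<alpha>. r \<alpha> = s \<and> D \<alpha> = E}"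
    using infinite_arbitrarily_large[OF inf, of "Suc (card B)"] by blast
  have "p ` L \<subseteq> fun_space.span B"
    using L(3) p(1) B(2) by blast
  then have "\<not> indep_family L p"
    using indep_family_card_le[OF L(1) _ B(1), of p] L(2) by auto
  then obtain c \<alpha>\<^sub>0 where c: "\<And>v. (\<Sum>\<alpha>\<in>L. c \<alpha> * p \<alpha> v) = 0" "\<alpha>\<^sub>0 \<in> L" "c \<alpha>\<^sub>0 \<noteq> 0"
    unfolding indep_family_def by auto
  \<comment> \<open>The numerator of the sum of the fractions c_\<alpha> / (x - \<alpha>) over the
    common denominator. At \<open>\<alpha>\<^sub>0\<close> only one summand survives, so
    \<open>q\<close> is nonzero.\<close>
  define q where "q = (\<Sum>\<alpha>\<in>L. Polynomial.smult (c \<alpha>) (\<Prod>\<beta>\<in>L - {\<alpha>}. [:- \<beta>, 1:]))"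
  have "poly q \<alpha>\<^sub>0 = (\<Sum>\<alpha>\<in>L. c \<alpha> * (\<Prod>\<beta>\<in>L - {\<alpha>}. \<alpha>\<^sub>0 - \<beta>))"
    by (simp add: q_def poly_sum poly_prod)
  also have "\<dots> = (\<Sum>\<alpha>\<in>{\<alpha>\<^sub>0}. c \<alpha> * (\<Prod>\<beta>\<in>L - {\<alpha>}. \<alpha>\<^sub>0 - \<beta>))"
    by (rule sum.mono_neutral_right) (use L(1) c(2) in auto)
  finally have "poly q \<alpha>\<^sub>0 \<noteq> 0"
    using L(1) c(3) by simp
  then have "q \<noteq> 0" by auto
  \<comment> \<open>The congruences for the inverses, cleared of denominators and combined with the
    coefficients \<open>c\<close>. The terms with \<open>p\<close> cancel by the linear relation and
    leave \<open>f ^ s\<close> times \<open>q\<close> at the coordinate.\<close>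
  have "(\<lambda>v. \<Sum>\<alpha>\<in>L. (c \<alpha> * (\<Prod>\<beta>\<in>L - {\<alpha>}. v $ i - \<beta>)) * (f v ^ s - p \<alpha> v * (v $ i - \<alpha>))) \<in> M"
  proof (intro poly_ideal_sum[OF ideal] poly_ideal_mult[OF ideal] poly_funs_mult poly_funs_const
      poly_funs_prod lin)
    fix \<alpha> assume "\<alpha> \<in> L"
    then show "(\<lambda>v. f v ^ s - p \<alpha> v * (v $ i - \<alpha>)) \<in> M"
      using p(2)[of \<alpha>] L(3) by auto
  qed
  moreover have "(\<Sum>\<alpha>\<in>L. (c \<alpha> * (\<Prod>\<beta>\<in>L - {\<alpha>}. v $ i - \<beta>)) * (f v ^ s - p \<alpha> v * (v $ i - \<alpha>)))
      = f v ^ s * poly q (v $ i)" for v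
  proof -
    have "(\<Sum>\<alpha>\<in>L. (c \<alpha> * (\<Prod>\<beta>\<in>L - {\<alpha>}. v $ i - \<beta>)) * (p \<alpha> v * (v $ i - \<alpha>)))
        = (\<Sum>\<alpha>\<in>L. c \<alpha> * p \<alpha> v * (\<Prod>\<beta>\<in>L. v $ i - \<beta>))"
      by (rule sum.cong) (auto simp: prod.remove[OF L(1)] mult_ac)
    also have "\<dots> = 0"
      using c(1)[of v] by (simp flip: sum_distrib_right)
    finally show ?thesis
      by (simp add: right_diff_distrib sum_subtractf q_def poly_sum poly_prod sum_distrib_left mult_ac)
  qed
  ultimately have "(\<lambda>v. f v ^ s * poly q (v $ i)) \<in> M" by simp
  moreover have "(\<lambda>v. poly q (v $ i)) \<in> poly_funs"
    unfolding poly_altdef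
    by (intro poly_funs_sum poly_funs_mult poly_funs_power poly_funs_coord poly_funs_const)
  ultimately have "(\<lambda>v. f v ^ s) \<in> M \<or> (\<lambda>v. poly q (v $ i)) \<in> M"
    using poly_funs_power[OF f] by (intro prime)
  then have "(\<lambda>v. poly q (v $ i)) \<in> M"
    using avoid[of s] by blast
  with root_free[OF \<open>q \<noteq> 0\<close>] show False by blast
qed

text \<open>The constants congruent to the coordinates are the coordinates of a point
  \<open>z\<close>, and every polynomial is congruent to its value at \<open>z\<close>. An element
  of \<open>M\<close> with nonzero value there would put a nonzero constant into \<open>M\<close>,
  and \<open>f z = 0\<close> would put \<open>f\<close> itself there.\<close>

lemma exists_zero: "\<exists>z. (\<forall>g\<in>M. g z = 0) \<and> f z \<noteq> 0"
proof -
  obtain z' where z': "\<And>i. (\<lambda>v. v $ i - z' i) \<in> M"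
    using coord_minus_const_in by metis
  define z where "z = (\<chi> i. z' i)"
  have z: "(\<lambda>v. v $ i - z $ i) \<in> M" for i
    using z'[of i] by (simp add: z_def)
  have residue: "(\<lambda>v. g v - g z) \<in> M" if "g \<in> poly_le D" for g D
    using that
  proof (induction rule: poly_le_induct)
    case (const a D)
    then show ?case using poly_ideal_zero[OF ideal] by simp
  next
    case (coord g D i)
    have "(\<lambda>v. v $ i * (g v - g z) + g z * (v $ i - z $ i)) \<in> M"
      by (intro poly_ideal_add[OF ideal] poly_ideal_mult[OF ideal] poly_ideal_cmult[OF ideal]
          coord.IH z poly_funs_coord)
    then show ?case by (simp add: algebra_simps)
  next
    case (add g D h)
    have "(\<lambda>v. (g v - g z) + (h v - h z)) \<in> M"
      by (intro poly_ideal_add[OF ideal] add.IH)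
    then show ?case by (simp add: algebra_simps)
  qed
  have "g z = 0" if g: "g \<in> M" for g
  proof (rule ccontr)
    assume "g z \<noteq> 0"
    obtain D where "g \<in> poly_le D"
      using poly_ideal_poly_funs[OF ideal g] by (auto simp: poly_funs_eq)
    from poly_ideal_diff[OF ideal g residue[OF this]] have "(\<lambda>v. g z) \<in> M" by simp
    with const_notin[OF \<open>g z \<noteq> 0\<close>] show False by blast
  qed
  moreover have "f z \<noteq> 0"
  proof
    assume "f z = 0"
    obtain D where "f \<in> poly_le D"
      using f by (auto simp: poly_funs_eq)
    with residue[OF this] \<open>f z = 0\<close> have "f \<in> M" by simp
    with avoid[of 1] show False by simp
  qed
  ultimately show ?thesis by blast
qed

end

text \<open>If no power of \<open>f\<close> lies in \<open>J\<close>, Zorn's lemma gives an ideal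
  above \<open>J\<close> that is maximal with this property; unions of chains inherit it because
  each power is tested in a single member. Its zero then contradicts the vanishing of
  \<open>f\<close>.\<close>

theorem nullstellensatz:
  assumes J: "poly_ideal J" and f: "f \<in> poly_funs" and zero: "\<And>z. \<forall>g\<in>J. g z = 0 \<Longrightarrow> f z = 0"
  shows "\<exists>r. (\<lambda>v. f v ^ r) \<in> J"
proof (rule ccontr)
  assume n: "\<not> (\<exists>r. (\<lambda>v. f v ^ r) \<in> J)"
  let ?A = "{K. poly_ideal K \<and> J \<subseteq> K \<and> (\<forall>r. (\<lambda>v. f v ^ r) \<notin> K)}"
  have "\<exists>M\<in>?A. \<forall>X\<in>?A. M \<subseteq> X \<longrightarrow> X = M"
  proof (rule subset_Zorn_nonempty)
    have "J \<in> ?A"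
      using J n by simp
    then show "?A \<noteq> {}" by (rule ex_in_conv[THEN iffD1, OF exI])
    fix \<C> assume C: "\<C> \<noteq> {}" "subset.chain ?A \<C>"
    have sub: "\<C> \<subseteq> ?A"
      using C(2) unfolding subset_chain_def by (rule conjunct1)
    have chain: "\<forall>X\<in>\<C>. \<forall>Y\<in>\<C>. X \<subseteq> Y \<or> Y \<subseteq> X"
      using C(2) unfolding subset_chain_def by (rule conjunct2)
    have mem: "poly_ideal K" "J \<subseteq> K" "(\<lambda>v. f v ^ r) \<notin> K" if "K \<in> \<C>" for K r
      using subsetD[OF sub that] by simp_all
    have "poly_ideal (\<Union>\<C>)"
      by (rule poly_ideal_Union_chain[OF C(1) mem(1)]) (use chain in auto)
    moreover obtain K where "K \<in> \<C>" using C(1) by blast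
    then have "J \<subseteq> \<Union>\<C>"
      using mem(2) by blast
    moreover have "(\<lambda>v. f v ^ r) \<notin> \<Union>\<C>" for r
      using mem(3) by blast
    ultimately show "\<Union>\<C> \<in> ?A" by simp
  qed
  then obtain M where M: "M \<in> ?A" and max: "\<forall>X\<in>?A. M \<subseteq> X \<longrightarrow> X = M" ..
  interpret power_avoiding_ideal M f
  proof
    fix K assume K: "poly_ideal K" "M \<subseteq> K" "\<And>r. (\<lambda>v. f v ^ r) \<notin> K"
    have "J \<subseteq> K"
      using M K(2) by auto
    with K have "K \<in> ?A" by simp
    with max K(2) show "K = M" by simp
  next
    show "poly_ideal M" "\<And>r. (\<lambda>v. f v ^ r) \<notin> M"
      using M by simp_all
  qed (rule f)
  obtain z where z: "\<forall>g\<in>M. g z = 0" "f z \<noteq> 0"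
    using exists_zero by (elim exE conjE)
  have "\<forall>g\<in>J. g z = 0"
    using z(1) M by auto
  from zero[OF this] z(2) show False by simp
qed

corollary weak_nullstellensatz:
  assumes J: "poly_ideal J" and "\<And>z. \<exists>g\<in>J. g z \<noteq> 0"
  shows "(\<lambda>v. 1) \<in> J"
proof -
  have "\<exists>r. (\<lambda>v. 1 ^ r) \<in> J"
    by (rule nullstellensatz[OF J poly_funs_const]) (use assms(2) in blast)
  then show ?thesis by simp
qed

section \<open>Partial derivatives\<close>

text \<open>The Frechet derivative is only real linear in general. For polynomials it is complex
  linear, so its value in the direction of the unit vector is the complex partial
  derivative.\<close>

definition pd :: "'n \<Rightarrow> (complex ^ 'n \<Rightarrow> complex) \<Rightarrow> complex ^ 'n \<Rightarrow> complex" where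
  "pd j f v = frechet_derivative f (at v) (axis j 1)"

lemma sum_axis_mult: "(\<Sum>k\<in>UNIV. axis j 1 $ k * g k) = (g j :: complex)"
proof -
  have "(\<Sum>k\<in>UNIV. axis j 1 $ k * g k) = (\<Sum>k\<in>UNIV. if k = j then g k else 0)"
    by (rule sum.cong) (auto simp: axis_def)
  then show ?thesis by simp
qed

lemma pd_eqI:
  assumes "(f has_derivative (\<lambda>u. \<Sum>j\<in>UNIV. u $ j * f' j)) (at v)"
  shows "pd j f v = f' j"
  by (simp add: pd_def frechet_derivative_at[OF assms, symmetric] sum_axis_mult)

text \<open>The form of the derivative, a sum of complex multiples of the \<open>u $ j\<close>,
  records complex linearity. The degree bound \<open>D\<close> is kept unsharpened so that the
  product rule passes through the induction without case distinctions.\<close>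

lemma poly_le_derivative_exists:
  assumes "f \<in> poly_le D"
  shows "\<exists>f'. (\<forall>j. f' j \<in> poly_le D) \<and>
      (\<forall>v. (f has_derivative (\<lambda>u. \<Sum>j\<in>UNIV. u $ j * f' j v)) (at v))"
  using assms
proof (induction rule: poly_le_induct)
  case (const a D)
  then show ?case by (intro exI[of _ "\<lambda>j v. 0"]) (auto intro: poly_le_const)
next
  case (coord f D i)
  then obtain f' where f': "\<And>j. f' j \<in> poly_le D"
    "\<And>v. (f has_derivative (\<lambda>u. \<Sum>j\<in>UNIV. u $ j * f' j v)) (at v)" by blast
  let ?g = "\<lambda>j v. (if j = i then f v else 0) + v $ i * f' j v"
  have "(\<lambda>v. if j = i then f v else 0) \<in> poly_le (Suc D)" for j
    using poly_le_mono[OF coord.hyps, of "Suc D"] poly_le_const[of 0 "Suc D"] by (cases "j = i") simp_all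
  then have "?g j \<in> poly_le (Suc D)" for j
    by (rule poly_le_add[OF _ poly_le_times_coord[OF f'(1)]])
  moreover have "((\<lambda>v. v $ i * f v) has_derivative (\<lambda>u. \<Sum>j\<in>UNIV. u $ j * ?g j v)) (at v)" for v
  proof -
    have "(\<Sum>j\<in>UNIV. u $ j * ?g j v) = v $ i * (\<Sum>j\<in>UNIV. u $ j * f' j v) + u $ i * f v" for u
    proof -
      have "(\<Sum>j\<in>UNIV. u $ j * ?g j v)
          = (\<Sum>j\<in>UNIV. if j = i then u $ j * f v else 0) + (\<Sum>j\<in>UNIV. v $ i * (u $ j * f' j v))"
        unfolding sum.distrib[symmetric] by (rule sum.cong) (auto simp: algebra_simps)
      then show ?thesis by (simp add: sum_distrib_left)
    qed
    moreover have "((\<lambda>v. v $ i) has_derivative (\<lambda>u. u $ i)) (at v)"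
      by (rule bounded_linear_imp_has_derivative[OF bounded_linear_vec_nth])
    ultimately show ?thesis
      using has_derivative_mult[OF _ f'(2)] by simp
  qed
  ultimately show ?case by (intro exI[of _ ?g]) blast
next
  case (add f D g)
  then obtain f' g' where "\<And>j. f' j \<in> poly_le D" "\<And>j. g' j \<in> poly_le D"
    "\<And>v. (f has_derivative (\<lambda>u. \<Sum>j\<in>UNIV. u $ j * f' j v)) (at v)"
    "\<And>v. (g has_derivative (\<lambda>u. \<Sum>j\<in>UNIV. u $ j * g' j v)) (at v)" by blast
  then show ?case
    by (intro exI[of _ "\<lambda>j v. f' j v + g' j v"])
      (auto simp: distrib_left sum.distrib intro: poly_le_add has_derivative_add)
qed

lemma poly_le_has_derivative:
  assumes "f \<in> poly_le D"
  shows "(f has_derivative (\<lambda>u. \<Sum>j\<in>UNIV. u $ j * pd j f v)) (at v)"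
proof -
  obtain f' where f': "\<And>v. (f has_derivative (\<lambda>u. \<Sum>j\<in>UNIV. u $ j * f' j v)) (at v)"
    using poly_le_derivative_exists[OF assms] by blast
  have "pd j f v = f' j v" for j by (rule pd_eqI[OF f'])
  with f'[of v] show ?thesis by simp
qed

lemma poly_le_pd:
  assumes "f \<in> poly_le D" shows "pd j f \<in> poly_le D"
proof -
  obtain f' where f': "\<And>j. f' j \<in> poly_le D"
    "\<And>v. (f has_derivative (\<lambda>u. \<Sum>j\<in>UNIV. u $ j * f' j v)) (at v)"
    using poly_le_derivative_exists[OF assms] by blast
  have "pd j f = f' j" by (rule ext) (rule pd_eqI[OF f'(2)])
  with f'(1) show ?thesis by simp
qed

lemma poly_funs_has_derivative:
  "f \<in> poly_funs \<Longrightarrow> (f has_derivative (\<lambda>u. \<Sum>j\<in>UNIV. u $ j * pd j f v)) (at v)"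
  by (auto simp: poly_funs_eq intro: poly_le_has_derivative)

lemma poly_funs_continuous_on: "f \<in> poly_funs \<Longrightarrow> continuous_on S f"
  by (intro continuous_at_imp_continuous_on ballI has_derivative_continuous[OF poly_funs_has_derivative])

lemma poly_funs_pd: "f \<in> poly_funs \<Longrightarrow> pd j f \<in> poly_funs"
  by (auto simp: poly_funs_eq intro: poly_le_pd)

text \<open>First-order expansion at \<open>w\<close> with polynomial coefficients instead of an
  error term. It makes membership in ideals accessible to linear algebra over the polynomial
  ring.\<close>

lemma poly_funs_taylor:
  assumes "f \<in> poly_funs"
  obtains b where "\<And>j. b j \<in> poly_funs" "\<And>v. f v = f w + (\<Sum>j\<in>UNIV. b j v * (v $ j - w $ j))"
    "\<And>j. b j w = pd j f w"
proof -
  obtain D where D: "f \<in> poly_le D" using assms by (auto simp: poly_funs_eq)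
  then have "\<exists>b. (\<forall>j. b j \<in> poly_funs) \<and> (\<forall>v. f v = f w + (\<Sum>j\<in>UNIV. b j v * (v $ j - w $ j)))"
  proof (induction rule: poly_le_induct)
    case (const a D)
    then show ?case by (intro exI[of _ "\<lambda>j v. 0"]) (auto intro: poly_funs_const)
  next
    case (coord f D i)
    then obtain b where b: "\<And>j. b j \<in> poly_funs"
      "\<And>v. f v = f w + (\<Sum>j\<in>UNIV. b j v * (v $ j - w $ j))" by blast
    \<comment> \<open>From v_i f(v) - w_i f(w) = f(w) (v_i - w_i) + v_i (f(v) - f(w)).\<close>
    let ?b = "\<lambda>j v. (if j = i then f w else 0) + v $ i * b j v"
    have "(\<lambda>v. if j = i then f w else 0) \<in> poly_funs" for j
      by (rule poly_funs_const)
    then have "?b j \<in> poly_funs" for j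
      using b(1) by (intro poly_funs_add poly_funs_mult poly_funs_coord)
    moreover have "v $ i * f v = w $ i * f w + (\<Sum>j\<in>UNIV. ?b j v * (v $ j - w $ j))" for v
    proof -
      have "(\<Sum>j\<in>UNIV. ?b j v * (v $ j - w $ j))
          = (\<Sum>j\<in>UNIV. if j = i then f w * (v $ j - w $ j) else 0)
            + (\<Sum>j\<in>UNIV. v $ i * (b j v * (v $ j - w $ j)))"
        unfolding sum.distrib[symmetric] by (rule sum.cong) (auto simp: algebra_simps)
      also have "\<dots> = f w * (v $ i - w $ i) + v $ i * (\<Sum>j\<in>UNIV. b j v * (v $ j - w $ j))"
        by (simp add: sum_distrib_left)
      also have "(\<Sum>j\<in>UNIV. b j v * (v $ j - w $ j)) = f v - f w"
        by (subst b(2)[of v]) simp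
      finally show ?thesis by (simp add: algebra_simps)
    qed
    ultimately show ?case by (intro exI[of _ ?b]) blast
  next
    case (add f D g)
    then obtain b c where bc: "\<And>j. b j \<in> poly_funs" "\<And>j. c j \<in> poly_funs"
      "\<And>v. f v = f w + (\<Sum>j\<in>UNIV. b j v * (v $ j - w $ j))"
      "\<And>v. g v = g w + (\<Sum>j\<in>UNIV. c j v * (v $ j - w $ j))" by blast
    have "f v + g v = f w + g w + (\<Sum>j\<in>UNIV. (b j v + c j v) * (v $ j - w $ j))" for v
      by (subst bc(3)[of v], subst bc(4)[of v]) (simp add: distrib_right sum.distrib)
    then show ?case
      using bc(1,2) by (intro exI[of _ "\<lambda>j v. b j v + c j v"] conjI allI poly_funs_add)
  qed
  then obtain b where b: "\<And>j. b j \<in> poly_funs"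
    "\<And>v. f v = f w + (\<Sum>j\<in>UNIV. b j v * (v $ j - w $ j))" by blast
  \<comment> \<open>In the derivative of the expansion, the derivatives of the \<open>b j\<close>
    are multiplied by \<open>w $ j - w $ j\<close>. Only the \<open>b j w\<close> remain, and
    uniqueness of the derivative identifies them.\<close>
  have "(f has_derivative (\<lambda>u. \<Sum>j\<in>UNIV. u $ j * b j w)) (at w)"
  proof -
    have "((\<lambda>v. v $ j - w $ j) has_derivative (\<lambda>u. u $ j)) (at w)" for j
      using has_derivative_diff[OF bounded_linear_imp_has_derivative[OF bounded_linear_vec_nth[of j]]
          has_derivative_const[of "w $ j"]] by simp
    then have d: "((\<lambda>v. b j v * (v $ j - w $ j)) has_derivative
        (\<lambda>u. b j w * (u $ j) + (\<Sum>k\<in>UNIV. u $ k * pd k (b j) w) * (w $ j - w $ j))) (at w)" for j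
      by (rule has_derivative_mult[OF poly_funs_has_derivative[OF b(1)]])
    have D: "((\<lambda>v. f w + (\<Sum>j\<in>UNIV. b j v * (v $ j - w $ j))) has_derivative
        (\<lambda>u. 0 + (\<Sum>j\<in>UNIV. b j w * (u $ j) + (\<Sum>k\<in>UNIV. u $ k * pd k (b j) w) * (w $ j - w $ j)))) (at w)"
      by (rule has_derivative_add[OF has_derivative_const has_derivative_sum[OF d]])
    have F: "(\<lambda>v. f w + (\<Sum>j\<in>UNIV. b j v * (v $ j - w $ j))) = f"
      by (rule ext) (rule b(2)[symmetric])
    show ?thesis
      using D unfolding F by (simp add: mult.commute)
  qed
  from pd_eqI[OF this, symmetric] show thesis by (rule that[of b, OF b])
qed

section \<open>The ideal of the fixed point locus\<close>

definition gen_ideal :: "('n \<Rightarrow> complex ^ 'n \<Rightarrow> complex) \<Rightarrow> (complex ^ 'n \<Rightarrow> complex) set" where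
  "gen_ideal F = {\<lambda>v. \<Sum>i\<in>UNIV. g i v * F i v | g. \<forall>i. g i \<in> poly_funs}"

lemma gen_idealI: "(\<And>i. g i \<in> poly_funs) \<Longrightarrow> (\<lambda>v. \<Sum>i\<in>UNIV. g i v * F i v) \<in> gen_ideal F"
  unfolding gen_ideal_def by (intro CollectI exI[of _ g]) simp

lemma gen_idealD:
  "f \<in> gen_ideal F \<Longrightarrow> \<exists>g. (\<forall>i. g i \<in> poly_funs) \<and> f = (\<lambda>v. \<Sum>i\<in>UNIV. g i v * F i v)"
  by (auto simp: gen_ideal_def)

lemma gen_ideal_zero_at: "f \<in> gen_ideal F \<Longrightarrow> (\<And>i. F i z = 0) \<Longrightarrow> f z = 0"
  using gen_idealD[of f F] by auto

lemma poly_ideal_gen_ideal: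
  assumes F: "\<And>i. F i \<in> poly_funs"
  shows "poly_ideal (gen_ideal F)"
proof (rule poly_idealI)
  show "gen_ideal F \<subseteq> poly_funs"
    by (auto simp: gen_ideal_def intro!: poly_funs_sum poly_funs_mult F)
  show "(\<lambda>v. 0) \<in> gen_ideal F"
    using gen_idealI[of "\<lambda>_ _. 0" F] poly_funs_const[of 0] by simp
next
  fix f g assume f: "f \<in> gen_ideal F" and g: "g \<in> gen_ideal F"
  obtain a where a: "\<forall>i. a i \<in> poly_funs" "f = (\<lambda>v. \<Sum>i\<in>UNIV. a i v * F i v)"
    using gen_idealD[OF f] by (elim exE conjE)
  obtain b where b: "\<forall>i. b i \<in> poly_funs" "g = (\<lambda>v. \<Sum>i\<in>UNIV. b i v * F i v)"
    using gen_idealD[OF g] by (elim exE conjE)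
  have "(\<lambda>v. \<Sum>i\<in>UNIV. (a i v + b i v) * F i v) \<in> gen_ideal F"
    using a(1) b(1) by (intro gen_idealI poly_funs_add) simp_all
  then show "(\<lambda>v. f v + g v) \<in> gen_ideal F"
    by (simp add: a(2) b(2) distrib_right sum.distrib)
next
  fix f g :: "complex ^ 'a \<Rightarrow> complex" assume g: "g \<in> poly_funs" and f: "f \<in> gen_ideal F"
  obtain a where a: "\<forall>i. a i \<in> poly_funs" "f = (\<lambda>v. \<Sum>i\<in>UNIV. a i v * F i v)"
    using gen_idealD[OF f] by (elim exE conjE)
  have "(\<lambda>v. \<Sum>i\<in>UNIV. (g v * a i v) * F i v) \<in> gen_ideal F"
    using a(1) g by (intro gen_idealI poly_funs_mult) simp_all
  then show "(\<lambda>v. g v * f v) \<in> gen_ideal F"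
    by (simp add: a(2) sum_distrib_left mult_ac)
qed

lemma gen_ideal_generator: "F i \<in> gen_ideal F"
proof -
  have "(\<lambda>v. \<Sum>j\<in>UNIV. (if j = i then 1 else 0) * F j v) \<in> gen_ideal F"
    by (rule gen_idealI[of "\<lambda>j v. if j = i then 1 else 0"]) (rule poly_funs_const)
  moreover have "(\<Sum>j\<in>UNIV. (if j = i then 1 else 0) * F j v) = F i v" for v
  proof -
    have "(\<Sum>j\<in>UNIV. (if j = i then 1 else 0) * F j v) = (\<Sum>j\<in>UNIV. if j = i then F j v else 0)"
      by (rule sum.cong) auto
    then show ?thesis by simp
  qed
  ultimately show ?thesis by simp
qed

text \<open>The F_i of the overview; \<open>jac\<close> is the function E.\<close>

definition fix_eqn :: "(complex ^ 'n \<Rightarrow> complex ^ 'n) \<Rightarrow> 'n \<Rightarrow> complex ^ 'n \<Rightarrow> complex" where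
  "fix_eqn \<Theta> i v = \<Theta> v $ i - v $ i"

definition jac :: "(complex ^ 'n \<Rightarrow> complex ^ 'n) \<Rightarrow> complex ^ 'n \<Rightarrow> complex" where
  "jac \<Theta> v = det (\<chi> i j. pd j (fix_eqn \<Theta> i) v)"

definition nondegenerate :: "(complex ^ 'n \<Rightarrow> complex ^ 'n) \<Rightarrow> bool" where
  "nondegenerate \<Theta> \<longleftrightarrow> (\<forall>v. \<Theta> v = v \<longrightarrow> jac \<Theta> v \<noteq> 0)"

text \<open>The exponent 0 is harmless: if 1 lies in the ideal, so does everything.\<close>

definition radical_fix_ideal :: "(complex ^ 'n \<Rightarrow> complex ^ 'n) \<Rightarrow> bool" where
  "radical_fix_ideal \<Theta> \<longleftrightarrow>
     (\<forall>f\<in>poly_funs. \<forall>r. (\<lambda>v. f v ^ r) \<in> gen_ideal (fix_eqn \<Theta>) \<longrightarrow> f \<in> gen_ideal (fix_eqn \<Theta>))"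

lemma fix_eqn_zero_iff: "(\<forall>i. fix_eqn \<Theta> i v = 0) \<longleftrightarrow> \<Theta> v = v"
  by (simp add: fix_eqn_def vec_eq_iff)

section \<open>Homogeneous systems of parameters: reduction modulo the fixed point equations\<close>

lemma monomial_split_power:
  fixes v :: "complex ^ 'n"
  assumes "r \<le> m j"
  shows "(\<Prod>i\<in>UNIV. (v $ i) ^ m i)
    = (v $ j) ^ r * (\<Prod>i\<in>UNIV. (v $ i) ^ (m (j := m j - r)) i)"
proof -
  have "(\<Prod>i\<in>UNIV - {j}. (v $ i) ^ (m (j := m j - r)) i) = (\<Prod>i\<in>UNIV - {j}. (v $ i) ^ m i)"
    by (rule prod.cong) auto
  moreover have "(v $ j) ^ m j = (v $ j) ^ r * (v $ j) ^ (m j - r)"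
    using assms by (simp flip: power_add)
  ultimately show ?thesis
    by (subst (1 2) prod.remove[of UNIV j]) simp_all
qed

lemma poly_funs_monomial: "(\<lambda>v. \<Prod>i\<in>UNIV. (v $ i) ^ m i) \<in> poly_funs"
  by (intro poly_funs_prod poly_funs_power poly_funs_coord)

text \<open>A product with one factor for each other point \<open>w\<close>: the difference in a
  coordinate that tells \<open>w\<close> from \<open>z\<close>.\<close>

lemma separating_poly:
  assumes "finite L"
  shows "\<exists>l\<in>poly_funs. l z \<noteq> 0 \<and> (\<forall>w\<in>L - {z}. l w = 0)"
proof -
  have "\<exists>j. w \<noteq> z \<longrightarrow> z $ j \<noteq> w $ j" for w
    by (metis vec_eq_iff)
  then obtain j where j: "\<And>w. w \<noteq> z \<Longrightarrow> z $ j w \<noteq> w $ j w"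
    by metis
  show ?thesis
  proof (rule bexI, intro conjI ballI)
    show "(\<lambda>v. \<Prod>w\<in>L - {z}. v $ j w - w $ j w) \<in> poly_funs"
      by (intro poly_funs_prod poly_funs_diff poly_funs_coord poly_funs_const)
    show "(\<Prod>w\<in>L - {z}. z $ j w - w $ j w) \<noteq> 0"
      using j assms by simp
    show "(\<Prod>w'\<in>L - {z}. w $ j w' - w' $ j w') = 0" if "w \<in> L - {z}" for w
      using that assms by (intro prod_zero) auto
  qed
qed

text \<open>Degree at least 2 makes \<open>\<Theta> v $ i\<close> the leading form of
  \<open>fix_eqn \<Theta> i\<close>, so that the equations lower degrees, and it bounds the fixed
  points.\<close>

locale homogeneous_map =
  fixes \<Theta> :: "complex ^ 'n \<Rightarrow> complex ^ 'n" and d :: nat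
  assumes deg: "\<And>i. (\<lambda>v. \<Theta> v $ i) \<in> poly_funs_deg d" and d_ge_2: "d \<ge> 2"
begin

lemma component_poly_le: "(\<lambda>v. \<Theta> v $ i) \<in> poly_le d"
  using deg poly_funs_deg_subset_poly_le by blast

lemma component_poly_funs: "(\<lambda>v. \<Theta> v $ i) \<in> poly_funs"
  by (rule poly_le_poly_funs[OF component_poly_le])

lemma fix_eqn_poly_le: "fix_eqn \<Theta> i \<in> poly_le d"
proof -
  have "(\<lambda>v. \<Theta> v $ i - v $ i) \<in> poly_le d"
    using d_ge_2 by (intro poly_le_diff component_poly_le poly_le_mono[OF poly_le_coord]) simp
  then show ?thesis by (simp add: fix_eqn_def[abs_def])
qed

lemma fix_eqn_poly_funs: "fix_eqn \<Theta> i \<in> poly_funs"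
  by (rule poly_le_poly_funs[OF fix_eqn_poly_le])

lemma jac_poly_le: "jac \<Theta> \<in> poly_le (CARD('n) * d)"
proof -
  have "(\<lambda>v. \<Sum>p | p permutes UNIV. of_int (sign p) * (\<Prod>i\<in>UNIV. pd (p i) (fix_eqn \<Theta> i) v))
      \<in> poly_le (\<Sum>i\<in>(UNIV :: 'n set). d)"
    by (intro poly_le_sum poly_le_cmult poly_le_prod poly_le_pd fix_eqn_poly_le)
  then show ?thesis by (simp add: jac_def[abs_def] det_def)
qed

lemma zero: "\<Theta> 0 = 0"
proof -
  have "\<Theta> 0 $ i = 0" for i
    using poly_funs_deg_homogeneous[OF deg[of i], of 0 0] d_ge_2 by (simp add: power_0_left)
  then show ?thesis by (simp add: vec_eq_iff)
qed

lemma hsop_iff: "hsop \<Theta> \<longleftrightarrow> (\<forall>v. \<Theta> v = 0 \<longrightarrow> v = 0)"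
  using zero by (auto simp: hsop_def)

text \<open>By the Nullstellensatz a power of each coordinate lies in the ideal. A monomial whose
  degree reaches the sum of these exponents is divisible by one of the powers.\<close>

lemma forms_in_component_ideal:
  assumes "hsop \<Theta>"
  shows "\<exists>N\<ge>d. \<forall>e\<ge>N. \<forall>f\<in>poly_funs_deg e. f \<in> gen_ideal (\<lambda>i v. \<Theta> v $ i)"
proof -
  let ?J = "gen_ideal (\<lambda>i v. \<Theta> v $ i)"
  have J: "poly_ideal ?J"
    by (intro poly_ideal_gen_ideal component_poly_funs)
  have "\<forall>j. \<exists>r. (\<lambda>v. (v $ j) ^ r) \<in> ?J"
  proof
    fix j show "\<exists>r. (\<lambda>v. (v $ j) ^ r) \<in> ?J"
    proof (rule nullstellensatz[OF J poly_funs_coord])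
      fix z assume "\<forall>g\<in>?J. g z = 0"
      then have "\<Theta> z $ i = 0" for i
        using gen_ideal_generator[of "\<lambda>i v. \<Theta> v $ i" i] by (rule bspec)
      then have "z = 0"
        using assms by (simp add: hsop_iff vec_eq_iff)
      then show "z $ j = 0" by simp
    qed
  qed
  from choice[OF this] obtain r where r: "\<forall>j. (\<lambda>v. (v $ j) ^ r j) \<in> ?J" ..
  show ?thesis
  \<comment> \<open>The summand \<open>d\<close> only secures \<open>N \<ge> d\<close>.\<close>
  proof (intro exI[of _ "(\<Sum>j\<in>UNIV. r j) + d"] conjI allI impI ballI)
    fix e and f :: "complex ^ 'n \<Rightarrow> complex"
    assume e: "(\<Sum>j\<in>UNIV. r j) + d \<le> e" and "f \<in> poly_funs_deg e"
    then obtain a where f: "f = (\<lambda>v. \<Sum>m | (\<Sum>i\<in>UNIV. m i) = e. a m * (\<Prod>i\<in>UNIV. (v $ i) ^ m i))"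
      unfolding poly_funs_deg_def by auto
    have "(\<lambda>v. \<Prod>i\<in>UNIV. (v $ i) ^ m i) \<in> ?J" if m: "(\<Sum>i\<in>UNIV. m i) = e" for m
    proof -
      have "\<exists>j. r j \<le> m j"
      proof (rule ccontr)
        assume "\<not> (\<exists>j. r j \<le> m j)"
        then have "(\<Sum>j\<in>UNIV. m j) < (\<Sum>j\<in>UNIV. r j)"
          by (intro sum_strict_mono) (auto simp: not_le)
        with m e show False by simp
      qed
      then obtain j where j: "r j \<le> m j" ..
      have "(\<lambda>v. (v $ j) ^ r j * (\<Prod>i\<in>UNIV. (v $ i) ^ (m (j := m j - r j)) i)) \<in> ?J"
        by (rule poly_ideal_mult_right[OF J r[THEN spec] poly_funs_monomial])
      then show ?thesis
        unfolding monomial_split_power[of "r j" m j, OF j] .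
    qed
    then show "f \<in> ?J"
      unfolding f by (intro poly_ideal_sum[OF J] poly_ideal_cmult[OF J]) simp
  qed simp
qed

text \<open>Both sides at \<open>t *s v\<close> are polynomials in \<open>t\<close>. Comparing
  coefficients of \<open>t ^ e\<close> keeps exactly the components of the cofactors of degree
  \<open>e - d\<close>.\<close>

lemma homogeneous_coefficients:
  assumes e: "e \<ge> d" and f: "f \<in> poly_funs_deg e" and fI: "f \<in> gen_ideal (\<lambda>i v. \<Theta> v $ i)"
  shows "\<exists>g. (\<forall>i. g i \<in> poly_funs_deg (e - d)) \<and> f = (\<lambda>v. \<Sum>i\<in>UNIV. g i v * \<Theta> v $ i)"
proof -
  obtain g where g: "\<forall>i. g i \<in> poly_funs" "f = (\<lambda>v. \<Sum>i\<in>UNIV. g i v * \<Theta> v $ i)"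
    using gen_idealD[OF fI] by (elim exE conjE)
  have "\<forall>i. \<exists>D. g i \<in> poly_le D"
    using g(1) unfolding poly_funs_eq by simp
  from choice[OF this] obtain D where D: "\<forall>i. g i \<in> poly_le (D i)" ..
  \<comment> \<open>A common degree bound for all cofactors; adding \<open>e\<close> ensures that
    the component of degree \<open>e - d\<close> is among those considered.\<close>
  define K where "K = (\<Sum>i\<in>UNIV. D i) + e"
  have "g i \<in> poly_le K" for i
    by (rule poly_le_mono[OF D[THEN spec]]) (simp add: K_def member_le_sum trans_le_add1)
  then have "\<forall>i. \<exists>p. (\<forall>k\<le>K. p k \<in> poly_funs_deg k) \<and> g i = (\<lambda>v. \<Sum>k\<le>K. p k v)"
    by (intro allI poly_le_decompose)
  from choice[OF this] obtain p where
    p: "\<forall>i. (\<forall>k\<le>K. p i k \<in> poly_funs_deg k) \<and> g i = (\<lambda>v. \<Sum>k\<le>K. p i k v)" ..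
  then have p1: "p i k \<in> poly_funs_deg k" if "k \<le> K" for i k
    using that by simp
  from p have p2: "g i v = (\<Sum>k\<le>K. p i k v)" for i v by simp
  have "f v = (\<Sum>i\<in>UNIV. p i (e - d) v * \<Theta> v $ i)" for v
  proof -
    define c where "c k = (\<Sum>i\<in>UNIV. p i k v * \<Theta> v $ i)" for k
    have "poly (Polynomial.monom (f v) e) t = poly (\<Sum>k\<le>K. Polynomial.monom (c k) (k + d)) t" for t
    proof -
      have "t ^ e * f v = f (t *s v)"
        by (rule poly_funs_deg_homogeneous[OF f, symmetric])
      also have "\<dots> = (\<Sum>i\<in>UNIV. (\<Sum>k\<le>K. t ^ k * p i k v) * (t ^ d * \<Theta> v $ i))"
        unfolding g(2)
      proof (rule sum.cong[OF refl])
        fix i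
        have "g i (t *s v) = (\<Sum>k\<le>K. t ^ k * p i k v)"
          unfolding p2 by (rule sum.cong) (auto simp: poly_funs_deg_homogeneous[OF p1])
        then show "g i (t *s v) * \<Theta> (t *s v) $ i = (\<Sum>k\<le>K. t ^ k * p i k v) * (t ^ d * \<Theta> v $ i)"
          by (simp add: poly_funs_deg_homogeneous[OF deg])
      qed
      also have "\<dots> = (\<Sum>i\<in>UNIV. \<Sum>k\<le>K. p i k v * \<Theta> v $ i * t ^ (k + d))"
        by (simp add: sum_distrib_left sum_distrib_right power_add mult_ac)
      also have "\<dots> = (\<Sum>k\<le>K. \<Sum>i\<in>UNIV. p i k v * \<Theta> v $ i * t ^ (k + d))"
        by (rule sum.swap)
      also have "\<dots> = (\<Sum>k\<le>K. c k * t ^ (k + d))"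
        by (simp add: c_def sum_distrib_right)
      finally show ?thesis
        by (simp add: poly_monom poly_sum mult.commute)
    qed
    then have "Polynomial.monom (f v) e = (\<Sum>k\<le>K. Polynomial.monom (c k) (k + d))"
      by (simp only: poly_eq_poly_eq_iff[symmetric] fun_eq_iff simp_thms)
    then have "Polynomial.coeff (Polynomial.monom (f v) e) e = Polynomial.coeff (\<Sum>k\<le>K. Polynomial.monom (c k) (k + d)) e"
      by (rule arg_cong)
    also have "\<dots> = (\<Sum>k\<le>K. if k = e - d then c k else 0)"
      unfolding coeff_sum coeff_monom using e by (intro sum.cong) auto
    also have "\<dots> = c (e - d)"
      by (simp add: K_def)
    finally show ?thesis by (simp add: c_def)
  qed
  moreover have "p i (e - d) \<in> poly_funs_deg (e - d)" for i
    by (rule p1) (simp add: K_def)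
  ultimately show ?thesis
    by (intro exI[of _ "\<lambda>i. p i (e - d)"] conjI allI ext)
qed

lemma forms_generated:
  assumes "hsop \<Theta>"
  shows "\<exists>N\<ge>d. \<forall>e\<ge>N. \<forall>f\<in>poly_funs_deg e.
       \<exists>g. (\<forall>i. g i \<in> poly_funs_deg (e - d)) \<and> f = (\<lambda>v. \<Sum>i\<in>UNIV. g i v * \<Theta> v $ i)"
proof -
  obtain N where N: "N \<ge> d"
    "\<forall>e\<ge>N. \<forall>f\<in>poly_funs_deg e. f \<in> gen_ideal (\<lambda>i v. \<Theta> v $ i)"
    using forms_in_component_ideal[OF assms] by (elim exE conjE)
  show ?thesis
  proof (intro exI[of _ N] conjI allI impI ballI N(1))
    fix e and f :: "complex ^ 'n \<Rightarrow> complex" assume e: "e \<ge> N" "f \<in> poly_funs_deg e"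
    show "\<exists>g. (\<forall>i. g i \<in> poly_funs_deg (e - d)) \<and> f = (\<lambda>v. \<Sum>i\<in>UNIV. g i v * \<Theta> v $ i)"
      using N(2) e by (intro homogeneous_coefficients[OF order_trans[OF N(1) e(1)] e(2)]) simp
  qed
qed

text \<open>The leading form of \<open>f\<close> is a combination of the components of \<Theta>.
  Replacing \<Theta>_i by F_i + x_i turns it into a combination of the F_i plus terms of lower
  degree, because x_i has degree 1 < d. The bound \<open>D - d\<close> on the cofactors is what
  makes spanning conditions in bounded degree available; below degree \<open>d\<close> the cofactors
  are zero.\<close>

lemma reduction:
  assumes "hsop \<Theta>"
  shows "\<exists>N\<ge>d. \<forall>D. \<forall>f\<in>poly_le D.
    \<exists>f'\<in>poly_le N. \<exists>g. (\<forall>i. g i \<in> poly_le (D - d)) \<and>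
      (\<forall>v. f v = f' v + (\<Sum>i\<in>UNIV. g i v * fix_eqn \<Theta> i v))"
proof -
  obtain N where N: "N \<ge> d" "\<forall>e\<ge>N. \<forall>f\<in>poly_funs_deg e.
       \<exists>g. (\<forall>i. g i \<in> poly_funs_deg (e - d)) \<and> f = (\<lambda>v. \<Sum>i\<in>UNIV. g i v * \<Theta> v $ i)"
    using forms_generated[OF assms] by (elim exE conjE)
  show ?thesis
  proof (intro exI[of _ N] conjI allI impI ballI N(1))
    fix D and f :: "complex ^ 'n \<Rightarrow> complex" assume "f \<in> poly_le D"
    then show "\<exists>f'\<in>poly_le N. \<exists>g. (\<forall>i. g i \<in> poly_le (D - d)) \<and>
      (\<forall>v. f v = f' v + (\<Sum>i\<in>UNIV. g i v * fix_eqn \<Theta> i v))"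
    proof (induction D arbitrary: f)
      case 0
      then have "f \<in> poly_le N" by (rule poly_le_mono) simp
      then show ?case
        by (intro bexI[of _ f] exI[of _ "\<lambda>_ _. 0"]) (auto intro: poly_le_const)
    next
      case (Suc D)
      show ?case
      proof (cases "Suc D \<le> N")
        case True
        then have "f \<in> poly_le N" by (rule poly_le_mono[OF Suc.prems])
        then show ?thesis
          by (intro bexI[of _ f] exI[of _ "\<lambda>_ _. 0"]) (auto intro: poly_le_const)
      next
        case False
        obtain p where p: "\<forall>k\<le>Suc D. p k \<in> poly_funs_deg k" "f = (\<lambda>v. \<Sum>k\<le>Suc D. p k v)"
          using poly_le_decompose[OF Suc.prems] by (elim exE conjE)
        have "p (Suc D) \<in> poly_funs_deg (Suc D)" using p(1) by simp
        with N(2) False have "\<exists>g. (\<forall>i. g i \<in> poly_funs_deg (Suc D - d)) \<and>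
            p (Suc D) = (\<lambda>v. \<Sum>i\<in>UNIV. g i v * \<Theta> v $ i)"
          by simp
        then obtain g where g: "\<forall>i. g i \<in> poly_funs_deg (Suc D - d)"
          "p (Suc D) = (\<lambda>v. \<Sum>i\<in>UNIV. g i v * \<Theta> v $ i)"
          by (elim exE conjE)
        have g': "g i \<in> poly_le (Suc D - d)" for i
          using g(1) poly_funs_deg_subset_poly_le by blast
        \<comment> \<open>Its degree is at most \<open>Suc D - d + 1\<close>, which is at most
          \<open>D\<close> because \<open>d \<ge> 2\<close>.\<close>
        have "(\<lambda>v. v $ i * g i v) \<in> poly_le D" for i
          using poly_le_times_coord[OF g'[of i], of i] d_ge_2 False N(1)
          by (elim poly_le_mono) simp
        moreover have "p k \<in> poly_le D" if "k \<le> D" for k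
          using that p(1) poly_funs_deg_subset_poly_le[of k] by (intro poly_le_mono[of "p k" k D]) auto
        ultimately have "(\<lambda>v. (\<Sum>k\<le>D. p k v) + (\<Sum>i\<in>UNIV. v $ i * g i v)) \<in> poly_le D"
          by (intro poly_le_add poly_le_sum) simp_all
        from Suc.IH[OF this] obtain f' h where h: "f' \<in> poly_le N" "\<forall>i. h i \<in> poly_le (D - d)"
          "\<forall>v. (\<Sum>k\<le>D. p k v) + (\<Sum>i\<in>UNIV. v $ i * g i v)
             = f' v + (\<Sum>i\<in>UNIV. h i v * fix_eqn \<Theta> i v)"
          by (elim bexE exE conjE)
        show ?thesis
        proof (intro bexI[of _ f'] exI[of _ "\<lambda>i v. g i v + h i v"] conjI allI)
          show "(\<lambda>v. g i v + h i v) \<in> poly_le (Suc D - d)" for i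
            using g' poly_le_mono[OF h(2)[THEN spec], of "Suc D - d"] by (intro poly_le_add) simp_all
          show "f v = f' v + (\<Sum>i\<in>UNIV. (g i v + h i v) * fix_eqn \<Theta> i v)" for v
          proof -
            have "f v = (\<Sum>k\<le>D. p k v) + (\<Sum>i\<in>UNIV. g i v * \<Theta> v $ i)"
              by (simp add: p(2) g(2))
            also have "\<dots> = ((\<Sum>k\<le>D. p k v) + (\<Sum>i\<in>UNIV. v $ i * g i v))
                + (\<Sum>i\<in>UNIV. g i v * fix_eqn \<Theta> i v)"
              by (simp add: fix_eqn_def right_diff_distrib sum_subtractf mult.commute)
            also have "(\<Sum>k\<le>D. p k v) + (\<Sum>i\<in>UNIV. v $ i * g i v)
                = f' v + (\<Sum>i\<in>UNIV. h i v * fix_eqn \<Theta> i v)"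
              using h(3) by simp
            finally show ?thesis by (simp add: distrib_right sum.distrib)
          qed
        qed (rule h(1))
      qed
    qed
  qed
qed

text \<open>By \<open>reduction\<close>, every polynomial agrees on the fixed points with one from
  the finite-dimensional \<open>poly_le N\<close>. Functions separating \<open>Suc (card B)\<close>
  fixed points would be independent there, one too many.\<close>

lemma finite_fixed_points:
  assumes "hsop \<Theta>"
  shows "finite {v. \<Theta> v = v}"
proof (rule ccontr)
  assume inf: "infinite {v. \<Theta> v = v}"
  obtain N where N: "N \<ge> d" "\<forall>D. \<forall>f\<in>poly_le D.
    \<exists>f'\<in>poly_le N. \<exists>g. (\<forall>i. g i \<in> poly_le (D - d)) \<and>
      (\<forall>v. f v = f' v + (\<Sum>i\<in>UNIV. g i v * fix_eqn \<Theta> i v))"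
    using reduction[OF assms] by (elim exE conjE)
  obtain B :: "(complex ^ 'n \<Rightarrow> complex) set" where B: "finite B" "poly_le N \<subseteq> fun_space.span B"
    using poly_le_finite_span[of N] by (elim exE conjE) (rule that)
  obtain L where L: "finite L" "card L = Suc (card B)" "L \<subseteq> {v. \<Theta> v = v}"
    using infinite_arbitrarily_large[OF inf, of "Suc (card B)"] by blast
  have "\<forall>z. \<exists>f\<in>poly_le N. z \<in> L \<longrightarrow> f z \<noteq> 0 \<and> (\<forall>w\<in>L - {z}. f w = 0)"
  proof
    fix z
    obtain l where l: "l \<in> poly_funs" "l z \<noteq> 0" "\<forall>w\<in>L - {z}. l w = 0"
      using separating_poly[OF L(1), of z] by (elim bexE conjE)
    obtain D where "l \<in> poly_le D"
      using l(1) unfolding poly_funs_eq by (rule UN_E)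
    from N(2)[THEN spec, THEN bspec, OF this] obtain f' g where f': "f' \<in> poly_le N"
      "\<forall>v. l v = f' v + (\<Sum>i\<in>UNIV. g i v * fix_eqn \<Theta> i v)"
      by (elim bexE exE conjE)
    have "l w = f' w" if "w \<in> L" for w
    proof -
      have "fix_eqn \<Theta> i w = 0" for i
        using that L(3) fix_eqn_zero_iff[of \<Theta> w] by auto
      with f'(2) show ?thesis by simp
    qed
    then show "\<exists>f\<in>poly_le N. z \<in> L \<longrightarrow> f z \<noteq> 0 \<and> (\<forall>w\<in>L - {z}. f w = 0)"
      using l(2,3) f'(1) by (intro bexI[of _ f']) auto
  qed
  from bchoice[of UNIV, simplified, OF this[unfolded Bex_def]] obtain p where
    p: "\<forall>z. p z \<in> poly_le N \<and> (z \<in> L \<longrightarrow> p z z \<noteq> 0 \<and> (\<forall>w\<in>L - {z}. p z w = 0))" ..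
  have "indep_family L p"
  proof (rule indep_familyI)
    fix c w assume c: "\<And>x. (\<Sum>k\<in>L. c k * p k x) = 0" and w: "w \<in> L"
    have "(\<Sum>k\<in>L. c k * p k w) = (\<Sum>k\<in>{w}. c k * p k w)"
      by (rule sum.mono_neutral_right) (use L(1) w p in auto)
    with c[of w] have "c w * p w w = 0" by simp
    with p w show "c w = 0" by simp
  qed
  then have "card L \<le> card B"
    by (rule indep_family_card_le[OF L(1) _ B(1)]) (use p B(2) in auto)
  with L(2) show False by simp
qed

section \<open>Radicality of the ideal and nondegeneracy of the fixed points\<close>

lemma fix_ideal_zero_iff: "(\<forall>f\<in>gen_ideal (fix_eqn \<Theta>). f z = 0) \<longleftrightarrow> \<Theta> z = z"
proof
  assume "\<forall>f\<in>gen_ideal (fix_eqn \<Theta>). f z = 0"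
  then have "fix_eqn \<Theta> i z = 0" for i
    using gen_ideal_generator[of "fix_eqn \<Theta>" i] by (rule bspec)
  then show "\<Theta> z = z" by (simp add: fix_eqn_zero_iff[symmetric])
next
  assume "\<Theta> z = z"
  then have "fix_eqn \<Theta> i z = 0" for i by (simp add: fix_eqn_def)
  then show "\<forall>f\<in>gen_ideal (fix_eqn \<Theta>). f z = 0"
    using gen_ideal_zero_at by blast
qed

lemma fix_ideal: "poly_ideal (gen_ideal (fix_eqn \<Theta>))"
  by (intro poly_ideal_gen_ideal fix_eqn_poly_funs)

text \<open>If \<open>u \<noteq> 0\<close> is in the kernel of the derivative at a fixed point \<open>z\<close>, then all elements of the
  ideal have derivative zero at \<open>z\<close> in direction \<open>u\<close>. But some function vanishing on the finite
  fixed point set does not.\<close>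

lemma radical_imp_nondegenerate:
  assumes "hsop \<Theta>" "radical_fix_ideal \<Theta>"
  shows "nondegenerate \<Theta>"
  unfolding nondegenerate_def
proof (intro allI impI notI)
  fix z assume z: "\<Theta> z = z" and "jac \<Theta> z = 0"
  let ?A = "\<chi> i j. pd j (fix_eqn \<Theta> i) z"
  have "\<not> invertible ?A"
    using \<open>jac \<Theta> z = 0\<close> by (simp add: invertible_det_nz jac_def)
  then obtain u where u: "?A *v u = 0" "u \<noteq> 0"
    unfolding invertible_left_inverse matrix_left_invertible_ker by auto
  have Au: "(\<Sum>j\<in>UNIV. u $ j * pd j (fix_eqn \<Theta> i) z) = 0" for i
    using u(1) by (simp add: vec_eq_iff matrix_vector_mult_def mult.commute)
  obtain j where j: "u $ j \<noteq> 0" using u(2) by (auto simp: vec_eq_iff)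
  obtain l where l: "l \<in> poly_funs" "l z \<noteq> 0" "\<forall>w\<in>{v. \<Theta> v = v} - {z}. l w = 0"
    using separating_poly[OF finite_fixed_points[OF assms(1)], of z] by (elim bexE conjE)
  \<comment> \<open>It vanishes at all fixed points, so a power of it lies in the ideal, while its
    derivative at \<open>z\<close> in direction \<open>u\<close> is \<open>u $ j * l z\<close>,
    which is nonzero.\<close>
  let ?f = "\<lambda>v. (v $ j - z $ j) * l v"
  have f: "?f \<in> poly_funs"
    by (intro poly_funs_mult poly_funs_diff poly_funs_coord poly_funs_const l)
  have "\<exists>r. (\<lambda>v. ?f v ^ r) \<in> gen_ideal (fix_eqn \<Theta>)"
  proof (rule nullstellensatz[OF fix_ideal f])
    fix w assume "\<forall>g\<in>gen_ideal (fix_eqn \<Theta>). g w = 0"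
    then have "\<Theta> w = w" by (simp only: fix_ideal_zero_iff)
    with l(3) show "?f w = 0" by (cases "w = z") auto
  qed
  then obtain r where r: "(\<lambda>v. ?f v ^ r) \<in> gen_ideal (fix_eqn \<Theta>)" ..
  have fI: "?f \<in> gen_ideal (fix_eqn \<Theta>)"
    by (rule assms(2)[unfolded radical_fix_ideal_def, rule_format, OF f r])
  obtain g where g: "\<forall>i. g i \<in> poly_funs" "?f = (\<lambda>v. \<Sum>i\<in>UNIV. g i v * fix_eqn \<Theta> i v)"
    using gen_idealD[OF fI] by (elim exE conjE)
  have z0: "fix_eqn \<Theta> i z = 0" for i using z by (simp add: fix_eqn_def)
  have "((\<lambda>v. g i v * fix_eqn \<Theta> i v) has_derivative
      (\<lambda>x. g i z * (\<Sum>j\<in>UNIV. x $ j * pd j (fix_eqn \<Theta> i) z)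
        + (\<Sum>j\<in>UNIV. x $ j * pd j (g i) z) * fix_eqn \<Theta> i z)) (at z)" for i
    by (rule has_derivative_mult[OF poly_funs_has_derivative[OF g(1)[THEN spec]]
          poly_funs_has_derivative[OF fix_eqn_poly_funs]])
  from has_derivative_sum[OF this, where I = UNIV]
  have D1: "(?f has_derivative (\<lambda>x. \<Sum>i\<in>UNIV. g i z * (\<Sum>j\<in>UNIV. x $ j * pd j (fix_eqn \<Theta> i) z)
        + (\<Sum>j\<in>UNIV. x $ j * pd j (g i) z) * fix_eqn \<Theta> i z)) (at z)"
    unfolding g(2) .
  have "((\<lambda>v. v $ j - z $ j) has_derivative (\<lambda>x. x $ j)) (at z)"
    using has_derivative_diff[OF bounded_linear_imp_has_derivative[OF bounded_linear_vec_nth[of j]]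
        has_derivative_const[of "z $ j"]] by simp
  from has_derivative_mult[OF this poly_funs_has_derivative[OF l(1)]]
  have D2: "(?f has_derivative
      (\<lambda>x. (z $ j - z $ j) * (\<Sum>k\<in>UNIV. x $ k * pd k l z) + x $ j * l z)) (at z)" .
  from fun_cong[OF has_derivative_unique[OF D1 D2], of u]
  show False using Au z0 j l(2) by simp
qed

text \<open>At a nondegenerate fixed point \<open>w\<close>, Cramer's rule for the Taylor coefficients at \<open>w\<close> gives a
  polynomial not vanishing at \<open>w\<close> that multiplies all functions vanishing at \<open>w\<close> into the ideal.\<close>

lemma local_multiplier:
  assumes nd: "jac \<Theta> w \<noteq> 0" and w: "\<Theta> w = w" and f: "f \<in> poly_funs" "f w = 0"
  shows "\<exists>q\<in>poly_funs. q w \<noteq> 0 \<and> (\<lambda>v. q v * f v) \<in> gen_ideal (fix_eqn \<Theta>)"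
proof -
  have "\<forall>i. \<exists>b. (\<forall>j. b j \<in> poly_funs) \<and>
    (\<forall>v. fix_eqn \<Theta> i v = fix_eqn \<Theta> i w + (\<Sum>j\<in>UNIV. b j v * (v $ j - w $ j))) \<and>
    (\<forall>j. b j w = pd j (fix_eqn \<Theta> i) w)"
  proof
    fix i
    show "\<exists>b. (\<forall>j. b j \<in> poly_funs) \<and>
      (\<forall>v. fix_eqn \<Theta> i v = fix_eqn \<Theta> i w + (\<Sum>j\<in>UNIV. b j v * (v $ j - w $ j))) \<and>
      (\<forall>j. b j w = pd j (fix_eqn \<Theta> i) w)"
      by (rule poly_funs_taylor[OF fix_eqn_poly_funs[of i], where w = w]) blast
  qed
  from choice[OF this] obtain b where b: "\<forall>i. (\<forall>j. b i j \<in> poly_funs) \<and>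
    (\<forall>v. fix_eqn \<Theta> i v = fix_eqn \<Theta> i w + (\<Sum>j\<in>UNIV. b i j v * (v $ j - w $ j))) \<and>
    (\<forall>j. b i j w = pd j (fix_eqn \<Theta> i) w)" ..
  have w0: "fix_eqn \<Theta> i w = 0" for i using w by (simp add: fix_eqn_def)
  have b1: "b i j \<in> poly_funs" for i j using b by simp
  have b2: "(\<Sum>j\<in>UNIV. b i j v * (v $ j - w $ j)) = fix_eqn \<Theta> i v" for i v
  proof -
    have "fix_eqn \<Theta> i v = fix_eqn \<Theta> i w + (\<Sum>j\<in>UNIV. b i j v * (v $ j - w $ j))"
      using b by blast
    then show ?thesis by (simp add: w0)
  qed
  define A where "A v = (\<chi> i j. b i j v)" for v
  have det_A: "det (A v) = (\<Sum>p | p permutes UNIV. of_int (sign p) * (\<Prod>i\<in>UNIV. b i (p i) v))" for v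
    by (simp add: det_def A_def)
  have q: "(\<lambda>v. det (A v)) \<in> poly_funs"
    unfolding det_A by (intro poly_funs_sum poly_funs_mult poly_funs_const poly_funs_prod b1)
  have "A w = (\<chi> i j. pd j (fix_eqn \<Theta> i) w)"
    using b by (simp add: A_def vec_eq_iff)
  then have qw: "det (A w) \<noteq> 0"
    using nd by (simp add: jac_def)
  have lin: "(\<lambda>v. (v $ k - w $ k) * det (A v)) \<in> gen_ideal (fix_eqn \<Theta>)" for k
  proof -
    \<comment> \<open>Cramer's rule: column \<open>k\<close> of the matrix is replaced by the
      equations. Each term of the Leibniz expansion then contains one of them as a factor.\<close>
    have "(v $ k - w $ k) * det (A v) = (\<Sum>p | p permutes UNIV. of_int (sign p) *
        (\<Prod>i\<in>UNIV. if p i = k then fix_eqn \<Theta> i v else b i (p i) v))" for v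
    proof -
      have "(v $ k - w $ k) * det (A v)
          = det (\<chi> i j. if j = k then (A v *v (v - w)) $ i else A v $ i $ j)"
        by (simp add: cramer_lemma)
      also have "(\<chi> i j. if j = k then (A v *v (v - w)) $ i else A v $ i $ j)
          = (\<chi> i j. if j = k then fix_eqn \<Theta> i v else b i j v)"
        by (simp add: matrix_vector_mult_def A_def b2 cong: if_cong)
      finally show ?thesis by (simp add: det_def)
    qed
    moreover have "(\<lambda>v. \<Prod>i\<in>UNIV. if p i = k then fix_eqn \<Theta> i v else b i (p i) v)
        \<in> gen_ideal (fix_eqn \<Theta>)" if p: "p permutes UNIV" for p
    proof -
      obtain i where i: "p i = k"
        using permutes_surj[OF p] by (metis surj_def)
      show ?thesis
      proof (rule poly_ideal_prod[OF fix_ideal, where i = i])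
        show "(\<lambda>v. if p i = k then fix_eqn \<Theta> i v else b i (p i) v) \<in> gen_ideal (fix_eqn \<Theta>)"
          using gen_ideal_generator[of "fix_eqn \<Theta>" i] i by simp
        show "(\<lambda>v. if p i = k then fix_eqn \<Theta> i v else b i (p i) v) \<in> poly_funs" for i
          using b1 fix_eqn_poly_funs by (cases "p i = k") simp_all
      qed simp_all
    qed
    ultimately show ?thesis
      by (simp only:) (intro poly_ideal_sum[OF fix_ideal] poly_ideal_cmult[OF fix_ideal], simp)
  qed
  obtain a where a: "\<And>j. a j \<in> poly_funs" "\<And>v. f v = f w + (\<Sum>j\<in>UNIV. a j v * (v $ j - w $ j))"
    using poly_funs_taylor[OF f(1), of w] by metis
  have "(\<lambda>v. \<Sum>j\<in>UNIV. a j v * ((v $ j - w $ j) * det (A v))) \<in> gen_ideal (fix_eqn \<Theta>)"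
    by (intro poly_ideal_sum[OF fix_ideal] poly_ideal_mult[OF fix_ideal] a lin)
  moreover have "(\<Sum>j\<in>UNIV. a j v * ((v $ j - w $ j) * det (A v))) = det (A v) * f v" for v
    by (subst a(2)[of v]) (simp add: f(2) sum_distrib_left mult_ac)
  ultimately show ?thesis
    using q qw by (intro bexI[of _ "\<lambda>v. det (A v)"]) simp_all
qed

text \<open>The multipliers of \<open>f\<close> into the ideal form an ideal \<open>?Q\<close>. At a
  fixed point, \<open>local_multiplier\<close> yields an element of \<open>?Q\<close> that does not
  vanish; elsewhere one of the equations does. So \<open>?Q\<close> has no zero and contains
  1.\<close>

lemma nondegenerate_imp_radical:
  assumes "nondegenerate \<Theta>"
  shows "radical_fix_ideal \<Theta>"
  unfolding radical_fix_ideal_def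
proof (intro ballI allI impI)
  fix f :: "complex ^ 'n \<Rightarrow> complex" and r assume f: "f \<in> poly_funs" and fr: "(\<lambda>v. f v ^ r) \<in> gen_ideal (fix_eqn \<Theta>)"
  let ?Q = "{q \<in> poly_funs. (\<lambda>v. q v * f v) \<in> gen_ideal (fix_eqn \<Theta>)}"
  have Q: "poly_ideal ?Q"
  proof (rule poly_idealI)
    show "(\<lambda>v. 0) \<in> ?Q"
      using poly_ideal_zero[OF fix_ideal] by (simp add: poly_funs_const)
  next
    fix p q assume "p \<in> ?Q" "q \<in> ?Q"
    then show "(\<lambda>v. p v + q v) \<in> ?Q"
      using poly_ideal_add[OF fix_ideal, of "\<lambda>v. p v * f v" "\<lambda>v. q v * f v"]
      by (simp add: poly_funs_add distrib_right)
  next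
    fix p q :: "complex ^ 'n \<Rightarrow> complex" assume "q \<in> poly_funs" "p \<in> ?Q"
    then show "(\<lambda>v. q v * p v) \<in> ?Q"
      using poly_ideal_mult[OF fix_ideal, of q "\<lambda>v. p v * f v"]
      by (simp add: poly_funs_mult mult.assoc)
  qed auto
  have "\<exists>q\<in>?Q. q w \<noteq> 0" for w
  proof (cases "\<Theta> w = w")
    case True
    have "f w ^ r = 0"
      using bspec[OF iffD2[OF fix_ideal_zero_iff True] fr] .
    then have "f w = 0" by simp
    moreover have "jac \<Theta> w \<noteq> 0"
      using assms True by (simp add: nondegenerate_def)
    ultimately have "\<exists>q\<in>poly_funs. q w \<noteq> 0 \<and> (\<lambda>v. q v * f v) \<in> gen_ideal (fix_eqn \<Theta>)"
      by (intro local_multiplier True f)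
    then show ?thesis by blast
  next
    case False
    then obtain i where "fix_eqn \<Theta> i w \<noteq> 0"
      using fix_eqn_zero_iff[of \<Theta> w] by auto
    moreover have "fix_eqn \<Theta> i \<in> ?Q"
      using poly_ideal_mult_right[OF fix_ideal gen_ideal_generator f] fix_eqn_poly_funs by simp
    ultimately show ?thesis by (rule_tac bexI)
  qed
  then have "(\<lambda>v. 1) \<in> ?Q"
    by (rule weak_nullstellensatz[OF Q])
  then show "f \<in> gen_ideal (fix_eqn \<Theta>)" by simp
qed

end

section \<open>Zariski openness\<close>

definition monomial_fun :: "('n \<Rightarrow> nat) \<Rightarrow> complex ^ 'n \<Rightarrow> complex" where
  "monomial_fun m v = (\<Prod>i\<in>UNIV. (v $ i) ^ m i)"

lemma poly_funs_deg_span: "poly_funs_deg e \<subseteq> fun_space.span (monomial_fun ` {m. (\<Sum>i\<in>UNIV. m i) = e})"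
proof
  fix f :: "complex ^ 'n \<Rightarrow> complex" assume "f \<in> poly_funs_deg e"
  then obtain a where f: "f = (\<lambda>v. \<Sum>m | (\<Sum>i\<in>UNIV. m i) = e. a m * monomial_fun m v)"
    unfolding poly_funs_deg_def monomial_fun_def by auto
  show "f \<in> fun_space.span (monomial_fun ` {m. (\<Sum>i\<in>UNIV. m i) = e})"
    unfolding f by (intro fun_span_sum fun_span_cmult fun_space.span_base) simp
qed

lemma poly_funs_deg_times_monomial:
  assumes f: "f \<in> poly_funs_deg d" and m: "(\<Sum>i\<in>UNIV. m i) = e"
  shows "(\<lambda>v. f v * monomial_fun m v) \<in> poly_funs_deg (d + e)"
proof -
  obtain a where a: "f = (\<lambda>v. \<Sum>m | (\<Sum>i\<in>UNIV. m i) = d. a m * (\<Prod>i\<in>UNIV. (v $ i) ^ m i))"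
    using f unfolding poly_funs_deg_def by auto
  have "(\<lambda>v. \<Sum>m' | (\<Sum>i\<in>UNIV. m' i) = d. a m' * (\<Prod>i\<in>UNIV. (v $ i) ^ (m' i + m i)))
      \<in> poly_funs_deg (d + e)"
    using m by (intro poly_funs_deg_sum monomial_in_poly_funs_deg) (simp add: sum.distrib)
  moreover have "f v * monomial_fun m v
      = (\<Sum>m' | (\<Sum>i\<in>UNIV. m' i) = d. a m' * (\<Prod>i\<in>UNIV. (v $ i) ^ (m' i + m i)))" for v
    by (simp add: a monomial_fun_def sum_distrib_right power_add prod.distrib mult.assoc)
  ultimately show ?thesis by simp
qed

text \<open>Replaces arbitrary cofactors by a finite spanning set of them, so that a spanning
  condition involves only finitely many products.\<close>

lemma fun_span_mult:
  assumes k: "k \<in> fun_space.span B" and B: "\<And>b. b \<in> B \<Longrightarrow> (\<lambda>v. F v * b v) \<in> fun_space.span X"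
  shows "(\<lambda>v. F v * k v) \<in> fun_space.span X"
proof -
  have "k \<in> {k. (\<lambda>v. F v * k v) \<in> fun_space.span X}"
  proof (rule fun_span_least[OF k])
    show "B \<subseteq> {k. (\<lambda>v. F v * k v) \<in> fun_space.span X}"
      using B by auto
    show "(\<lambda>x. 0) \<in> {k. (\<lambda>v. F v * k v) \<in> fun_space.span X}"
      by (simp add: fun_span_zero)
  next
    fix f g assume "f \<in> {k. (\<lambda>v. F v * k v) \<in> fun_space.span X}"
      "g \<in> {k. (\<lambda>v. F v * k v) \<in> fun_space.span X}"
    then show "(\<lambda>x. f x + g x) \<in> {k. (\<lambda>v. F v * k v) \<in> fun_space.span X}"
      using fun_span_add[of "\<lambda>v. F v * f v" X "\<lambda>v. F v * g v"] by (simp add: distrib_left)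
  next
    fix c f assume "f \<in> {k. (\<lambda>v. F v * k v) \<in> fun_space.span X}"
    then show "(\<lambda>x. c * f x) \<in> {k. (\<lambda>v. F v * k v) \<in> fun_space.span X}"
      using fun_span_cmult[of "\<lambda>v. F v * f v" X c] by (simp add: mult.left_commute)
  qed
  then show ?thesis by simp
qed

text \<open>Used to exclude common zeros of generators whose span contains a function known not to
  vanish there.\<close>

lemma fun_span_zero_at:
  assumes "f \<in> fun_space.span X" "\<And>g. g \<in> X \<Longrightarrow> g z = 0"
  shows "f z = 0"
proof -
  have "f \<in> {f. f z = 0}"
    by (rule fun_span_least[OF assms(1)]) (use assms(2) in auto)
  then show ?thesis by simp
qed

lemma polynomials_on_evaluation: "(\<lambda>\<Theta>. \<Theta> v $ i) \<in> polynomials_on H"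
  by (rule polynomials_on.linear) (simp add: linear_functionals_on_def)

lemma pd_lincomb:
  assumes "f \<in> poly_funs" "g \<in> poly_funs"
  shows "pd j (\<lambda>v. a * f v + b * g v) v = a * pd j f v + b * pd j g v"
proof (rule pd_eqI)
  have "((\<lambda>v. a * f v + b * g v) has_derivative
      (\<lambda>u. a * (\<Sum>j\<in>UNIV. u $ j * pd j f v) + b * (\<Sum>j\<in>UNIV. u $ j * pd j g v))) (at v)"
    by (intro has_derivative_add has_derivative_mult_right poly_funs_has_derivative assms)
  then show "((\<lambda>v. a * f v + b * g v) has_derivative
      (\<lambda>u. \<Sum>j\<in>UNIV. u $ j * (a * pd j f v + b * pd j g v))) (at v)"
    by (simp add: distrib_left sum.distrib sum_distrib_left mult.left_commute)
qed

locale homogeneous_family =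
  fixes H :: "(complex ^ 'n \<Rightarrow> complex ^ 'n) set" and d :: nat
  assumes homogeneous: "\<And>\<Theta>. \<Theta> \<in> H \<Longrightarrow> homogeneous_map \<Theta> d"
begin

lemma polynomials_on_pd: "(\<lambda>\<Theta>. pd j (fix_eqn \<Theta> i) v) \<in> polynomials_on H"
proof -
  let ?x = "\<lambda>v :: complex ^ 'n. v $ i"
  \<comment> \<open>The derivative of the equation is affine in \<Theta>, because of the subtracted
    coordinate; adding back the derivative of the coordinate makes it linear. Linearity is required
    only for arguments in \<open>H\<close>, whose components are polynomials and hence
    differentiable.\<close>
  let ?l = "\<lambda>\<Theta>. pd j (fix_eqn \<Theta> i) v + pd j ?x v"
  have l: "?l \<Theta> = pd j (\<lambda>v. \<Theta> v $ i) v" if "(\<lambda>v. \<Theta> v $ i) \<in> poly_funs" for \<Theta>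
  proof -
    have "fix_eqn \<Theta> i = (\<lambda>v. 1 * \<Theta> v $ i + - 1 * v $ i)"
      by (simp add: fix_eqn_def[abs_def])
    then have "pd j (fix_eqn \<Theta> i) v = 1 * pd j (\<lambda>v. \<Theta> v $ i) v + - 1 * pd j ?x v"
      by (simp only: pd_lincomb[OF that poly_funs_coord])
    then show ?thesis by simp
  qed
  have "?l \<in> linear_functionals_on H"
    unfolding linear_functionals_on_def
  proof (intro CollectI ballI allI)
    fix \<Theta> \<Theta>' a b assume "\<Theta> \<in> H" "\<Theta>' \<in> H"
    then have c: "(\<lambda>v. \<Theta> v $ i) \<in> poly_funs" "(\<lambda>v. \<Theta>' v $ i) \<in> poly_funs"
      using homogeneous_map.component_poly_funs homogeneous by blast+
    have "?l (\<lambda>v. a *s \<Theta> v + b *s \<Theta>' v) = pd j (\<lambda>v. a * \<Theta> v $ i + b * \<Theta>' v $ i) v"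
      by (subst l) (auto intro!: poly_funs_add poly_funs_mult poly_funs_const c)
    also have "\<dots> = a * ?l \<Theta> + b * ?l \<Theta>'"
      by (simp only: pd_lincomb[OF c] l[OF c(1)] l[OF c(2)])
    finally show "?l (\<lambda>v. a *s \<Theta> v + b *s \<Theta>' v) = a * ?l \<Theta> + b * ?l \<Theta>'" .
  qed
  from polynomials_on_diff[OF polynomials_on.linear[OF this] polynomials_on.const[of "pd j ?x v"]]
  show ?thesis by simp
qed

lemma polynomials_on_jac: "(\<lambda>\<Theta>. jac \<Theta> v) \<in> polynomials_on H"
proof -
  have "(\<lambda>\<Theta>. \<Sum>p | p permutes UNIV. of_int (sign p) * (\<Prod>i\<in>UNIV. pd (p i) (fix_eqn \<Theta> i) v))
      \<in> polynomials_on H"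
    by (intro polynomials_on_sum polynomials_on.mult polynomials_on.const polynomials_on_prod
        polynomials_on_pd)
  then show ?thesis by (simp add: jac_def det_def)
qed

text \<open>For an h.s.o.p. the products of the components with monomials of degree
  \<open>N - d\<close> span all forms of degree \<open>N\<close>. Wherever this persists, each pure
  power x_j^N is a combination of the components and forces x_j = 0 at their common zeros.\<close>

lemma hsop_open:
  assumes \<Theta>1: "\<Theta>\<^sub>1 \<in> H" "hsop \<Theta>\<^sub>1"
  shows "\<exists>p\<in>polynomials_on H. p \<Theta>\<^sub>1 \<noteq> 0 \<and> (\<forall>\<Theta>\<in>H. p \<Theta> \<noteq> 0 \<longrightarrow> hsop \<Theta>)"
proof -
  interpret \<Theta>1: homogeneous_map \<Theta>\<^sub>1 d by (rule homogeneous[OF \<Theta>1(1)])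
  obtain N where N: "N \<ge> d" "\<forall>e\<ge>N. \<forall>f\<in>poly_funs_deg e.
       \<exists>g. (\<forall>i. g i \<in> poly_funs_deg (e - d)) \<and> f = (\<lambda>v. \<Sum>i\<in>UNIV. g i v * \<Theta>\<^sub>1 v $ i)"
    using \<Theta>1.forms_generated[OF \<Theta>1(2)] by (elim exE conjE)
  let ?M = "\<lambda>e. {m :: 'n \<Rightarrow> nat. (\<Sum>i\<in>UNIV. m i) = e}"
  let ?B = "monomial_fun ` ?M N"
  let ?I = "(UNIV :: 'n set) \<times> ?M (N - d)"
  define f where "f = (\<lambda>(\<Theta> :: complex ^ 'n \<Rightarrow> complex ^ 'n) (i, m) v. \<Theta> v $ i * monomial_fun m v)"
  have "\<exists>p\<in>polynomials_on H. p \<Theta>\<^sub>1 \<noteq> 0 \<and>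
      (\<forall>\<Theta>\<in>H. p \<Theta> \<noteq> 0 \<longrightarrow> ?B \<subseteq> fun_space.span (f \<Theta> ` ?I))"
  proof (rule spanning_open[OF _ _ _ _ \<Theta>1(1)])
    show "finite ?I" "finite ?B"
      by (simp_all add: finite_multidegrees)
  next
    fix \<Theta> b assume "\<Theta> \<in> H" and b: "b \<in> ?I"
    then interpret homogeneous_map \<Theta> d by (intro homogeneous)
    obtain i m where im: "b = (i, m)" "(\<Sum>i\<in>UNIV. m i) = N - d"
      using b by auto
    have "(\<lambda>v. \<Theta> v $ i * monomial_fun m v) \<in> poly_funs_deg N"
      using poly_funs_deg_times_monomial[OF deg im(2), of i] N(1) by simp
    then have "(\<lambda>v. \<Theta> v $ i * monomial_fun m v) \<in> fun_space.span ?B"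
      using poly_funs_deg_span[of N] by (rule subsetD[rotated])
    then show "f \<Theta> b \<in> fun_space.span ?B"
      by (simp add: f_def im(1))
  next
    fix b x
    show "(\<lambda>\<Theta>. f \<Theta> b x) \<in> polynomials_on H"
      by (cases b)
        (simp add: f_def polynomials_on.mult[OF polynomials_on_evaluation polynomials_on.const])
  next
    show "?B \<subseteq> fun_space.span (f \<Theta>\<^sub>1 ` ?I)"
    proof
      fix h assume "h \<in> ?B"
      then obtain m where m: "h = monomial_fun m" "(\<Sum>i\<in>UNIV. m i) = N" by auto
      then have "h \<in> poly_funs_deg N"
        using monomial_in_poly_funs_deg[of m N 1] by (simp add: monomial_fun_def[abs_def])
      then have "\<exists>g. (\<forall>i. g i \<in> poly_funs_deg (N - d)) \<and> h = (\<lambda>v. \<Sum>i\<in>UNIV. g i v * \<Theta>\<^sub>1 v $ i)"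
        using N(2) by simp
      then obtain g where g: "\<forall>i. g i \<in> poly_funs_deg (N - d)"
        "h = (\<lambda>v. \<Sum>i\<in>UNIV. g i v * \<Theta>\<^sub>1 v $ i)"
        by (elim exE conjE)
      have "(\<lambda>v. \<Theta>\<^sub>1 v $ i * g i v) \<in> fun_space.span (f \<Theta>\<^sub>1 ` ?I)" for i
      proof (rule fun_span_mult)
        show "g i \<in> fun_space.span (monomial_fun ` ?M (N - d))"
          using g(1) poly_funs_deg_span by blast
        fix b assume "b \<in> monomial_fun ` ?M (N - d)"
        then obtain m where "b = monomial_fun m" "m \<in> ?M (N - d)" by (rule imageE)
        then show "(\<lambda>v. \<Theta>\<^sub>1 v $ i * b v) \<in> fun_space.span (f \<Theta>\<^sub>1 ` ?I)"
          by (intro fun_space.span_base image_eqI[of _ _ "(i, m)"]) (simp_all add: f_def)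
      qed
      then show "h \<in> fun_space.span (f \<Theta>\<^sub>1 ` ?I)"
        unfolding g(2) by (intro fun_span_sum) (simp add: mult.commute)
    qed
  qed
  then obtain p where p: "p \<in> polynomials_on H" "p \<Theta>\<^sub>1 \<noteq> 0"
    "\<forall>\<Theta>\<in>H. p \<Theta> \<noteq> 0 \<longrightarrow> ?B \<subseteq> fun_space.span (f \<Theta> ` ?I)"
    by (elim bexE conjE)
  have "hsop \<Theta>" if "\<Theta> \<in> H" "p \<Theta> \<noteq> 0" for \<Theta>
  proof -
    interpret homogeneous_map \<Theta> d by (rule homogeneous[OF that(1)])
    have "z = 0" if z: "\<Theta> z = 0" for z
    proof -
      have "z $ j = 0" for j
      proof -
        let ?m = "\<lambda>i. if i = j then N else 0"
        have "monomial_fun ?m \<in> ?B" by simp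
        then have "monomial_fun ?m \<in> fun_space.span (f \<Theta> ` ?I)"
          using p(3) \<open>\<Theta> \<in> H\<close> \<open>p \<Theta> \<noteq> 0\<close> by blast
        then have "monomial_fun ?m z = 0"
          by (rule fun_span_zero_at) (auto simp: f_def z)
        moreover have "monomial_fun ?m z = (z $ j) ^ N"
          by (simp add: monomial_fun_def prod.remove[of UNIV j])
        ultimately show ?thesis by simp
      qed
      then show ?thesis by (simp add: vec_eq_iff)
    qed
    then show ?thesis by (simp add: hsop_iff)
  qed
  with p(1,2) show ?thesis by blast
qed

text \<open>Since F_i and E have no common zero at \<open>\<Theta>\<^sub>1\<close>, 1 is a
  combination of them. To span all of \<open>poly_le M\<close>, an element is first reduced to
  degree \<open>N\<close> modulo the F_i and the remainder is then multiplied by this representation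
  of 1.\<close>

lemma nondegenerate_open:
  assumes \<Theta>1: "\<Theta>\<^sub>1 \<in> H" "hsop \<Theta>\<^sub>1" "nondegenerate \<Theta>\<^sub>1"
  shows "\<exists>p\<in>polynomials_on H. p \<Theta>\<^sub>1 \<noteq> 0 \<and> (\<forall>\<Theta>\<in>H. p \<Theta> \<noteq> 0 \<longrightarrow> nondegenerate \<Theta>)"
proof -
  interpret \<Theta>1: homogeneous_map \<Theta>\<^sub>1 d by (rule homogeneous[OF \<Theta>1(1)])
  obtain N where N: "N \<ge> d" "\<forall>D. \<forall>f\<in>poly_le D.
    \<exists>f'\<in>poly_le N. \<exists>g. (\<forall>i. g i \<in> poly_le (D - d)) \<and>
      (\<forall>v. f v = f' v + (\<Sum>i\<in>UNIV. g i v * fix_eqn \<Theta>\<^sub>1 i v))"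
    using \<Theta>1.reduction[OF \<Theta>1(2)] by (elim exE conjE)
  define e where "e = CARD('n) * d"
  have jac_le: "jac \<Theta> \<in> poly_le e" if "\<Theta> \<in> H" for \<Theta>
    unfolding e_def by (rule homogeneous_map.jac_poly_le[OF homogeneous[OF that]])
  have jac_poly: "jac \<Theta>\<^sub>1 \<in> poly_funs"
    by (rule poly_le_poly_funs[OF jac_le[OF \<Theta>1(1)]])
  define K where
    "K = {\<lambda>v. m v + a v * jac \<Theta>\<^sub>1 v | m a. m \<in> gen_ideal (fix_eqn \<Theta>\<^sub>1) \<and> a \<in> poly_funs}"
  note K = poly_ideal_adjoin[OF \<Theta>1.fix_ideal jac_poly, folded K_def]
  have "(\<lambda>v. 1) \<in> K"
  proof (rule weak_nullstellensatz[OF K(1)])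
    fix z
    show "\<exists>g\<in>K. g z \<noteq> 0"
    proof (cases "\<Theta>\<^sub>1 z = z")
      case True
      with \<Theta>1(3) have "jac \<Theta>\<^sub>1 z \<noteq> 0" by (simp add: nondegenerate_def)
      then show ?thesis using K(3) by (rule bexI)
    next
      case False
      then have "\<not> (\<forall>f\<in>gen_ideal (fix_eqn \<Theta>\<^sub>1). f z = 0)"
        by (simp only: \<Theta>1.fix_ideal_zero_iff not_False_eq_True)
      then obtain f where "f \<in> gen_ideal (fix_eqn \<Theta>\<^sub>1)" "f z \<noteq> 0" by auto
      with K(2) show ?thesis by (intro bexI[of _ f]) auto
    qed
  qed
  then obtain m a where ma: "(\<lambda>v. 1) = (\<lambda>v. m v + a v * jac \<Theta>\<^sub>1 v)"
    "m \<in> gen_ideal (fix_eqn \<Theta>\<^sub>1)" "a \<in> poly_funs"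
    unfolding K_def mem_Collect_eq by (elim exE conjE)
  obtain h where h: "\<forall>i. h i \<in> poly_funs" "m = (\<lambda>v. \<Sum>i\<in>UNIV. h i v * fix_eqn \<Theta>\<^sub>1 i v)"
    using gen_idealD[OF ma(2)] by (elim exE conjE)
  have "\<forall>i. \<exists>D. h i \<in> poly_le D"
    using h(1) unfolding poly_funs_eq by simp
  from choice[OF this] obtain Dh where Dh: "\<forall>i. h i \<in> poly_le (Dh i)" ..
  obtain Da where Da: "a \<in> poly_le Da"
    using ma(3) unfolding poly_funs_eq by (rule UN_E)
  define D where "D = (\<Sum>i\<in>UNIV. Dh i) + Da"
  have hD: "h i \<in> poly_le D" for i
    by (rule poly_le_mono[OF Dh[THEN spec]]) (simp add: D_def member_le_sum trans_le_add1)
  have aD: "a \<in> poly_le D"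
    by (rule poly_le_mono[OF Da]) (simp add: D_def)
  have one: "(\<Sum>i\<in>UNIV. h i v * fix_eqn \<Theta>\<^sub>1 i v) + a v * jac \<Theta>\<^sub>1 v = 1" for v
    using fun_cong[OF ma(1), of v] by (simp add: h(2))
  \<comment> \<open>Cofactors of degree \<open>D\<close> times remainders of degree \<open>N\<close>
    have to fit both into degree \<open>M - d\<close>, next to an equation, and into degree
    \<open>M - e\<close>, next to the Jacobian.\<close>
  define M where "M = N + D + d + e"
  then have dM: "d + (M - d) = M" and eM: "e + (M - e) = M" by simp_all
  obtain B :: "(complex ^ 'n \<Rightarrow> complex) set" where
    B: "finite B" "B \<subseteq> poly_le M" "poly_le M \<subseteq> fun_space.span B"
    using poly_le_finite_span[of M] by (elim exE conjE)
  obtain B1 :: "(complex ^ 'n \<Rightarrow> complex) set" where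
    B1: "finite B1" "B1 \<subseteq> poly_le (M - d)" "poly_le (M - d) \<subseteq> fun_space.span B1"
    using poly_le_finite_span[of "M - d"] by (elim exE conjE)
  obtain B2 :: "(complex ^ 'n \<Rightarrow> complex) set" where
    B2: "finite B2" "B2 \<subseteq> poly_le (M - e)" "poly_le (M - e) \<subseteq> fun_space.span B2"
    using poly_le_finite_span[of "M - e"] by (elim exE conjE)
  let ?I = "((UNIV :: 'n set) \<times> B1) <+> B2"
  \<comment> \<open>The left summand of the index set lists multiples of the equations, the right
    one multiples of the Jacobian.\<close>
  define f where "f = (\<lambda>\<Theta> :: complex ^ 'n \<Rightarrow> complex ^ 'n. case_sum (\<lambda>(i, b) v. fix_eqn \<Theta> i v * b v) (\<lambda>b v. jac \<Theta> v * b v))"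
  have "\<exists>p\<in>polynomials_on H. p \<Theta>\<^sub>1 \<noteq> 0 \<and>
      (\<forall>\<Theta>\<in>H. p \<Theta> \<noteq> 0 \<longrightarrow> B \<subseteq> fun_space.span (f \<Theta> ` ?I))"
  proof (rule spanning_open[OF _ B(1) _ _ \<Theta>1(1)])
    show "finite ?I"
      using B1(1) B2(1) by simp
  next
    fix \<Theta> b assume H: "\<Theta> \<in> H" and b: "b \<in> ?I"
    interpret homogeneous_map \<Theta> d by (rule homogeneous[OF H])
    have "f \<Theta> b \<in> poly_le M"
      using b
    proof (rule PlusE)
      fix x assume "x \<in> UNIV \<times> B1" "b = Inl x"
      then obtain i b1 where b1: "b = Inl (i, b1)" "b1 \<in> B1" by auto
      then have "b1 \<in> poly_le (M - d)" using B1(2) by auto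
      from poly_le_mult[OF fix_eqn_poly_le[of i] this] show ?thesis
        by (simp add: f_def b1(1) dM)
    next
      fix b2 assume b2: "b2 \<in> B2" "b = Inr b2"
      then have "b2 \<in> poly_le (M - e)" using B2(2) by auto
      from poly_le_mult[OF jac_le[OF H] this] show ?thesis
        by (simp add: f_def b2(2) eM)
    qed
    then show "f \<Theta> b \<in> fun_space.span B"
      using B(3) by (rule subsetD[rotated])
  next
    fix b x
    show "(\<lambda>\<Theta>. f \<Theta> b x) \<in> polynomials_on H"
    proof (cases b)
      case (Inl y)
      obtain i b1 where y: "y = (i, b1)" by (cases y)
      have "(\<lambda>\<Theta>. (\<Theta> x $ i - x $ i) * b1 x) \<in> polynomials_on H"
        by (intro polynomials_on.mult polynomials_on_diff polynomials_on_evaluation polynomials_on.const)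
      then show ?thesis by (simp add: f_def Inl y fix_eqn_def)
    next
      case (Inr b2)
      then show ?thesis
        by (simp add: f_def polynomials_on.mult[OF polynomials_on_jac polynomials_on.const])
    qed
  next
    show "B \<subseteq> fun_space.span (f \<Theta>\<^sub>1 ` ?I)"
    proof
      fix k assume "k \<in> B"
      then have "k \<in> poly_le M" using B(2) by auto
      from N(2)[THEN spec, THEN bspec, OF this] obtain k' g where k': "k' \<in> poly_le N"
        "\<forall>i. g i \<in> poly_le (M - d)" "\<forall>v. k v = k' v + (\<Sum>i\<in>UNIV. g i v * fix_eqn \<Theta>\<^sub>1 i v)"
        by (elim bexE exE conjE)
      \<comment> \<open>The reduction of \<open>k\<close>, with the remainder \<open>k'\<close>
        written as \<open>k' * 1\<close> and 1 expanded by \<open>one\<close>.\<close>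
      have eq: "k v = (\<Sum>i\<in>UNIV. fix_eqn \<Theta>\<^sub>1 i v * (g i v + h i v * k' v)) + jac \<Theta>\<^sub>1 v * (a v * k' v)"
        for v
      proof -
        have "k v = k' v * 1 + (\<Sum>i\<in>UNIV. g i v * fix_eqn \<Theta>\<^sub>1 i v)"
          using k'(3) by simp
        also have "\<dots> = (\<Sum>i\<in>UNIV. fix_eqn \<Theta>\<^sub>1 i v * (g i v + h i v * k' v)) + jac \<Theta>\<^sub>1 v * (a v * k' v)"
          unfolding one[of v, symmetric]
          by (simp add: distrib_left sum.distrib sum_distrib_left mult_ac)
        finally show ?thesis .
      qed
      have "(\<lambda>v. fix_eqn \<Theta>\<^sub>1 i v * (g i v + h i v * k' v)) \<in> fun_space.span (f \<Theta>\<^sub>1 ` ?I)" for i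
      proof (rule fun_span_mult)
        have "(\<lambda>v. h i v * k' v) \<in> poly_le (M - d)"
          by (rule poly_le_mono[OF poly_le_mult[OF hD k'(1)]]) (simp add: M_def)
        then have "(\<lambda>v. g i v + h i v * k' v) \<in> poly_le (M - d)"
          using k'(2) by (intro poly_le_add) simp_all
        then show "(\<lambda>v. g i v + h i v * k' v) \<in> fun_space.span B1"
          using B1(3) by (rule subsetD[rotated])
        fix b assume "b \<in> B1"
        then show "(\<lambda>v. fix_eqn \<Theta>\<^sub>1 i v * b v) \<in> fun_space.span (f \<Theta>\<^sub>1 ` ?I)"
          by (intro fun_space.span_base image_eqI[of _ _ "Inl (i, b)"]) (simp_all add: f_def InlI)
      qed
      moreover have "(\<lambda>v. jac \<Theta>\<^sub>1 v * (a v * k' v)) \<in> fun_space.span (f \<Theta>\<^sub>1 ` ?I)"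
      proof (rule fun_span_mult)
        have "(\<lambda>v. a v * k' v) \<in> poly_le (M - e)"
          by (rule poly_le_mono[OF poly_le_mult[OF aD k'(1)]]) (simp add: M_def)
        then show "(\<lambda>v. a v * k' v) \<in> fun_space.span B2"
          using B2(3) by (rule subsetD[rotated])
        fix b assume "b \<in> B2"
        then show "(\<lambda>v. jac \<Theta>\<^sub>1 v * b v) \<in> fun_space.span (f \<Theta>\<^sub>1 ` ?I)"
          by (intro fun_space.span_base image_eqI[of _ _ "Inr b"]) (simp_all add: f_def InrI)
      qed
      ultimately have "(\<lambda>v. (\<Sum>i\<in>UNIV. fix_eqn \<Theta>\<^sub>1 i v * (g i v + h i v * k' v))
          + jac \<Theta>\<^sub>1 v * (a v * k' v)) \<in> fun_space.span (f \<Theta>\<^sub>1 ` ?I)"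
        by (intro fun_span_add fun_span_sum)
      then show "k \<in> fun_space.span (f \<Theta>\<^sub>1 ` ?I)"
        unfolding eq[symmetric] .
    qed
  qed
  then obtain p where p: "p \<in> polynomials_on H" "p \<Theta>\<^sub>1 \<noteq> 0"
    "\<forall>\<Theta>\<in>H. p \<Theta> \<noteq> 0 \<longrightarrow> B \<subseteq> fun_space.span (f \<Theta> ` ?I)"
    by (elim bexE conjE)
  have "nondegenerate \<Theta>" if "\<Theta> \<in> H" "p \<Theta> \<noteq> 0" for \<Theta>
    unfolding nondegenerate_def
  proof (intro allI impI notI)
    fix z assume z: "\<Theta> z = z" "jac \<Theta> z = 0"
    have "fun_space.span B \<subseteq> fun_space.span (f \<Theta> ` ?I)"
      using p(3) that by (intro fun_space.span_minimal fun_space.subspace_span) simp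
    moreover have "(\<lambda>v. 1) \<in> fun_space.span B"
      using B(3) poly_le_const[of 1 M] by (rule subsetD)
    ultimately have one_in: "(\<lambda>v. 1) \<in> fun_space.span (f \<Theta> ` ?I)"
      by (rule subsetD)
    have "(1 :: complex) = 0"
      by (rule fun_span_zero_at[OF one_in, of z]) (auto simp: f_def z fix_eqn_def)
    then show False by simp
  qed
  with p(1,2) show ?thesis by (intro bexI[of _ p] conjI ballI impI)
qed

lemma nondegenerate_hsop_open:
  assumes "\<Theta>\<^sub>1 \<in> H" "hsop \<Theta>\<^sub>1" "nondegenerate \<Theta>\<^sub>1"
  shows "\<exists>p\<in>polynomials_on H. p \<Theta>\<^sub>1 \<noteq> 0 \<and>
    (\<forall>\<Theta>\<in>H. p \<Theta> \<noteq> 0 \<longrightarrow> hsop \<Theta> \<and> nondegenerate \<Theta>)"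
proof -
  obtain p where p: "p \<in> polynomials_on H" "p \<Theta>\<^sub>1 \<noteq> 0" "\<forall>\<Theta>\<in>H. p \<Theta> \<noteq> 0 \<longrightarrow> hsop \<Theta>"
    using hsop_open[OF assms(1,2)] by (elim bexE conjE)
  obtain q where q: "q \<in> polynomials_on H" "q \<Theta>\<^sub>1 \<noteq> 0" "\<forall>\<Theta>\<in>H. q \<Theta> \<noteq> 0 \<longrightarrow> nondegenerate \<Theta>"
    using nondegenerate_open[OF assms] by (elim bexE conjE)
  show ?thesis
    by (rule bexI[OF _ polynomials_on.mult[OF p(1) q(1)]]) (use p q in simp)
qed

end

section \<open>The coordinate ring of the parking locus\<close>

lemma poly_ring_simps [simp]:
  "carrier poly_ring = poly_funs" "f \<otimes>\<^bsub>poly_ring\<^esub> g = (\<lambda>v. f v * g v)"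
  "\<one>\<^bsub>poly_ring\<^esub> = (\<lambda>v. 1)" "\<zero>\<^bsub>poly_ring\<^esub> = (\<lambda>v. 0)"
  "f \<oplus>\<^bsub>poly_ring\<^esub> g = (\<lambda>v. f v + g v)"
  by (simp_all add: poly_ring_def)

lemma cring_poly_ring: "cring poly_ring"
proof (rule cringI)
  show "abelian_group poly_ring"
  proof (rule abelian_groupI)
    fix f :: "complex ^ 'n \<Rightarrow> complex" assume "f \<in> carrier poly_ring"
    then have "(\<lambda>v. 0 - f v) \<in> poly_funs"
      by (intro poly_funs_diff poly_funs_const) simp
    then show "\<exists>g\<in>carrier poly_ring. g \<oplus>\<^bsub>poly_ring\<^esub> f = \<zero>\<^bsub>poly_ring\<^esub>"
      by (intro bexI[of _ "\<lambda>v. 0 - f v"]) simp_all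
  qed (simp_all add: poly_funs_add poly_funs_const add_ac)
  show "comm_monoid poly_ring"
    by (rule comm_monoidI) (simp_all add: poly_funs_mult poly_funs_const mult_ac)
qed (simp add: distrib_right)

lemma poly_ring_nat_pow: "f [^]\<^bsub>poly_ring\<^esub> (r :: nat) = (\<lambda>v. f v ^ r)"
proof (induction r)
  case 0
  show ?case by (simp add: nat_pow_def)
next
  case (Suc r)
  then show ?case by (simp add: nat_pow_def mult.commute)
qed

lemma ideal_poly_ring:
  assumes J: "poly_ideal J"
  shows "ideal J poly_ring"
proof (rule idealI)
  show "ring poly_ring"
    using cring_poly_ring by (rule cring.axioms)
  interpret cring poly_ring by (rule cring_poly_ring)
  show "subgroup J (add_monoid poly_ring)"
  proof (rule add.subgroupI)
    show "J \<subseteq> carrier poly_ring"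
      using poly_ideal_poly_funs[OF J] by auto
    show "J \<noteq> {}"
      using poly_ideal_zero[OF J] by auto
    show "f \<oplus>\<^bsub>poly_ring\<^esub> g \<in> J" if "f \<in> J" "g \<in> J" for f g
      using poly_ideal_add[OF J that] by simp
    show "\<ominus>\<^bsub>poly_ring\<^esub> f \<in> J" if f: "f \<in> J" for f
    proof -
      have f': "f \<in> poly_funs" by (rule poly_ideal_poly_funs[OF J f])
      have "(\<lambda>v. - 1 * f v) \<in> J" by (rule poly_ideal_cmult[OF J f])
      moreover have "\<ominus>\<^bsub>poly_ring\<^esub> f = (\<lambda>v. - 1 * f v)"
        using poly_ideal_poly_funs[OF J calculation] f' by (intro minus_equality) simp_all
      ultimately show ?thesis by simp
    qed
  qed
  show "g \<otimes>\<^bsub>poly_ring\<^esub> f \<in> J" "f \<otimes>\<^bsub>poly_ring\<^esub> g \<in> J"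
    if "f \<in> J" "g \<in> carrier poly_ring" for f g
    using that poly_ideal_mult[OF J] poly_ideal_mult_right[OF J] by simp_all
qed

lemma reduced_quotient_iff:
  assumes "cring R" and I: "ideal I R"
  shows "reduced_ring (R Quot I) \<longleftrightarrow>
    (\<forall>f\<in>carrier R. \<forall>n :: nat. f [^]\<^bsub>R\<^esub> n \<in> I \<longrightarrow> f \<in> I)"
proof -
  interpret cring R by fact
  interpret I: ideal I R by (rule I)
  interpret h: ring_hom_ring R "R Quot I" "(+>\<^bsub>R\<^esub>) I"
    by (rule I.rcos_ring_hom_ring)
  have carr: "carrier (R Quot I) = (+>\<^bsub>R\<^esub>) I ` carrier R"
    unfolding FactRing_def A_RCOSETS_def' by (simp only: partial_object.simps UNION_singleton_eq_range)
  have quot_zero: "\<zero>\<^bsub>R Quot I\<^esub> = I"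
    unfolding FactRing_def by (simp only: ring.simps)
  have zero: "I +>\<^bsub>R\<^esub> f = \<zero>\<^bsub>R Quot I\<^esub> \<longleftrightarrow> f \<in> I" if "f \<in> carrier R" for f
    unfolding quot_zero by (rule iffI[OF I.rcos_const_imp_mem[OF that] a_rcos_zero[OF I]])
  have power: "(I +>\<^bsub>R\<^esub> f) [^]\<^bsub>R Quot I\<^esub> n = \<zero>\<^bsub>R Quot I\<^esub> \<longleftrightarrow> f [^]\<^bsub>R\<^esub> n \<in> I"
    if "f \<in> carrier R" for f and n :: nat
    unfolding h.hom_nat_pow[OF that, symmetric] by (rule zero[OF nat_pow_closed[OF that]])
  show ?thesis
    unfolding reduced_ring_def carr ball_simps(9) 
  proof (rule ball_cong[OF refl])
    fix f assume f: "f \<in> carrier R"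
    show "(\<forall>n :: nat. (I +>\<^bsub>R\<^esub> f) [^]\<^bsub>R Quot I\<^esub> n = \<zero>\<^bsub>R Quot I\<^esub> \<longrightarrow> I +>\<^bsub>R\<^esub> f = \<zero>\<^bsub>R Quot I\<^esub>)
      \<longleftrightarrow> (\<forall>n :: nat. f [^]\<^bsub>R\<^esub> n \<in> I \<longrightarrow> f \<in> I)"
      unfolding zero[OF f] power[OF f] by (rule refl)
  qed
qed

lemma dual_space_coord: "(\<lambda>v. v $ i) \<in> dual_space"
proof -
  have "Vector_Spaces.linear (*s) (*) (\<lambda>v :: complex ^ 'n. v $ i)" for i
    by unfold_locales (simp_all add: algebra_simps)
  then show ?thesis by (simp add: dual_space_def)
qed

lemma dual_space_lincomb:
  assumes "x \<in> dual_space"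
  shows "x (a *s u + b *s v) = a * x u + b * x v"
proof -
  interpret Vector_Spaces.linear "(*s)" "(*)" x
    using assms by (simp add: dual_space_def)
  show ?thesis by (simp add: add scale)
qed

lemma dual_space_expand:
  assumes x: "x \<in> dual_space"
  shows "x v = (\<Sum>i\<in>UNIV. x (axis i 1) * v $ i)"
proof -
  interpret Vector_Spaces.linear "(*s)" "(*)" x
    using assms by (simp add: dual_space_def)
  have "x v = x (\<Sum>i\<in>UNIV. v $ i *s axis i 1)"
    by (simp add: basis_expansion)
  also have "\<dots> = (\<Sum>i\<in>UNIV. x (axis i 1) * v $ i)"
    by (simp add: sum scale mult.commute)
  finally show ?thesis .
qed

context homogeneous_map
begin

text \<open>A linear form is a combination of the coordinates, so the generators for arbitrary
  linear forms are combinations of the finitely many coordinate equations.\<close>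

lemma parking_ideal_eq: "parking_ideal \<Theta> = gen_ideal (fix_eqn \<Theta>)"
proof
  interpret cring poly_ring by (rule cring_poly_ring)
  let ?S = "{\<lambda>v. x (\<Theta> v) - x v | x. x \<in> dual_space}"
  have S: "?S \<subseteq> gen_ideal (fix_eqn \<Theta>)"
  proof
    fix f assume "f \<in> ?S"
    then obtain x where x: "f = (\<lambda>v. x (\<Theta> v) - x v)" "x \<in> dual_space" by auto
    have "f = (\<lambda>v. \<Sum>i\<in>UNIV. x (axis i 1) * fix_eqn \<Theta> i v)"
    proof
      fix v
      have "f v = (\<Sum>i\<in>UNIV. x (axis i 1) * \<Theta> v $ i) - (\<Sum>i\<in>UNIV. x (axis i 1) * v $ i)"
        unfolding x(1) by (subst (1 2) dual_space_expand[OF x(2)]) (rule refl)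
      then show "f v = (\<Sum>i\<in>UNIV. x (axis i 1) * fix_eqn \<Theta> i v)"
        by (simp add: fix_eqn_def right_diff_distrib sum_subtractf)
    qed
    also have "\<dots> \<in> gen_ideal (fix_eqn \<Theta>)"
      by (rule gen_idealI) (rule poly_funs_const)
    finally show "f \<in> gen_ideal (fix_eqn \<Theta>)" .
  qed
  then show "parking_ideal \<Theta> \<subseteq> gen_ideal (fix_eqn \<Theta>)"
    unfolding parking_ideal_def by (intro genideal_minimal ideal_poly_ring fix_ideal)
  have S': "?S \<subseteq> carrier poly_ring"
    using S poly_ideal_poly_funs[OF fix_ideal] by auto
  interpret I: ideal "parking_ideal \<Theta>" poly_ring
    unfolding parking_ideal_def by (rule genideal_ideal[OF S'])
  have F: "fix_eqn \<Theta> i \<in> parking_ideal \<Theta>" for i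
  proof -
    have "fix_eqn \<Theta> i \<in> ?S"
      using dual_space_coord[of i]
      by (intro CollectI exI[of _ "\<lambda>v. v $ i"]) (simp add: fix_eqn_def[abs_def])
    then show ?thesis
      using genideal_self[OF S'] unfolding parking_ideal_def by blast
  qed
  show "gen_ideal (fix_eqn \<Theta>) \<subseteq> parking_ideal \<Theta>"
  proof
    fix f assume f: "f \<in> gen_ideal (fix_eqn \<Theta>)"
    obtain g where g: "\<forall>i. g i \<in> poly_funs" "f = (\<lambda>v. \<Sum>i\<in>UNIV. g i v * fix_eqn \<Theta> i v)"
      using gen_idealD[OF f] by (elim exE conjE)
    have "(\<lambda>v. \<Sum>i\<in>A. g i v * fix_eqn \<Theta> i v) \<in> parking_ideal \<Theta>" for A
    proof (induction A rule: infinite_finite_induct)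
      case (infinite A)
      then show ?case using I.zero_closed by simp
    next
      case empty
      then show ?case using I.zero_closed by simp
    next
      case (insert i A)
      have "(\<lambda>v. g i v * fix_eqn \<Theta> i v) \<in> parking_ideal \<Theta>"
        using I.I_l_closed[OF F[of i], of "g i"] g(1) by simp
      from I.a_closed[OF this insert.IH] insert.hyps show ?case by simp
    qed
    then show "f \<in> parking_ideal \<Theta>" unfolding g(2) .
  qed
qed

lemma parking_locus_reduced_iff: "parking_locus_reduced \<Theta> \<longleftrightarrow> radical_fix_ideal \<Theta>"
  unfolding parking_locus_reduced_def parking_ideal_eq radical_fix_ideal_def
  by (subst reduced_quotient_iff[OF cring_poly_ring ideal_poly_ring[OF fix_ideal]])
    (simp add: poly_ring_nat_pow)

end

section \<open>Reflection groups act by isometries\<close>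

lemma orthogonal_matrix_reflection: "orthogonal_matrix (reflection a)"
proof -
  let ?f = "\<lambda>x. x - (2 * (x \<bullet> a) / (a \<bullet> a)) *\<^sub>R a"
  have "linear ?f"
    by (rule linearI) (simp_all add: algebra_simps add_divide_distrib)
  \<comment> \<open>For \<open>a = 0\<close> the quotient is 0 by convention and the map is the
    identity.\<close>
  moreover have "?f v \<bullet> ?f w = v \<bullet> w" for v w
    by (cases "a = 0") (simp_all add: inner_diff_left inner_diff_right inner_commute field_simps)
  ultimately have "orthogonal_transformation ?f"
    by (simp add: orthogonal_transformation_def)
  then show ?thesis
    by (simp add: orthogonal_transformation_matrix reflection_def)
qed

lemma matrix_inv_orthogonal:
  fixes A :: "real ^ 'n ^ 'n"
  assumes A: "orthogonal_matrix A"
  shows "matrix_inv A = transpose A"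
proof -
  have "A ** matrix_inv A = mat 1 \<and> matrix_inv A ** A = mat 1"
    unfolding matrix_inv_def
    by (rule someI[of _ "transpose A"]) (use A in \<open>simp add: orthogonal_matrix_def\<close>)
  then have "transpose A ** (A ** matrix_inv A) = transpose A" by simp
  then show ?thesis
    using A by (simp add: matrix_mul_assoc orthogonal_matrix_def)
qed

lemma group_orthogonal_group_mat: "group (orthogonal_group_mat :: (real ^ 'n ^ 'n) monoid)"
proof (rule groupI)
  fix A :: "real ^ 'n ^ 'n" assume "A \<in> carrier orthogonal_group_mat"
  then show "\<exists>B\<in>carrier orthogonal_group_mat. B \<otimes>\<^bsub>orthogonal_group_mat\<^esub> A = \<one>\<^bsub>orthogonal_group_mat\<^esub>"
    by (intro bexI[of _ "transpose A"]) (auto simp: orthogonal_group_mat_def orthogonal_matrix_def)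
qed (auto simp: orthogonal_group_mat_def orthogonal_matrix_mul orthogonal_matrix_id matrix_mul_assoc)

lemma subgroup_reflection_group:
  assumes "real_reflection_group W"
  shows "subgroup W orthogonal_group_mat"
proof -
  interpret group "orthogonal_group_mat :: (real ^ 'a ^ 'a) monoid"
    by (rule group_orthogonal_group_mat)
  obtain S where S: "S \<subseteq> reflection ` (- {0})" "W = generate orthogonal_group_mat S"
    using assms by (auto simp: real_reflection_group_def)
  have "S \<subseteq> carrier orthogonal_group_mat"
    using S(1) orthogonal_matrix_reflection by (auto simp: orthogonal_group_mat_def)
  then show ?thesis
    unfolding S(2) by (rule generate_is_subgroup)
qed

lemma reflection_group_orthogonal:
  assumes "real_reflection_group W" "w \<in> W"
  shows "orthogonal_matrix w"
  using subgroup.subset[OF subgroup_reflection_group[OF assms(1)]] assms(2)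
  by (auto simp: orthogonal_group_mat_def)

lemma coxeter_element_in_group:
  assumes W: "real_reflection_group W" and c: "coxeter_element W c"
  shows "c \<in> W"
proof -
  note sub = subgroup_reflection_group[OF W]
  have mult: "a ** b \<in> W" if "a \<in> W" "b \<in> W" for a b
    using subgroup.m_closed[OF sub that] by (simp add: orthogonal_group_mat_def)
  have one: "mat 1 \<in> W"
    using subgroup.one_closed[OF sub] by (simp add: orthogonal_group_mat_def)
  interpret group "orthogonal_group_mat :: (real ^ 'a ^ 'a) monoid"
    by (rule group_orthogonal_group_mat)
  have inv: "matrix_inv w \<in> W" if w: "w \<in> W" for w
  proof -
    have o: "orthogonal_matrix w" by (rule reflection_group_orthogonal[OF W w])
    have "inv\<^bsub>orthogonal_group_mat\<^esub> w = transpose w"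
      using o by (intro inv_equality) (auto simp: orthogonal_group_mat_def orthogonal_matrix_def)
    with subgroup.m_inv_closed[OF sub w] show ?thesis
      by (simp add: matrix_inv_orthogonal[OF o])
  qed
  obtain \<Delta> bs w where d: "simple_system W \<Delta>" "set bs = \<Delta>" "w \<in> W"
    "c = w ** mat_prod (map reflection bs) ** matrix_inv w"
    using c unfolding coxeter_element_def by auto
  have "set bs \<subseteq> unit_roots W"
    using d(1,2) by (simp add: simple_system_def)
  then have "mat_prod (map reflection bs) \<in> W"
    by (induction bs) (auto simp: mat_prod_def one unit_roots_def intro: mult)
  then show ?thesis
    unfolding d(4) by (intro mult inv d(3))
qed

text \<open>For \<open>k \<ge> 1\<close> this puts the degree kh + 1 at 2 or more, as
  \<open>homogeneous_map\<close> demands.\<close>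

lemma coxeter_number_pos:
  assumes W: "real_reflection_group W" and c: "coxeter_element W c"
  shows "coxeter_number W c \<ge> 1"
proof -
  interpret group "subgroup_of W"
    unfolding subgroup_of_def
    by (rule subgroup.subgroup_is_group[OF subgroup_reflection_group[OF W] group_orthogonal_group_mat])
  show ?thesis
    unfolding coxeter_number_def
  proof (rule ord_ge_1)
    show "finite (carrier (subgroup_of W))"
      using W by (simp add: subgroup_of_def real_reflection_group_def)
    show "c \<in> carrier (subgroup_of W)"
      using coxeter_element_in_group[OF W c] by (simp add: subgroup_of_def)
  qed
qed

lemma norm_vector_scalar_mult: "norm (c *s v) = norm c * norm (v :: complex ^ 'n)"
  by (simp add: norm_vec_def L2_set_right_distrib norm_mult)

lemma cact_lincomb: "cact w (a *s u + b *s v) = a *s cact w u + b *s cact w v"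
  by (simp add: cact_def vec.add vec.scale)

text \<open>A real matrix acts separately on the real and the imaginary part of a complex vector,
  and the squared norm is the sum of the squared norms of the two parts.\<close>

lemma norm_cact:
  assumes "orthogonal_matrix w"
  shows "norm (cact w v) = norm v"
proof -
  have n: "(norm x)\<^sup>2 = (norm (\<chi> i. Re (x $ i)))\<^sup>2 + (norm (\<chi> i. Im (x $ i)))\<^sup>2" for x :: "complex ^ 'a"
    by (simp add: norm_vec_def L2_set_def sum_nonneg cmod_power2 sum.distrib)
  have o: "norm (w *v x) = norm x" for x
  proof -
    have "orthogonal_transformation ((*v) w)"
      using assms by (simp add: orthogonal_transformation_matrix matrix_of_matrix_vector_mul)
    then show ?thesis by (simp add: orthogonal_transformation_norm)
  qed
  have "(\<chi> i. Re (cact w v $ i)) = w *v (\<chi> i. Re (v $ i))"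
    "(\<chi> i. Im (cact w v $ i)) = w *v (\<chi> i. Im (v $ i))"
    by (simp_all add: cact_def map_matrix_def matrix_vector_mult_def vec_eq_iff)
  with n[of "cact w v"] n[of v] have "(norm (cact w v))\<^sup>2 = (norm v)\<^sup>2"
    by (simp add: o)
  then show ?thesis by simp
qed

lemma dist_cact:
  assumes "orthogonal_matrix w"
  shows "dist (cact w u) (cact w v) = dist u v"
proof -
  have "cact w u - cact w v = cact w (u - v)"
    using cact_lincomb[of w 1 u "-1" v] by simp
  then show ?thesis
    by (simp add: dist_norm norm_cact[OF assms])
qed

section \<open>Deforming the fixed points along a line\<close>

lemma has_derivative_vecI:
  fixes f :: "'a::euclidean_space \<Rightarrow> 'b::euclidean_space ^ 'n"
  assumes "\<And>i. ((\<lambda>x. f x $ i) has_derivative (\<lambda>h. f' h $ i)) (at x)"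
  shows "(f has_derivative f') (at x)"
proof -
  have lin: "linear (\<lambda>h. f' h $ i)" for i
    using has_derivative_linear[OF assms[of i]] .
  have "linear f'"
    by (rule linearI) (simp_all add: vec_eq_iff linear_add[OF lin] linear_scale[OF lin])
  moreover have "((\<lambda>y. (f y - f x - f' (y - x)) /\<^sub>R norm (y - x)) \<longlongrightarrow> 0) (at x)"
  proof (rule vec_tendstoI)
    fix i
    show "((\<lambda>y. ((f y - f x - f' (y - x)) /\<^sub>R norm (y - x)) $ i) \<longlongrightarrow> 0 $ i) (at x)"
      using assms[of i] by (simp add: has_derivative_at_within)
  qed
  ultimately show ?thesis
    by (simp add: has_derivative_at_within linear_conv_bounded_linear)
qed

text \<open>By compactness the norm at \<open>t\<^sub>0\<close> has a positive minimum
  \<open>c\<close> and \<open>g\<close> is bounded by \<open>C\<close>, so for \<open>t\<close>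
  within \<open>c / (2 * C)\<close> at most half of \<open>c\<close> is lost. Applied on the unit
  sphere it prevents escape to infinity, and off small balls around the fixed points it prevents new
  ones.\<close>

lemma affine_family_lower_bound:
  fixes f g :: "'a::topological_space \<Rightarrow> complex ^ 'n"
  assumes K: "compact K" and f: "continuous_on K f" and g: "continuous_on K g"
    and nz: "\<And>v. v \<in> K \<Longrightarrow> f v + t\<^sub>0 *s g v \<noteq> 0"
  shows "\<exists>c>0. \<exists>\<delta>>0. \<forall>t. dist t t\<^sub>0 < \<delta> \<longrightarrow> (\<forall>v\<in>K. c \<le> norm (f v + t *s g v))"
proof (cases "K = {}")
  case True
  then show ?thesis by (auto intro: exI[of _ 1])
next
  case False
  have "continuous_on K (\<lambda>v. f v + t\<^sub>0 *s g v)"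
    unfolding vector_scalar_mult_def by (intro continuous_intros f g)
  then have "continuous_on K (\<lambda>v. norm (f v + t\<^sub>0 *s g v))"
    by (intro continuous_on_norm)
  from continuous_attains_inf[OF K False this]
  obtain a where a: "a \<in> K" "\<And>v. v \<in> K \<Longrightarrow> norm (f a + t\<^sub>0 *s g a) \<le> norm (f v + t\<^sub>0 *s g v)"
    by auto
  define c where "c = norm (f a + t\<^sub>0 *s g a)"
  have c: "c > 0" using nz[OF a(1)] by (simp add: c_def)
  have "continuous_on K (\<lambda>v. norm (g v))"
    by (intro continuous_on_norm g)
  from continuous_attains_sup[OF K False this]
  obtain b where b: "b \<in> K" "\<And>v. v \<in> K \<Longrightarrow> norm (g v) \<le> norm (g b)"
    by auto
  \<comment> \<open>The added 1 makes \<open>C\<close> positive even if \<open>g\<close> vanishes on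
    \<open>K\<close>.\<close>
  define C where "C = norm (g b) + 1"
  have C: "C > 0" by (simp add: C_def add_nonneg_pos)
  show ?thesis
  proof (rule exI[of _ "c / 2"], intro conjI exI[of _ "c / (2 * C)"] allI impI ballI)
    fix t v assume t: "dist t t\<^sub>0 < c / (2 * C)" and v: "v \<in> K"
    have "norm ((t - t\<^sub>0) *s g v) \<le> dist t t\<^sub>0 * C"
      unfolding norm_vector_scalar_mult dist_norm
      using b(2)[OF v] by (intro mult_left_mono) (simp_all add: C_def)
    also have "\<dots> \<le> c / (2 * C) * C"
      using t C by (intro mult_right_mono) simp_all
    also have "\<dots> = c / 2" using C by simp
    finally have "norm ((t - t\<^sub>0) *s g v) \<le> c / 2" .
    moreover have "c \<le> norm (f v + t\<^sub>0 *s g v)"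
      unfolding c_def by (rule a(2)[OF v])
    moreover have "f v + t *s g v = (f v + t\<^sub>0 *s g v) + (t - t\<^sub>0) *s g v"
      by (simp add: vec_eq_iff algebra_simps)
    moreover have "norm (f v + t\<^sub>0 *s g v) - norm ((t - t\<^sub>0) *s g v)
        \<le> norm ((f v + t\<^sub>0 *s g v) + (t - t\<^sub>0) *s g v)"
      by (rule norm_diff_ineq)
    ultimately show "c / 2 \<le> norm (f v + t *s g v)"
      by simp
  qed (use c C in simp_all)
qed

lemma common_radius:
  assumes "finite S" "\<And>z. z \<in> S \<Longrightarrow> \<exists>r>0. P z r"
    and mono: "\<And>z r s. P z r \<Longrightarrow> 0 < s \<Longrightarrow> s \<le> r \<Longrightarrow> P z s"
  shows "\<exists>r>0 :: real. \<forall>z\<in>S. P z r"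
  using assms(1,2)
proof (induction S rule: finite_induct)
  case empty
  show ?case by (intro exI[of _ 1]) simp
next
  case (insert a S)
  obtain r where r: "r > 0" "P a r" using insert.prems[of a] by auto
  have "\<exists>s>0. \<forall>z\<in>S. P z s" by (rule insert.IH) (use insert.prems in simp)
  then obtain s where s: "s > 0" "\<forall>z\<in>S. P z s" by auto
  have "P a (min r s)" using mono[OF r(2)] r(1) s(1) by simp
  moreover have "P z (min r s)" if "z \<in> S" for z
    using mono[of z s "min r s"] s that r(1) by simp
  ultimately show ?case using r(1) s(1) by (intro exI[of _ "min r s"]) simp
qed

lemma continuous_on_poly_map:
  assumes "\<And>i. (\<lambda>v. \<Theta> v $ i) \<in> poly_funs"
  shows "continuous_on S (\<Theta> :: complex ^ 'n \<Rightarrow> complex ^ 'n)"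
proof -
  have "continuous_on S (\<lambda>v. \<chi> i. \<Theta> v $ i)"
    by (intro continuous_on_vec_lambda poly_funs_continuous_on assms)
  then show ?thesis by simp
qed

section \<open>Fixed points along a pencil of maps\<close>

definition pencil ::
    "(complex ^ 'n \<Rightarrow> complex ^ 'n) \<Rightarrow> (complex ^ 'n \<Rightarrow> complex ^ 'n) \<Rightarrow> complex \<Rightarrow>
     complex ^ 'n \<Rightarrow> complex ^ 'n" where
  "pencil \<Theta>\<^sub>0 \<Theta>\<^sub>1 t v = (1 - t) *s \<Theta>\<^sub>0 v + t *s \<Theta>\<^sub>1 v"

locale homogeneous_pencil = A: homogeneous_map \<Theta>\<^sub>0 d + B: homogeneous_map \<Theta>\<^sub>1 d
  for \<Theta>\<^sub>0 \<Theta>\<^sub>1 :: "complex ^ 'n \<Rightarrow> complex ^ 'n" and d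
begin

abbreviation "P \<equiv> pencil \<Theta>\<^sub>0 \<Theta>\<^sub>1"

sublocale P: homogeneous_map "P t" d for t
proof
  show "(\<lambda>v. P t v $ i) \<in> poly_funs_deg d" for i
    using poly_funs_deg_add[OF poly_funs_deg_cmult[OF A.deg[of i], of "1 - t"]
        poly_funs_deg_cmult[OF B.deg[of i], of t]]
    by (simp only: pencil_def vector_add_component vector_smult_component)
qed (rule A.d_ge_2)

lemma fix_eqn_pencil:
  "fix_eqn (P t) i v = (1 - t) * fix_eqn \<Theta>\<^sub>0 i v + t * fix_eqn \<Theta>\<^sub>1 i v"
  by (simp add: fix_eqn_def pencil_def algebra_simps)

lemma pd_fix_eqn_pencil:
  "pd j (fix_eqn (P t) i) v = (1 - t) * pd j (fix_eqn \<Theta>\<^sub>0 i) v + t * pd j (fix_eqn \<Theta>\<^sub>1 i) v"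
  using pd_lincomb[OF A.fix_eqn_poly_funs B.fix_eqn_poly_funs, of j "1 - t" i t i]
  by (simp add: fix_eqn_pencil[abs_def])

text \<open>Carrying the parameter along as first component turns the implicit function problem for
  the fixed points into an inverse function problem between spaces of equal dimension.\<close>

definition graph_map :: "complex \<times> (complex ^ 'n) \<Rightarrow> complex \<times> (complex ^ 'n)" where
  "graph_map x = (fst x, \<chi> i. fix_eqn (P (fst x)) i (snd x))"

text \<open>The equations are affine in the parameter, so their derivative in that direction is the
  difference of the two sets of equations.\<close>

definition graph_map_deriv ::
    "complex \<times> (complex ^ 'n) \<Rightarrow> complex \<times> (complex ^ 'n) \<Rightarrow> complex \<times> (complex ^ 'n)" where
  "graph_map_deriv x y = (fst y, \<chi> i. fst y * (fix_eqn \<Theta>\<^sub>1 i (snd x) - fix_eqn \<Theta>\<^sub>0 i (snd x))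
     + (\<Sum>j\<in>UNIV. snd y $ j * pd j (fix_eqn (P (fst x)) i) (snd x)))"

lemma graph_map_eq_iff: "graph_map (t, v) = (t, 0) \<longleftrightarrow> P t v = v"
  by (simp add: graph_map_def fix_eqn_zero_iff[symmetric] vec_eq_iff)

lemma has_derivative_graph_map: "(graph_map has_derivative graph_map_deriv x) (at x)"
proof -
  have F: "((\<lambda>x. f (snd x)) has_derivative (\<lambda>y. \<Sum>j\<in>UNIV. snd y $ j * pd j f (snd x))) (at x)"
    if "f \<in> poly_funs" for f :: "complex ^ 'n \<Rightarrow> complex"
    by (rule has_derivative_compose[OF has_derivative_snd[OF has_derivative_ident]
          poly_funs_has_derivative[OF that]])
  have "((\<lambda>x. \<chi> i. fix_eqn (P (fst x)) i (snd x)) has_derivative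
      (\<lambda>y. \<chi> i. fst y * (fix_eqn \<Theta>\<^sub>1 i (snd x) - fix_eqn \<Theta>\<^sub>0 i (snd x))
        + (\<Sum>j\<in>UNIV. snd y $ j * pd j (fix_eqn (P (fst x)) i) (snd x)))) (at x)"
  proof (rule has_derivative_vecI)
    fix i
    have t: "(fst has_derivative fst) (at x)"
      by (rule has_derivative_fst[OF has_derivative_ident])
    have s: "((\<lambda>x. 1 - fst x) has_derivative (\<lambda>y. - fst y)) (at x)"
      using has_derivative_diff[OF has_derivative_const t, of 1] by simp
    have "((\<lambda>x. (1 - fst x) * fix_eqn \<Theta>\<^sub>0 i (snd x) + fst x * fix_eqn \<Theta>\<^sub>1 i (snd x)) has_derivative
      (\<lambda>y. ((1 - fst x) * (\<Sum>j\<in>UNIV. snd y $ j * pd j (fix_eqn \<Theta>\<^sub>0 i) (snd x))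
          + - fst y * fix_eqn \<Theta>\<^sub>0 i (snd x))
        + (fst x * (\<Sum>j\<in>UNIV. snd y $ j * pd j (fix_eqn \<Theta>\<^sub>1 i) (snd x))
          + fst y * fix_eqn \<Theta>\<^sub>1 i (snd x)))) (at x)"
      by (rule has_derivative_add[OF has_derivative_mult[OF s F[OF A.fix_eqn_poly_funs]]
            has_derivative_mult[OF t F[OF B.fix_eqn_poly_funs]]])
    moreover have "((1 - fst x) * (\<Sum>j\<in>UNIV. snd y $ j * pd j (fix_eqn \<Theta>\<^sub>0 i) (snd x))
          + - fst y * fix_eqn \<Theta>\<^sub>0 i (snd x))
        + (fst x * (\<Sum>j\<in>UNIV. snd y $ j * pd j (fix_eqn \<Theta>\<^sub>1 i) (snd x))
          + fst y * fix_eqn \<Theta>\<^sub>1 i (snd x))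
      = fst y * (fix_eqn \<Theta>\<^sub>1 i (snd x) - fix_eqn \<Theta>\<^sub>0 i (snd x))
        + (\<Sum>j\<in>UNIV. snd y $ j * pd j (fix_eqn (P (fst x)) i) (snd x))" for y
      unfolding pd_fix_eqn_pencil
      by (simp add: algebra_simps sum.distrib sum_distrib_left sum_subtractf)
    ultimately show "((\<lambda>x. (\<chi> i. fix_eqn (P (fst x)) i (snd x)) $ i) has_derivative
      (\<lambda>y. (\<chi> i. fst y * (fix_eqn \<Theta>\<^sub>1 i (snd x) - fix_eqn \<Theta>\<^sub>0 i (snd x))
        + (\<Sum>j\<in>UNIV. snd y $ j * pd j (fix_eqn (P (fst x)) i) (snd x))) $ i)) (at x)"
      by (simp only: vec_lambda_beta fix_eqn_pencil)
  qed
  from has_derivative_Pair[OF has_derivative_fst[OF has_derivative_ident] this]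
  show ?thesis
    by (simp only: graph_map_def[abs_def] graph_map_deriv_def[abs_def])
qed

lemma bounded_linear_graph_map_deriv: "bounded_linear (graph_map_deriv x)"
  by (rule has_derivative_bounded_linear[OF has_derivative_graph_map])

text \<open>The inverse function theorem asks for continuity in the operator norm; in finite
  dimension it can be checked on each vector.\<close>

lemma continuous_on_graph_map_deriv:
  "continuous_on UNIV (\<lambda>x. Blinfun (graph_map_deriv x))"
proof (rule continuous_on_blinfun_componentwise)
  fix y :: "complex \<times> (complex ^ 'n)"
  have c: "continuous_on UNIV (\<lambda>x :: complex \<times> (complex ^ 'n). f (snd x))" if "f \<in> poly_funs" for f
    by (rule continuous_on_compose2[OF poly_funs_continuous_on[OF that, of UNIV]])
      (auto intro: continuous_intros)
  have "continuous_on UNIV (\<lambda>x. graph_map_deriv x y)"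
    unfolding graph_map_deriv_def pd_fix_eqn_pencil
    by (intro continuous_intros c A.fix_eqn_poly_funs B.fix_eqn_poly_funs poly_funs_pd)
  then show "continuous_on UNIV (\<lambda>x. blinfun_apply (Blinfun (graph_map_deriv x)) y)"
    by (simp add: bounded_linear_Blinfun_apply[OF bounded_linear_graph_map_deriv])
qed

text \<open>The derivative is block triangular: a kernel vector has parameter part zero, and its
  other part is then annihilated by the invertible Jacobian matrix.\<close>

lemma inj_graph_map_deriv:
  assumes "jac (P t) z \<noteq> 0"
  shows "inj (graph_map_deriv (t, z))"
proof -
  have lin: "linear (graph_map_deriv (t, z))"
    by (rule bounded_linear.linear[OF bounded_linear_graph_map_deriv])
  show ?thesis
    unfolding linear_injective_0[OF lin]
  proof (intro allI impI)
    fix y assume y: "graph_map_deriv (t, z) y = 0"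
    obtain s u where su: "y = (s, u)" by (cases y)
    have s: "s = 0" using y by (simp add: graph_map_deriv_def su zero_prod_def)
    have "(\<Sum>j\<in>UNIV. u $ j * pd j (fix_eqn (P t) i) z) = 0" for i
      using y by (simp add: graph_map_deriv_def su zero_prod_def s vec_eq_iff)
    then have "(\<chi> i j. pd j (fix_eqn (P t) i) z) *v u = 0"
      by (simp add: matrix_vector_mult_def vec_eq_iff mult.commute)
    moreover have "invertible (\<chi> i j. pd j (fix_eqn (P t) i) z)"
      using assms by (simp add: invertible_det_nz jac_def)
    ultimately have "u = 0"
      unfolding invertible_left_inverse matrix_left_invertible_ker by simp
    with s show "y = 0" by (simp add: su zero_prod_def)
  qed
qed

text \<open>Fixed points of \<open>P t\<close> are the preimages of \<open>(t, 0)\<close> under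
  \<open>graph_map\<close>. The inverse function theorem makes this map injective near
  \<open>(t\<^sub>0, z)\<close>, and the continuous inverse applied to \<open>(t, 0)\<close> gives
  the fixed point near \<open>z\<close>.\<close>

lemma local_fixed_points:
  assumes z: "P t\<^sub>0 z = z" and nd: "jac (P t\<^sub>0) z \<noteq> 0"
  shows "\<exists>r>0. \<forall>t v v'. dist t t\<^sub>0 < r \<longrightarrow> dist v z < r \<longrightarrow> dist v' z < r \<longrightarrow>
      P t v = v \<longrightarrow> P t v' = v' \<longrightarrow> v = v'"
    and "\<epsilon> > 0 \<Longrightarrow> \<exists>\<delta>>0. \<forall>t. dist t t\<^sub>0 < \<delta> \<longrightarrow> (\<exists>v. P t v = v \<and> dist v z < \<epsilon>)"
proof -
  have lin: "linear (graph_map_deriv (t\<^sub>0, z))"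
    by (rule bounded_linear.linear[OF bounded_linear_graph_map_deriv])
  obtain k where k: "linear k" "k \<circ> graph_map_deriv (t\<^sub>0, z) = id"
    using linear_injective_left_inverse[OF lin inj_graph_map_deriv[OF nd]] by auto
  have bk: "bounded_linear k"
    using k(1) by (simp add: linear_conv_bounded_linear)
  note D = bounded_linear_Blinfun_apply[OF bounded_linear_graph_map_deriv]
  have inv: "Blinfun k o\<^sub>L Blinfun (graph_map_deriv (t\<^sub>0, z)) = id_blinfun"
  proof (rule blinfun_eqI)
    fix y
    show "blinfun_apply (Blinfun k o\<^sub>L Blinfun (graph_map_deriv (t\<^sub>0, z))) y = blinfun_apply id_blinfun y"
      using fun_cong[OF k(2), of y] by (simp add: D bounded_linear_Blinfun_apply[OF bk])
  qed
  have der: "(graph_map has_derivative blinfun_apply (Blinfun (graph_map_deriv x))) (at x)" for x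
    unfolding D by (rule has_derivative_graph_map)
  obtain U V g g' where "open U" and U: "(t\<^sub>0, z) \<in> U" and "open V" and "graph_map (t\<^sub>0, z) \<in> V"
    and hom: "homeomorphism U V graph_map g"
    by (rule inverse_function_theorem[OF open_UNIV der continuous_on_graph_map_deriv UNIV_I inv])
  have z0: "graph_map (t\<^sub>0, z) = (t\<^sub>0, 0)"
    using z by (simp only: graph_map_eq_iff)
  have gU: "g (graph_map x) = x" if "x \<in> U" for x
    using hom that by (simp add: homeomorphism_def)
  have gV: "graph_map (g y) = y" if "y \<in> V" for y
    using hom that by (simp add: homeomorphism_def)
  obtain e where e: "e > 0" "ball (t\<^sub>0, z) e \<subseteq> U"
    using \<open>open U\<close> U by (auto simp: open_contains_ball)
  have in_U: "(t, v) \<in> U" if "dist t t\<^sub>0 < e / 2" "dist v z < e / 2" for t v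
  proof -
    have "dist (t, v) (t\<^sub>0, z) \<le> dist t t\<^sub>0 + dist v z"
      unfolding dist_prod_def by (simp add: sqrt_sum_squares_le_sum)
    with that have "(t, v) \<in> ball (t\<^sub>0, z) e"
      by (simp add: dist_commute)
    with e(2) show ?thesis by blast
  qed
  show "\<exists>r>0. \<forall>t v v'. dist t t\<^sub>0 < r \<longrightarrow> dist v z < r \<longrightarrow> dist v' z < r \<longrightarrow>
      P t v = v \<longrightarrow> P t v' = v' \<longrightarrow> v = v'"
  proof (intro exI[of _ "e / 2"] conjI allI impI)
    fix t v v'
    assume d: "dist t t\<^sub>0 < e / 2" "dist v z < e / 2" "dist v' z < e / 2"
      and eq: "P t v = v" "P t v' = v'"
    have "graph_map (t, v) = (t, 0)" "graph_map (t, v') = (t, 0)"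
      using eq by (simp_all only: graph_map_eq_iff)
    then have "(t, v) = (t, v')"
      using gU[OF in_U[OF d(1,2)]] gU[OF in_U[OF d(1,3)]] by simp
    then show "v = v'" by simp
  qed (use e in simp)
  assume \<epsilon>: "\<epsilon> > 0"
  have cont: "continuous_on V g" using hom by (simp add: homeomorphism_def)
  have V0: "(t\<^sub>0, 0) \<in> V" using \<open>graph_map (t\<^sub>0, z) \<in> V\<close> z0 by simp
  have g0: "g (t\<^sub>0, 0) = (t\<^sub>0, z)" using gU[OF U] z0 by simp
  obtain \<delta>1 where \<delta>1: "\<delta>1 > 0" "\<And>x. x \<in> V \<Longrightarrow> dist x (t\<^sub>0, 0) < \<delta>1 \<Longrightarrow> dist (g x) (t\<^sub>0, z) < \<epsilon>"
    using cont[unfolded continuous_on_iff] V0 \<epsilon> g0 by metis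
  obtain \<delta>2 where \<delta>2: "\<delta>2 > 0" "ball (t\<^sub>0, 0) \<delta>2 \<subseteq> V"
    using \<open>open V\<close> V0 by (auto simp: open_contains_ball)
  show "\<exists>\<delta>>0. \<forall>t. dist t t\<^sub>0 < \<delta> \<longrightarrow> (\<exists>v. P t v = v \<and> dist v z < \<epsilon>)"
  proof (intro exI[of _ "min \<delta>1 \<delta>2"] conjI allI impI)
    fix t assume t: "dist t t\<^sub>0 < min \<delta>1 \<delta>2"
    have d: "dist (t, 0 :: complex ^ 'n) (t\<^sub>0, 0) = dist t t\<^sub>0"
      by (simp add: dist_prod_def)
    have "(t, 0 :: complex ^ 'n) \<in> ball (t\<^sub>0, 0) \<delta>2"
      using t d by (simp add: dist_commute)
    then have V: "(t, 0) \<in> V" using \<delta>2(2) by blast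
    obtain t' v where tv: "g (t, 0) = (t', v)" by (cases "g (t, 0)")
    have eq: "graph_map (t', v) = (t, 0)" using gV[OF V] tv by simp
    then have "t' = t" by (simp add: graph_map_def)
    with eq have "P t v = v" by (simp only: graph_map_eq_iff)
    moreover have "dist (g (t, 0)) (t\<^sub>0, z) < \<epsilon>"
      by (rule \<delta>1(2)[OF V]) (use t d in simp)
    then have "dist v z < \<epsilon>"
      using dist_snd_le[of "(t', v)" "(t\<^sub>0, z)"] tv by simp
    ultimately show "\<exists>v. P t v = v \<and> dist v z < \<epsilon>" by blast
  qed (use \<delta>1 \<delta>2 in simp)
qed

text \<open>On the unit sphere \<open>P t\<close> is bounded below by some \<open>c > 0\<close> for
  \<open>t\<close> near \<open>t\<^sub>0\<close>. For a fixed point of norm r > 1, homogeneity gives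
  r \<ge> r^2 c, hence r \<le> 1 / c.\<close>

lemma fixed_points_bounded:
  assumes "hsop (P t\<^sub>0)"
  shows "\<exists>R. \<exists>\<delta>>0. \<forall>t v. dist t t\<^sub>0 < \<delta> \<longrightarrow> P t v = v \<longrightarrow> norm v \<le> R"
proof -
  have P: "P t v = \<Theta>\<^sub>0 v + t *s (\<Theta>\<^sub>1 v - \<Theta>\<^sub>0 v)" for t v
    by (simp add: pencil_def vec_eq_iff algebra_simps)
  have "\<exists>c>0. \<exists>\<delta>>0. \<forall>t. dist t t\<^sub>0 < \<delta> \<longrightarrow>
    (\<forall>v\<in>sphere 0 1. c \<le> norm (\<Theta>\<^sub>0 v + t *s (\<Theta>\<^sub>1 v - \<Theta>\<^sub>0 v)))"
  proof (rule affine_family_lower_bound)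
    show "compact (sphere (0 :: complex ^ 'n) 1)" by simp
    show "continuous_on (sphere 0 1) \<Theta>\<^sub>0" "continuous_on (sphere 0 1) (\<lambda>v. \<Theta>\<^sub>1 v - \<Theta>\<^sub>0 v)"
      by (intro continuous_on_diff continuous_on_poly_map A.component_poly_funs
          B.component_poly_funs)+
    fix v :: "complex ^ 'n" assume v: "v \<in> sphere 0 1"
    show "\<Theta>\<^sub>0 v + t\<^sub>0 *s (\<Theta>\<^sub>1 v - \<Theta>\<^sub>0 v) \<noteq> 0"
      unfolding P[symmetric] using assms v by (auto simp: P.hsop_iff)
  qed
  then obtain c \<delta> where c: "c > 0" "\<delta> > 0"
    "\<And>t v. dist t t\<^sub>0 < \<delta> \<Longrightarrow> norm v = 1 \<Longrightarrow> c \<le> norm (P t v)"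
    unfolding P by auto
  have "norm v \<le> max 1 (1 / c)" if t: "dist t t\<^sub>0 < \<delta>" and v: "P t v = v" for t v
  proof (cases "norm v \<le> 1")
    case False
    define r where "r = norm v"
    have r: "r > 1" using False by (simp add: r_def)
    then have v0: "v \<noteq> 0" by (auto simp: r_def)
    define u where "u = of_real (1 / r) *s v"
    have u: "norm u = 1"
      using v0 by (simp add: u_def norm_vector_scalar_mult r_def norm_divide)
    have vu: "v = of_real r *s u"
      using v0 by (simp add: u_def r_def vec_eq_iff)
    have "P t v = of_real r ^ d *s P t u"
      using poly_funs_deg_homogeneous[OF P.deg[of t], of "of_real r" u]
      by (simp add: vec_eq_iff vu)
    then have "r = r ^ d * norm (P t u)"
      using v r by (metis norm_of_real norm_vector_scalar_mult norm_power abs_of_pos less_trans zero_less_one r_def)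
    moreover have "r ^ d * norm (P t u) \<ge> r ^ 2 * c"
      using r A.d_ge_2 c(1) c(3)[OF t u] by (intro mult_mono power_increasing) simp_all
    ultimately have "r * (r * c) \<le> r * 1"
      by (simp add: power2_eq_square mult.assoc)
    then have "r * c \<le> 1"
      using r by (subst (asm) mult_le_cancel_left_pos) simp_all
    then have "r \<le> 1 / c"
      using c(1) by (simp add: field_simps)
    then show ?thesis by (simp add: r_def)
  qed simp
  with c(2) show ?thesis by blast
qed

text \<open>Fixed points of nearby maps stay in one ball. Removing from it the open \<epsilon>-balls
  around the fixed points of \<open>P t\<^sub>0\<close> leaves a compact set, on which
  \<open>P t v - v\<close> stays away from zero.\<close>

lemma fixed_points_close:
  assumes hs: "hsop (P t\<^sub>0)" and \<epsilon>: "\<epsilon> > 0"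
  shows "\<exists>\<delta>>0. \<forall>t v. dist t t\<^sub>0 < \<delta> \<longrightarrow> P t v = v \<longrightarrow> (\<exists>z. P t\<^sub>0 z = z \<and> dist v z < \<epsilon>)"
proof -
  obtain R \<delta>1 where R: "\<delta>1 > 0" "\<And>t v. dist t t\<^sub>0 < \<delta>1 \<Longrightarrow> P t v = v \<Longrightarrow> norm v \<le> R"
    using fixed_points_bounded[OF hs] by auto
  define K where "K = cball 0 R - (\<Union>z\<in>{z. P t\<^sub>0 z = z}. ball z \<epsilon>)"
  have P: "P t v - v = (\<Theta>\<^sub>0 v - v) + t *s (\<Theta>\<^sub>1 v - \<Theta>\<^sub>0 v)" for t v
    by (simp add: pencil_def vec_eq_iff algebra_simps)
  have "\<exists>c>0. \<exists>\<delta>>0. \<forall>t. dist t t\<^sub>0 < \<delta> \<longrightarrow>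
    (\<forall>v\<in>K. c \<le> norm ((\<Theta>\<^sub>0 v - v) + t *s (\<Theta>\<^sub>1 v - \<Theta>\<^sub>0 v)))"
  proof (rule affine_family_lower_bound)
    show "compact K"
      unfolding K_def by (intro compact_diff compact_cball open_UN ballI open_ball)
    show "continuous_on K (\<lambda>v. \<Theta>\<^sub>0 v - v)" "continuous_on K (\<lambda>v. \<Theta>\<^sub>1 v - \<Theta>\<^sub>0 v)"
      by (intro continuous_on_diff continuous_on_poly_map A.component_poly_funs
          B.component_poly_funs continuous_on_id)+
    fix v assume v: "v \<in> K"
    show "(\<Theta>\<^sub>0 v - v) + t\<^sub>0 *s (\<Theta>\<^sub>1 v - \<Theta>\<^sub>0 v) \<noteq> 0"
    proof
      assume "(\<Theta>\<^sub>0 v - v) + t\<^sub>0 *s (\<Theta>\<^sub>1 v - \<Theta>\<^sub>0 v) = 0"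
      then have "P t\<^sub>0 v = v" unfolding P[symmetric] by simp
      then have "v \<in> (\<Union>z\<in>{z. P t\<^sub>0 z = z}. ball z \<epsilon>)"
        using \<epsilon> by (intro UN_I[of v]) simp_all
      with v show False by (simp add: K_def)
    qed
  qed
  then obtain c \<delta>2 where c: "c > 0" "\<delta>2 > 0"
    "\<And>t v. dist t t\<^sub>0 < \<delta>2 \<Longrightarrow> v \<in> K \<Longrightarrow> c \<le> norm (P t v - v)"
    unfolding P by auto
  show ?thesis
  proof (intro exI[of _ "min \<delta>1 \<delta>2"] conjI allI impI)
    fix t v assume t: "dist t t\<^sub>0 < min \<delta>1 \<delta>2" and v: "P t v = v"
    have "v \<notin> K"
      using c(1) c(3)[of t v] t v by auto
    moreover have "v \<in> cball 0 R"
      using R(2)[of t v] t v by simp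
    ultimately have "v \<in> (\<Union>z\<in>{z. P t\<^sub>0 z = z}. ball z \<epsilon>)"
      by (simp add: K_def)
    then show "\<exists>z. P t\<^sub>0 z = z \<and> dist v z < \<epsilon>"
      by (auto simp: dist_commute)
  qed (use R(1) c(2) in simp)
qed

section \<open>Equivariant equivalence of fixed point sets along the pencil\<close>

definition equivalent_at ::
    "(complex ^ 'n \<Rightarrow> complex ^ 'n) set \<Rightarrow> complex \<Rightarrow> complex \<Rightarrow> bool" where
  "equivalent_at \<A> s t \<longleftrightarrow> (\<exists>\<psi>. bij_betw \<psi> {v. P s v = v} {v. P t v = v} \<and>
     (\<forall>a\<in>\<A>. \<forall>v. P s v = v \<longrightarrow> \<psi> (a v) = a (\<psi> v)))"

lemma equivalent_at_sym:
  assumes pres: "\<And>a v. a \<in> \<A> \<Longrightarrow> P s v = v \<Longrightarrow> P s (a v) = a v"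
    and "equivalent_at \<A> s t"
  shows "equivalent_at \<A> t s"
proof -
  obtain \<psi> where \<psi>: "bij_betw \<psi> {v. P s v = v} {v. P t v = v}"
    "\<forall>a\<in>\<A>. \<forall>v. P s v = v \<longrightarrow> \<psi> (a v) = a (\<psi> v)"
    using assms(2) unfolding equivalent_at_def by auto
  let ?\<phi> = "the_inv_into {v. P s v = v} \<psi>"
  have inj: "inj_on \<psi> {v. P s v = v}" and im: "\<psi> ` {v. P s v = v} = {v. P t v = v}"
    using \<psi>(1) by (auto simp: bij_betw_def)
  have "?\<phi> (a w) = a (?\<phi> w)" if a: "a \<in> \<A>" and w: "P t w = w" for a w
  proof -
    obtain v where v: "P s v = v" "w = \<psi> v"
      using w im by blast
    have "?\<phi> (a w) = ?\<phi> (\<psi> (a v))" using \<psi>(2) a v by simp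
    also have "\<dots> = a v" using the_inv_into_f_f[OF inj] pres[OF a v(1)] by simp
    also have "v = ?\<phi> w" using the_inv_into_f_f[OF inj] v by simp
    finally show ?thesis .
  qed
  then show ?thesis
    unfolding equivalent_at_def using bij_betw_the_inv_into[OF \<psi>(1)] by blast
qed

lemma equivalent_at_trans:
  assumes "equivalent_at \<A> r s" "equivalent_at \<A> s t"
  shows "equivalent_at \<A> r t"
proof -
  obtain \<psi> where \<psi>: "bij_betw \<psi> {v. P r v = v} {v. P s v = v}"
    "\<forall>a\<in>\<A>. \<forall>v. P r v = v \<longrightarrow> \<psi> (a v) = a (\<psi> v)"
    using assms(1) unfolding equivalent_at_def by auto
  obtain \<phi> where \<phi>: "bij_betw \<phi> {v. P s v = v} {v. P t v = v}"
    "\<forall>a\<in>\<A>. \<forall>v. P s v = v \<longrightarrow> \<phi> (a v) = a (\<phi> v)"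
    using assms(2) unfolding equivalent_at_def by auto
  have "P s (\<psi> v) = \<psi> v" if "P r v = v" for v
    using bij_betwE[OF \<psi>(1)] that by auto
  then have "\<forall>a\<in>\<A>. \<forall>v. P r v = v \<longrightarrow> (\<phi> \<circ> \<psi>) (a v) = a ((\<phi> \<circ> \<psi>) v)"
    using \<psi>(2) \<phi>(2) by simp
  then show ?thesis
    unfolding equivalent_at_def using bij_betw_trans[OF \<psi>(1) \<phi>(1)] by blast
qed

text \<open>A fixed point \<open>v\<close> of \<open>P t\<close> is sent to the only fixed point of
  \<open>P t\<^sub>0\<close> within \<epsilon> of it. An isometry \<open>a\<close> that preserves
  the fixed point sets moves this pair to another pair at distance below \<epsilon>, so uniqueness
  forces equivariance.\<close>

lemma equivalent_at_near:
  assumes hs: "hsop (P t\<^sub>0)" and nd: "nondegenerate (P t\<^sub>0)"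
    and isom: "\<And>a u v. a \<in> \<A> \<Longrightarrow> dist (a u) (a v) = dist u v"
    and pres: "\<And>a t v. a \<in> \<A> \<Longrightarrow> P t v = v \<Longrightarrow> P t (a v) = a v"
  shows "\<exists>\<delta>>0. \<forall>t. dist t t\<^sub>0 < \<delta> \<longrightarrow> equivalent_at \<A> t t\<^sub>0"
proof -
  let ?Z = "\<lambda>t. {v. P t v = v}"
  have fin: "finite (?Z t\<^sub>0)" by (rule P.finite_fixed_points[OF hs])
  have J: "jac (P t\<^sub>0) z \<noteq> 0" if "z \<in> ?Z t\<^sub>0" for z
    using nd that by (simp add: nondegenerate_def)
  have "\<exists>r>0. \<forall>z\<in>?Z t\<^sub>0. \<forall>t v v'. dist t t\<^sub>0 < r \<longrightarrow> dist v z < r \<longrightarrow> dist v' z < r \<longrightarrow>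
      P t v = v \<longrightarrow> P t v' = v' \<longrightarrow> v = v'"
  proof (rule common_radius[OF fin])
    fix z assume z: "z \<in> ?Z t\<^sub>0"
    show "\<exists>r>0. \<forall>t v v'. dist t t\<^sub>0 < r \<longrightarrow> dist v z < r \<longrightarrow> dist v' z < r \<longrightarrow>
      P t v = v \<longrightarrow> P t v' = v' \<longrightarrow> v = v'"
      by (rule local_fixed_points(1)[OF _ J[OF z]]) (use z in simp)
  qed (meson less_le_trans)
  then obtain r where r: "r > 0" "\<And>z t v v'. P t\<^sub>0 z = z \<Longrightarrow> dist t t\<^sub>0 < r \<Longrightarrow> dist v z < r \<Longrightarrow>
      dist v' z < r \<Longrightarrow> P t v = v \<Longrightarrow> P t v' = v' \<Longrightarrow> v = v'"
    by auto
  have "\<exists>s>0. \<forall>z\<in>?Z t\<^sub>0. \<forall>w\<in>?Z t\<^sub>0. w \<noteq> z \<longrightarrow> s \<le> dist z w"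
    by (rule common_radius[OF fin finite_set_avoid[OF fin]]) (meson order_trans)
  then obtain s where s: "s > 0" "\<And>z w. P t\<^sub>0 z = z \<Longrightarrow> P t\<^sub>0 w = w \<Longrightarrow> dist z w < s \<Longrightarrow> w = z"
    by force
  \<comment> \<open>Being at most \<open>r\<close> makes the assignment injective; being at most
    \<open>s / 2\<close> makes its value unique, since two candidates would be less than
    \<open>s\<close> apart.\<close>
  define \<epsilon> where "\<epsilon> = min r (s / 2)"
  have \<epsilon>: "\<epsilon> > 0" "\<epsilon> \<le> r" "2 * \<epsilon> \<le> s" using r(1) s(1) by (simp_all add: \<epsilon>_def)
  obtain \<delta>1 where \<delta>1: "\<delta>1 > 0"
    "\<And>t v. dist t t\<^sub>0 < \<delta>1 \<Longrightarrow> P t v = v \<Longrightarrow> \<exists>z. P t\<^sub>0 z = z \<and> dist v z < \<epsilon>"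
    using fixed_points_close[OF hs \<epsilon>(1)] by auto
  have "\<exists>\<delta>>0. \<forall>z\<in>?Z t\<^sub>0. \<forall>t. dist t t\<^sub>0 < \<delta> \<longrightarrow> (\<exists>v. P t v = v \<and> dist v z < \<epsilon>)"
  proof (rule common_radius[OF fin])
    fix z assume z: "z \<in> ?Z t\<^sub>0"
    show "\<exists>\<delta>>0. \<forall>t. dist t t\<^sub>0 < \<delta> \<longrightarrow> (\<exists>v. P t v = v \<and> dist v z < \<epsilon>)"
      by (rule local_fixed_points(2)[OF _ J[OF z] \<epsilon>(1)]) (use z in simp)
  qed (meson less_le_trans)
  then obtain \<delta>2 where \<delta>2: "\<delta>2 > 0"
    "\<And>z t. P t\<^sub>0 z = z \<Longrightarrow> dist t t\<^sub>0 < \<delta>2 \<Longrightarrow> \<exists>v. P t v = v \<and> dist v z < \<epsilon>"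
    by auto
  have uniq: "w = z" if "P t\<^sub>0 z = z" "P t\<^sub>0 w = w" "dist v z < \<epsilon>" "dist v w < \<epsilon>" for v z w
  proof (rule s(2)[OF that(1,2)])
    show "dist z w < s"
      using dist_triangle2[of z w v] that(3,4) \<epsilon>(3) by (simp add: dist_commute)
  qed
  show ?thesis
  proof (intro exI[of _ "min r (min \<delta>1 \<delta>2)"] conjI allI impI)
    fix t assume t: "dist t t\<^sub>0 < min r (min \<delta>1 \<delta>2)"
    have "\<forall>v. \<exists>z. P t v = v \<longrightarrow> P t\<^sub>0 z = z \<and> dist v z < \<epsilon>"
      using \<delta>1(2)[of t] t by auto
    from choice[OF this] obtain \<psi> where
      \<psi>: "\<forall>v. P t v = v \<longrightarrow> P t\<^sub>0 (\<psi> v) = \<psi> v \<and> dist v (\<psi> v) < \<epsilon>" ..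
    have eq: "\<psi> v = z" if "P t v = v" "P t\<^sub>0 z = z" "dist v z < \<epsilon>" for v z
      using uniq[OF that(2) _ that(3), of "\<psi> v"] \<psi> that(1) by simp
    have "bij_betw \<psi> (?Z t) (?Z t\<^sub>0)"
      unfolding bij_betw_def
    proof
      show "inj_on \<psi> (?Z t)"
      proof (rule inj_onI)
        fix v v' assume v: "v \<in> ?Z t" "v' \<in> ?Z t" "\<psi> v = \<psi> v'"
        then have "P t\<^sub>0 (\<psi> v) = \<psi> v" "dist v (\<psi> v) < r" "dist v' (\<psi> v) < r"
          using \<psi> \<epsilon>(2) by (auto intro: less_le_trans)
        then show "v = v'"
          using r(2)[of "\<psi> v" t v v'] t v(1,2) by simp
      qed
      show "\<psi> ` ?Z t = ?Z t\<^sub>0"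
      proof
        show "\<psi> ` ?Z t \<subseteq> ?Z t\<^sub>0" using \<psi> by auto
        show "?Z t\<^sub>0 \<subseteq> \<psi> ` ?Z t"
        proof
          fix z assume z: "z \<in> ?Z t\<^sub>0"
          then obtain v where "P t v = v" "dist v z < \<epsilon>"
            using \<delta>2(2)[of z t] t by auto
          with eq z show "z \<in> \<psi> ` ?Z t" by (intro image_eqI[of _ _ v]) auto
        qed
      qed
    qed
    moreover have "\<psi> (a v) = a (\<psi> v)" if a: "a \<in> \<A>" and v: "P t v = v" for a v
    proof (rule eq)
      show "P t (a v) = a v" "P t\<^sub>0 (a (\<psi> v)) = a (\<psi> v)"
        using pres[OF a] v \<psi> by simp_all
      show "dist (a v) (a (\<psi> v)) < \<epsilon>"
        using isom[OF a] v \<psi> by simp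
    qed
    ultimately show "equivalent_at \<A> t t\<^sub>0"
      unfolding equivalent_at_def by (intro exI[of _ \<psi>]) simp
  qed (use r(1) \<delta>1(1) \<delta>2(1) in simp)
qed

text \<open>Equivalence is locally constant by \<open>equivalent_at_near\<close>, and a connected
  set has a single class of such a relation.\<close>

lemma equivalent_at_connected:
  assumes T: "connected T" "s \<in> T" "t \<in> T"
    and good: "\<And>t. t \<in> T \<Longrightarrow> hsop (P t) \<and> nondegenerate (P t)"
    and isom: "\<And>a u v. a \<in> \<A> \<Longrightarrow> dist (a u) (a v) = dist u v"
    and pres: "\<And>a t v. a \<in> \<A> \<Longrightarrow> P t v = v \<Longrightarrow> P t (a v) = a v"
  shows "equivalent_at \<A> s t"
proof (rule connected_equivalence_relation[OF T])
  show "equivalent_at \<A> y x" if "equivalent_at \<A> x y" for x y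
    using that by (rule equivalent_at_sym[rotated]) (rule pres)
  show "equivalent_at \<A> x z" if "equivalent_at \<A> x y" "equivalent_at \<A> y z" for x y z
    by (rule equivalent_at_trans[OF that])
  fix a assume "a \<in> T"
  have "\<exists>\<delta>>0. \<forall>t. dist t a < \<delta> \<longrightarrow> equivalent_at \<A> t a"
  proof (rule equivalent_at_near)
    show "hsop (P a)" "nondegenerate (P a)"
      using good[OF \<open>a \<in> T\<close>] by simp_all
    show "dist (b u) (b v) = dist u v" if "b \<in> \<A>" for b u v
      using that by (rule isom)
    show "P t (b v) = b v" if "b \<in> \<A>" "P t v = v" for b t v
      using that by (rule pres)
  qed
  then obtain \<delta> where \<delta>: "\<delta> > 0" "\<And>t. dist t a < \<delta> \<Longrightarrow> equivalent_at \<A> t a" by auto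
  show "\<exists>U. openin (top_of_set T) U \<and> a \<in> U \<and> (\<forall>x\<in>U. equivalent_at \<A> a x)"
  proof (intro exI[of _ "T \<inter> ball a \<delta>"] conjI ballI)
    show "openin (top_of_set T) (T \<inter> ball a \<delta>)" by (intro openin_open_Int open_ball)
    show "a \<in> T \<inter> ball a \<delta>" using \<open>a \<in> T\<close> \<delta>(1) by simp
    fix x assume "x \<in> T \<inter> ball a \<delta>"
    then have "equivalent_at \<A> x a" by (intro \<delta>(2)) (simp add: dist_commute)
    then show "equivalent_at \<A> a x" by (rule equivalent_at_sym[rotated]) (rule pres)
  qed
qed

end

text \<open>A linear functional on \<open>H\<close> is affine in \<open>t\<close> along the line,
  because its value there is determined by the values at the two members of \<open>H\<close>. Sums
  and products of polynomials in \<open>t\<close> are again such polynomials.\<close>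

lemma polynomials_on_pencil:
  assumes H: "\<Theta>\<^sub>0 \<in> H" "\<Theta>\<^sub>1 \<in> H" and p: "p \<in> polynomials_on H"
  shows "\<exists>q :: complex Polynomial.poly. \<forall>t. p (pencil \<Theta>\<^sub>0 \<Theta>\<^sub>1 t) = Polynomial.poly q t"
  using p
proof induction
  case (const a)
  show ?case by (intro exI[of _ "[:a:]"]) simp
next
  case (linear l)
  have "l (\<lambda>v. a *s \<Theta>\<^sub>0 v + b *s \<Theta>\<^sub>1 v) = a * l \<Theta>\<^sub>0 + b * l \<Theta>\<^sub>1" for a b
    using linear H unfolding linear_functionals_on_def by simp
  then have "l (pencil \<Theta>\<^sub>0 \<Theta>\<^sub>1 t) = (1 - t) * l \<Theta>\<^sub>0 + t * l \<Theta>\<^sub>1" for t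
    by (simp only: pencil_def[abs_def])
  then show ?case
    by (intro exI[of _ "[:l \<Theta>\<^sub>0, l \<Theta>\<^sub>1 - l \<Theta>\<^sub>0:]"]) (simp add: algebra_simps)
next
  case (add p q)
  then obtain a b where "\<forall>t. p (pencil \<Theta>\<^sub>0 \<Theta>\<^sub>1 t) = Polynomial.poly a t"
    "\<forall>t. q (pencil \<Theta>\<^sub>0 \<Theta>\<^sub>1 t) = Polynomial.poly b t" by auto
  then show ?case by (intro exI[of _ "a + b"]) simp
next
  case (mult p q)
  then obtain a b where "\<forall>t. p (pencil \<Theta>\<^sub>0 \<Theta>\<^sub>1 t) = Polynomial.poly a t"
    "\<forall>t. q (pencil \<Theta>\<^sub>0 \<Theta>\<^sub>1 t) = Polynomial.poly b t" by auto
  then show ?case by (intro exI[of _ "a * b"]) simp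
qed

section \<open>The theorem\<close>

lemma equivariant_maps_homogeneous:
  assumes "\<Theta> \<in> equivariant_maps W d" "d \<ge> 2"
  shows "homogeneous_map \<Theta> d"
proof
  fix i
  have "(\<lambda>v. v $ i) \<circ> \<Theta> \<in> poly_funs_deg d"
    using assms(1) dual_space_coord[of i] by (simp add: equivariant_maps_def)
  then show "(\<lambda>v. \<Theta> v $ i) \<in> poly_funs_deg d" by (simp add: comp_def)
qed (rule assms(2))

lemma pencil_equivariant:
  assumes "\<Theta>\<^sub>0 \<in> equivariant_maps W d" "\<Theta>\<^sub>1 \<in> equivariant_maps W d"
  shows "pencil \<Theta>\<^sub>0 \<Theta>\<^sub>1 t \<in> equivariant_maps W d"
  unfolding equivariant_maps_def
proof (intro CollectI conjI ballI allI)
  fix x :: "complex ^ 'a \<Rightarrow> complex" assume x: "x \<in> dual_space"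
  have "(\<lambda>v. (1 - t) * x (\<Theta>\<^sub>0 v) + t * x (\<Theta>\<^sub>1 v)) \<in> poly_funs_deg d"
    using assms x by (intro poly_funs_deg_add poly_funs_deg_cmult)
      (simp_all add: equivariant_maps_def comp_def)
  then show "x \<circ> pencil \<Theta>\<^sub>0 \<Theta>\<^sub>1 t \<in> poly_funs_deg d"
    by (simp only: comp_def pencil_def dual_space_lincomb[OF x])
next
  fix w v assume "w \<in> W"
  then have "\<Theta>\<^sub>0 (cact w v) = cact w (\<Theta>\<^sub>0 v)" "\<Theta>\<^sub>1 (cact w v) = cact w (\<Theta>\<^sub>1 v)"
    using assms by (simp_all add: equivariant_maps_def)
  then show "pencil \<Theta>\<^sub>0 \<Theta>\<^sub>1 t (cact w v) = cact w (pencil \<Theta>\<^sub>0 \<Theta>\<^sub>1 t v)"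
    by (simp only: pencil_def cact_lincomb)
qed

lemma locus_act_isometry:
  assumes "orthogonal_matrix w"
  shows "dist (locus_act W c k (w, m) u) (locus_act W c k (w, m) v) = dist u v"
proof -
  let ?z = "exp (2 * of_real pi * \<i> / of_nat (k * coxeter_number W c)) ^ nat m :: complex"
  have "norm (exp (2 * of_real pi * \<i> / of_nat n)) = 1" for n
    by (simp add: norm_exp_eq_Re)
  then have z: "norm ?z = 1"
    by (simp add: norm_power)
  have "?z *s cact w u - ?z *s cact w v = ?z *s (cact w u - cact w v)"
    by (simp add: vec_eq_iff algebra_simps)
  then have "dist (?z *s cact w u) (?z *s cact w v) = dist u v"
    using dist_cact[OF assms, of u v] by (simp only: dist_norm norm_vector_scalar_mult z mult_1)
  then show ?thesis
    by (simp only: locus_act_def case_prod_conv)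
qed

text \<open>The scalar has order dividing kh, so its power kh + 1, produced by homogeneity, is the
  scalar itself.\<close>

lemma locus_act_fixed_point:
  assumes \<Theta>: "\<Theta> \<in> equivariant_maps W (k * coxeter_number W c + 1)"
    and pos: "k * coxeter_number W c \<ge> 1" and w: "w \<in> W" and v: "\<Theta> v = v"
  shows "\<Theta> (locus_act W c k (w, m) v) = locus_act W c k (w, m) v"
proof -
  define N where "N = k * coxeter_number W c"
  interpret homogeneous_map \<Theta> "N + 1"
    by (rule equivariant_maps_homogeneous[OF \<Theta>[folded N_def]]) (use pos in \<open>simp add: N_def\<close>)
  let ?e = "exp (2 * of_real pi * \<i> / of_nat N) :: complex"
  have N: "N \<noteq> 0" using pos by (simp add: N_def)
  have "?e ^ N = exp (of_nat N * (2 * of_real pi * \<i> / of_nat N))"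
    by (rule exp_of_nat_mult[symmetric])
  also have "\<dots> = 1"
    using N by simp
  finally have e: "?e ^ N = 1" .
  let ?z = "?e ^ nat m"
  have "?z ^ (N + 1) = (?e ^ N) ^ nat m * ?z"
    by (simp add: power_add mult.commute flip: power_mult)
  then have z: "?z ^ (N + 1) = ?z" using e by simp
  have "\<Theta> (?z *s cact w v) = ?z ^ (N + 1) *s \<Theta> (cact w v)"
    using poly_funs_deg_homogeneous[OF deg, of ?z "cact w v"] by (simp add: vec_eq_iff)
  also have "\<dots> = ?z *s cact w v"
    using \<Theta> w v unfolding z by (simp add: equivariant_maps_def)
  finally show ?thesis
    by (simp add: locus_act_def N_def)
qed

context
  fixes W :: "(real ^ 'n ^ 'n) set" and c :: "real ^ 'n ^ 'n" and k :: nat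
  assumes W: "real_reflection_group W" and c: "coxeter_element W c" and k: "k \<ge> 1"
begin

lemma degree_pos: "k * coxeter_number W c \<ge> 1"
  using coxeter_number_pos[OF W c] k by (simp add: Suc_le_eq)

lemma parking_maps_homogeneous:
  "\<Theta> \<in> parking_maps W c k \<Longrightarrow> homogeneous_map \<Theta> (k * coxeter_number W c + 1)"
  unfolding parking_maps_def
  by (rule equivariant_maps_homogeneous) (use degree_pos in simp_all)

lemma reduced_hsops_iff:
  assumes "\<Theta> \<in> parking_maps W c k"
  shows "\<Theta> \<in> reduced_hsops W c k \<longleftrightarrow> hsop \<Theta> \<and> nondegenerate \<Theta>"
proof -
  interpret homogeneous_map \<Theta> "k * coxeter_number W c + 1"
    by (rule parking_maps_homogeneous[OF assms])
  show ?thesis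
    using assms radical_imp_nondegenerate nondegenerate_imp_radical
    by (auto simp: reduced_hsops_def parking_locus_reduced_iff)
qed

lemma reduced_hsops_open:
  assumes "\<Theta> \<in> reduced_hsops W c k"
  shows "\<exists>p\<in>polynomials_on (parking_maps W c k). p \<Theta> \<noteq> 0 \<and>
    (\<forall>\<Theta>'\<in>parking_maps W c k. p \<Theta>' \<noteq> 0 \<longrightarrow> hsop \<Theta>' \<and> nondegenerate \<Theta>')"
proof -
  interpret homogeneous_family "parking_maps W c k" "k * coxeter_number W c + 1"
    by (rule homogeneous_family.intro) (rule parking_maps_homogeneous)
  have \<Theta>: "\<Theta> \<in> parking_maps W c k"
    using assms by (simp add: reduced_hsops_def)
  show ?thesis
    using nondegenerate_hsop_open[OF \<Theta>] assms reduced_hsops_iff[OF \<Theta>] by simp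
qed

text \<open>The transfer from one member to another: the equivariant bijection between the two loci,
  obtained by deformation, is composed with the given one onto the parking functions.\<close>

lemma reduced_hsops_equivalent:
  assumes \<Theta>0: "\<Theta>\<^sub>0 \<in> reduced_hsops W c k" and \<Theta>1: "\<Theta>\<^sub>1 \<in> reduced_hsops W c k"
    and eq: "locus_equivalent_to_park W c k \<Theta>\<^sub>0"
  shows "locus_equivalent_to_park W c k \<Theta>\<^sub>1"
proof -
  let ?H = "parking_maps W c k"
  have H: "\<Theta>\<^sub>0 \<in> ?H" "\<Theta>\<^sub>1 \<in> ?H"
    using \<Theta>0 \<Theta>1 by (simp_all add: reduced_hsops_def)
  interpret homogeneous_pencil \<Theta>\<^sub>0 \<Theta>\<^sub>1 "k * coxeter_number W c + 1"
    by (intro homogeneous_pencil.intro parking_maps_homogeneous H)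
  have PH: "P t \<in> ?H" for t
    using pencil_equivariant H unfolding parking_maps_def by blast
  obtain p0 where p0: "p0 \<in> polynomials_on ?H" "p0 \<Theta>\<^sub>0 \<noteq> 0"
    "\<forall>\<Theta>'\<in>?H. p0 \<Theta>' \<noteq> 0 \<longrightarrow> hsop \<Theta>' \<and> nondegenerate \<Theta>'"
    using reduced_hsops_open[OF \<Theta>0] by (elim bexE conjE)
  obtain p1 where p1: "p1 \<in> polynomials_on ?H" "p1 \<Theta>\<^sub>1 \<noteq> 0"
    "\<forall>\<Theta>'\<in>?H. p1 \<Theta>' \<noteq> 0 \<longrightarrow> hsop \<Theta>' \<and> nondegenerate \<Theta>'"
    using reduced_hsops_open[OF \<Theta>1] by (elim bexE conjE)
  obtain q0 where q0: "\<forall>t. p0 (P t) = Polynomial.poly q0 t"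
    using polynomials_on_pencil[OF H p0(1)] ..
  obtain q1 where q1: "\<forall>t. p1 (P t) = Polynomial.poly q1 t"
    using polynomials_on_pencil[OF H p1(1)] ..
  have P01: "P 0 = \<Theta>\<^sub>0" "P 1 = \<Theta>\<^sub>1"
    by (simp_all add: pencil_def fun_eq_iff)
  \<comment> \<open>A parameter is kept if at least one of the two certificates is nonzero there.
    This retains both endpoints, each through its own certificate, and as \<open>q0\<close> is
    nonzero only finitely many parameters are lost.\<close>
  define T where "T = UNIV - {t. Polynomial.poly q0 t = 0 \<and> Polynomial.poly q1 t = 0}"
  have "q0 \<noteq> 0" using p0(2) q0[THEN spec, of 0] P01(1) by auto
  then have "finite {t. Polynomial.poly q0 t = 0 \<and> Polynomial.poly q1 t = 0}"
    by (rule finite_subset[OF _ poly_roots_finite, rotated]) auto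
  then have conn: "connected T"
    unfolding T_def by (intro connected_open_delete_finite open_UNIV connected_UNIV) simp_all
  have T0: "0 \<in> T" using p0(2) q0[THEN spec, of 0] P01(1) by (simp add: T_def)
  have T1: "1 \<in> T" using p1(2) q1[THEN spec, of 1] P01(2) by (simp add: T_def)
  let ?A = "locus_act W c k ` carrier (acting_group W c k)"
  have carr: "fst g \<in> W" if "g \<in> carrier (acting_group W c k)" for g
    using that by (auto simp: acting_group_def DirProd_def subgroup_of_def)
  \<comment> \<open>The direction from 1 to 0 gives a map out of the locus of
    \<open>\<Theta>\<^sub>1\<close>, ready for composition with the bijection given at
    \<open>\<Theta>\<^sub>0\<close>.\<close>
  have "equivalent_at ?A 1 0"
  proof (rule equivalent_at_connected[OF conn T1 T0])
    show "hsop (P t) \<and> nondegenerate (P t)" if "t \<in> T" for t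
      using that p0(3) p1(3) q0 q1 PH[of t] by (auto simp: T_def)
    show "dist (a u) (a v) = dist u v" if "a \<in> ?A" for a u v
    proof -
      obtain w m where "a = locus_act W c k (w, m)" "w \<in> W"
        using \<open>a \<in> ?A\<close> carr by fastforce
      with locus_act_isometry reflection_group_orthogonal[OF W] show ?thesis by blast
    qed
    show "P t (a v) = a v" if a: "a \<in> ?A" and v: "P t v = v" for a t v
    proof -
      obtain w m where "a = locus_act W c k (w, m)" "w \<in> W"
        using \<open>a \<in> ?A\<close> carr by fastforce
      with locus_act_fixed_point[OF PH[of t, unfolded parking_maps_def] degree_pos _ v]
      show ?thesis by simp
    qed
  qed
  then obtain \<psi> where \<psi>: "bij_betw \<psi> (parking_locus \<Theta>\<^sub>1) (parking_locus \<Theta>\<^sub>0)"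
    "\<And>g v. g \<in> carrier (acting_group W c k) \<Longrightarrow> v \<in> parking_locus \<Theta>\<^sub>1 \<Longrightarrow>
      \<psi> (locus_act W c k g v) = locus_act W c k g (\<psi> v)"
    by (auto simp: equivalent_at_def P01 parking_locus_def)
  obtain \<phi> where \<phi>: "bij_betw \<phi> (parking_locus \<Theta>\<^sub>0) (Park_NC W c k)"
    "\<And>g v. g \<in> carrier (acting_group W c k) \<Longrightarrow> v \<in> parking_locus \<Theta>\<^sub>0 \<Longrightarrow>
      \<phi> (locus_act W c k g v) = park_act W c k g (\<phi> v)"
    using eq by (auto simp: locus_equivalent_to_park_def equivariant_bijection_def)
  show ?thesis
    unfolding locus_equivalent_to_park_def equivariant_bijection_def
  proof (intro exI[of _ "\<phi> \<circ> \<psi>"] conjI ballI)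
    show "bij_betw (\<phi> \<circ> \<psi>) (parking_locus \<Theta>\<^sub>1) (Park_NC W c k)"
      by (rule bij_betw_trans[OF \<psi>(1) \<phi>(1)])
    fix g v assume g: "g \<in> carrier (acting_group W c k)" and v: "v \<in> parking_locus \<Theta>\<^sub>1"
    have "\<psi> v \<in> parking_locus \<Theta>\<^sub>0"
      using bij_betwE[OF \<psi>(1)] v by blast
    then show "(\<phi> \<circ> \<psi>) (locus_act W c k g v) = park_act W c k g ((\<phi> \<circ> \<psi>) v)"
      by (simp add: \<psi>(2)[OF g v] \<phi>(2)[OF g])
  qed
qed

end

theorem theorem1p2:
  fixes W :: "(real ^ 'n ^ 'n) set" and c :: "real ^ 'n ^ 'n" and k :: nat
  assumes "irreducible_reflection_group W"
    and "coxeter_element W c"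
    and "k \<ge> 1"
  shows "intermediate_conjecture W c k \<longleftrightarrow> generic_strong_conjecture W c k"
proof
  have W: "real_reflection_group W"
    using assms(1) by (simp add: irreducible_reflection_group_def)
  let ?H = "parking_maps W c k"
  assume "intermediate_conjecture W c k"
  then obtain \<Theta> where \<Theta>: "\<Theta> \<in> reduced_hsops W c k" "locus_equivalent_to_park W c k \<Theta>"
    by (auto simp: intermediate_conjecture_def reduced_hsops_def)
  obtain p where p: "p \<in> polynomials_on ?H" "p \<Theta> \<noteq> 0"
    "\<forall>\<Theta>'\<in>?H. p \<Theta>' \<noteq> 0 \<longrightarrow> hsop \<Theta>' \<and> nondegenerate \<Theta>'"
    using reduced_hsops_open[OF W assms(2,3) \<Theta>(1)] by (elim bexE conjE)
  \<comment> \<open>The principal open set where the certificate of the given \<Theta> does not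
    vanish.\<close>
  let ?U = "?H - {\<Theta> \<in> ?H. \<forall>p\<in>{p}. p \<Theta> = 0}"
  have "zariski_open_in ?H ?U"
    unfolding zariski_open_in_def using p(1) by (intro exI[of _ "{p}"]) simp
  moreover have "\<Theta> \<in> ?U"
    using \<Theta>(1) p(2) by (simp add: reduced_hsops_def)
  moreover have "?U \<subseteq> reduced_hsops W c k"
    using p(3) reduced_hsops_iff[OF W assms(2,3)] by auto
  ultimately show "generic_strong_conjecture W c k"
    unfolding generic_strong_conjecture_def
    using reduced_hsops_equivalent[OF W assms(2,3) \<Theta>(1) _ \<Theta>(2)]
    by (intro conjI ballI exI[of _ ?U]) auto
next
  assume "generic_strong_conjecture W c k"
  then obtain U where U: "U \<noteq> {}" "U \<subseteq> reduced_hsops W c k"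
    and eq: "\<forall>\<Theta>\<in>reduced_hsops W c k. locus_equivalent_to_park W c k \<Theta>"
    by (auto simp: generic_strong_conjecture_def)
  \<comment> \<open>Nonemptiness of \<open>U\<close> supplies a reduced h.s.o.p.; the universally
    quantified clause alone could hold vacuously.\<close>
  then obtain \<Theta> where "\<Theta> \<in> reduced_hsops W c k" by auto
  with eq show "intermediate_conjecture W c k"
    by (auto simp: intermediate_conjecture_def reduced_hsops_def)
qed

end
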